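(* Let $E$ be one of the Banach spaces $c_0$ or $\ell_p$ with $1<p<\infty$ (with its standard norm). Let $f:E\to\mathbb{R}^d$ be a $C^1$ function and $\varepsilon:E\to(0,\infty)$ a continuous function. Let $U\subseteq E$ be any open set containing the critical set $C_f:=\{x\in E:\ Df(x)\ \text{is not surjective}\}$. Then there exists a $C^1$ function $\varphi:E\to\mathbb{R}^d$ such that: (1) $\|f(x)-\varphi(x)\|\leq\varepsilon(x)$ for all $x\in E$; (2) $f(x)=\varphi(x)$ for all $x\in E\setminus U$; (3) $D\varphi(x)$ is surjective for all $x\in E$, i.e. $\varphi$ has no critical points; and (4) in the case $E=c_0$, moreover $\|Df(x)-D\varphi(x)\|\leq\varepsilon(x)$ for all $x\in E$.
   Context: $\|\cdot\|$ on $\mathbb{R}^d$ denotes the Euclidean norm; for a linear map $E\to\mathbb{R}^d$, $\|\cdot\|$ is the operator norm. $Df(x)$ denotes the Fréchet derivative of $f$ at $x$. *)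

theory Defs
  imports "HOL-Analysis.Analysis"
begin

datatype seqspace = C0 | Lp real

definition valid_space :: "seqspace \<Rightarrow> bool" where
  "valid_space S = (case S of C0 \<Rightarrow> True | Lp p \<Rightarrow> 1 < p)"

definition sp_carrier :: "seqspace \<Rightarrow> (nat \<Rightarrow> real) set" where
  "sp_carrier S = (case S of
      C0 \<Rightarrow> {x. x \<longlonglongrightarrow> 0}
    | Lp p \<Rightarrow> {x. summable (\<lambda>n. \<bar>x n\<bar> powr p)})"

definition sp_norm :: "seqspace \<Rightarrow> (nat \<Rightarrow> real) \<Rightarrow> real" where
  "sp_norm S x = (case S of
      C0 \<Rightarrow> (SUP n. \<bar>x n\<bar>)
    | Lp p \<Rightarrow> (\<Sum>n. \<bar>x n\<bar> powr p) powr (1 / p))"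

text \<open>Bounded linear maps from the space into a normed space (only values on the carrier matter).\<close>
definition sp_bounded_linear :: "seqspace \<Rightarrow> ((nat \<Rightarrow> real) \<Rightarrow> 'b::real_normed_vector) \<Rightarrow> bool" where
  "sp_bounded_linear S L \<longleftrightarrow>
     (\<forall>u\<in>sp_carrier S. \<forall>v\<in>sp_carrier S. L (\<lambda>n. u n + v n) = L u + L v) \<and>
     (\<forall>c::real. \<forall>u\<in>sp_carrier S. L (\<lambda>n. c * u n) = c *\<^sub>R L u) \<and>
     (\<exists>K. \<forall>u\<in>sp_carrier S. norm (L u) \<le> K * sp_norm S u)"

definition sp_opnorm :: "seqspace \<Rightarrow> ((nat \<Rightarrow> real) \<Rightarrow> 'b::real_normed_vector) \<Rightarrow> real" where
  "sp_opnorm S L = Sup {norm (L u) | u. u \<in> sp_carrier S \<and> sp_norm S u \<le> 1}"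

definition sp_has_deriv :: "seqspace \<Rightarrow> ((nat \<Rightarrow> real) \<Rightarrow> 'b::real_normed_vector)
     \<Rightarrow> ((nat \<Rightarrow> real) \<Rightarrow> 'b) \<Rightarrow> (nat \<Rightarrow> real) \<Rightarrow> bool" where
  "sp_has_deriv S f L x \<longleftrightarrow> sp_bounded_linear S L \<and>
     (\<forall>e>0. \<exists>\<delta>>0. \<forall>h\<in>sp_carrier S. sp_norm S h < \<delta> \<longrightarrow>
         norm (f (\<lambda>n. x n + h n) - f x - L h) \<le> e * sp_norm S h)"

definition sp_deriv :: "seqspace \<Rightarrow> ((nat \<Rightarrow> real) \<Rightarrow> 'b::real_normed_vector)
     \<Rightarrow> (nat \<Rightarrow> real) \<Rightarrow> ((nat \<Rightarrow> real) \<Rightarrow> 'b)" where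
  "sp_deriv S f x = (SOME L. sp_has_deriv S f L x)"

definition sp_C1 :: "seqspace \<Rightarrow> ((nat \<Rightarrow> real) \<Rightarrow> 'b::real_normed_vector) \<Rightarrow> bool" where
  "sp_C1 S f \<longleftrightarrow> (\<exists>Df. (\<forall>x\<in>sp_carrier S. sp_has_deriv S f (Df x) x) \<and>
     (\<forall>x\<in>sp_carrier S. \<forall>e>0. \<exists>\<delta>>0. \<forall>y\<in>sp_carrier S. sp_norm S (\<lambda>n. y n - x n) < \<delta> \<longrightarrow>
         sp_opnorm S (\<lambda>u. Df y u - Df x u) \<le> e))"

definition sp_continuous :: "seqspace \<Rightarrow> ((nat \<Rightarrow> real) \<Rightarrow> real) \<Rightarrow> bool" where
  "sp_continuous S g \<longleftrightarrow> (\<forall>x\<in>sp_carrier S. \<forall>e>0. \<exists>\<delta>>0. \<forall>y\<in>sp_carrier S.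
      sp_norm S (\<lambda>n. y n - x n) < \<delta> \<longrightarrow> \<bar>g y - g x\<bar> < e)"

definition sp_open :: "seqspace \<Rightarrow> (nat \<Rightarrow> real) set \<Rightarrow> bool" where
  "sp_open S U \<longleftrightarrow> U \<subseteq> sp_carrier S \<and>
     (\<forall>x\<in>U. \<exists>r>0. \<forall>y\<in>sp_carrier S. sp_norm S (\<lambda>n. y n - x n) < r \<longrightarrow> y \<in> U)"

definition sp_surj :: "seqspace \<Rightarrow> ((nat \<Rightarrow> real) \<Rightarrow> 'b) \<Rightarrow> bool" where
  "sp_surj S L \<longleftrightarrow> L ` sp_carrier S = UNIV"

definition sp_critical :: "seqspace \<Rightarrow> ((nat \<Rightarrow> real) \<Rightarrow> 'b::real_normed_vector) \<Rightarrow> (nat \<Rightarrow> real) set" where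
  "sp_critical S f = {x \<in> sp_carrier S. \<not> sp_surj S (sp_deriv S f x)}"

end

theory Submission
  imports Defs "HOL-Library.Function_Algebras"
begin

text \<open>
  Let \<open>s n x\<close> be a smooth version of the norm of \<open>(x n, x (n + 1), \<dots>)\<close> and let \<open>r\<close> be a small
  Lipschitz function, positive exactly on \<open>U\<close>. Replacing the coordinates of \<open>x\<close> one after the
  other, with the \<open>n\<close>-th one damped to \<open>0\<close> as soon as \<open>s n x\<close> drops below \<open>r\<close>, gives a map \<open>\<Psi>\<close>
  close to the identity which takes its values locally in a finite-dimensional coordinate space.
  Only tail coordinates are changed and \<open>Df(x)\<close> is small on tails, so \<open>f \<circ> \<Psi>\<close> is \<open>C\<^sup>1\<close>-close to
  \<open>f\<close>. In \<open>\<ell>\<^sub>p\<close> a far coordinate \<open>m\<close> still enters \<open>D(f \<circ> \<Psi>)(y)\<close>, but only as a vector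
  independent of \<open>m\<close> times \<open>\<bar>y m\<bar> powr (p - 1) * sgn (y m)\<close>. Let \<open>\<Lambda>\<close> be the linear map
  sending the \<open>m\<close>-th unit vector to \<open>2\<^sup>-\<^sup>m u m\<close>, where \<open>u\<close> runs through all vectors plus or minus
  a coordinate axis infinitely often. If the coordinates of \<open>y\<close> are eventually positive, then a
  vector \<open>\<xi>\<close> orthogonal to the range of the derivative of \<open>(f - \<Lambda>) \<circ> \<Psi> + \<Lambda>\<close> at \<open>y\<close> would
  give \<open>a m * \<beta> + 2\<^sup>-\<^sup>m (\<xi> \<bullet> u m) = 0\<close> with \<open>a m > 0\<close> for all large \<open>m\<close>, which is impossible by
  the choice of signs. It remains to precompose with a map \<open>h\<close>, again close to the identity,
  that pushes small tails into the positive cone and whose derivative has all far unit vectors in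
  its range; it is built by the same coordinatewise recursion.
\<close>

section \<open>Strict differentiability in sequence lattices\<close>

text \<open>The obstacle is that \<open>r\<close> is only Lipschitz, while averaging smooths it in
  finitely many coordinates only. Step \<open>n\<close> of the recursion therefore uses a smooth
  \<open>rad n\<close>, close to \<open>r\<close> on heads of length \<open>n\<close> and with the
  same Lipschitz constant, evaluated at the head that has already been modified. Its error
  \<open>(1/2)^n / 8\<close> is absorbed because \<open>s n\<close> stays above
  \<open>(1/2)^n\<close>, and a far coordinate of the argument can reach component \<open>n\<close>
  only through \<open>s n\<close>. This makes the derivative triangular, which is behind both the
  proportionality of the far columns and the solvability for far unit vectors. The Lipschitz
  constant 1/100 is chosen so that the derivative of the recursion, which feeds back into itself,
  obeys an inequality with gain 15/100. Being \<open>C1\<close> across the boundary of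
  \<open>U\<close> needs one more bound: inside \<open>U\<close> the distance to \<open>f\<close> is
  kept below the square of the distance to every point outside \<open>U\<close>, and the distance of
  the derivatives below that distance itself.\<close>

definition scl :: "real \<Rightarrow> (nat \<Rightarrow> real) \<Rightarrow> nat \<Rightarrow> real" where
  "scl c u = (\<lambda>i. c * u i)"

definition head :: "nat \<Rightarrow> (nat \<Rightarrow> real) \<Rightarrow> nat \<Rightarrow> real" where
  "head n u = (\<lambda>i. if i < n then u i else 0)"

definition tail :: "nat \<Rightarrow> (nat \<Rightarrow> real) \<Rightarrow> nat \<Rightarrow> real" where
  "tail n u = (\<lambda>i. if n \<le> i then u i else 0)"

definition unit_seq :: "nat \<Rightarrow> nat \<Rightarrow> real" where
  "unit_seq n = (\<lambda>i. if i = n then 1 else 0)"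

lemma scl_apply [simp]: "scl c u i = c * u i"
  by (simp add: scl_def)

lemma head_add_tail: "head n u + tail n u = u"
  by (auto simp: head_def tail_def)

text \<open>Common ground of all the spaces. Solidity lets norms be estimated coordinate by
  coordinate; \<open>tail_small\<close> makes finitely supported sequences dense;
  \<open>summable_mem\<close> embeds the absolutely summable sequences contractively and so supplies
  unit vectors and summable errors.\<close>

locale seq_lattice =
  fixes V :: "(nat \<Rightarrow> real) set" and N :: "(nat \<Rightarrow> real) \<Rightarrow> real"
  assumes add_mem: "u \<in> V \<Longrightarrow> v \<in> V \<Longrightarrow> u + v \<in> V"
    and norm_add: "u \<in> V \<Longrightarrow> v \<in> V \<Longrightarrow> N (u + v) \<le> N u + N v"
    and scl_mem: "u \<in> V \<Longrightarrow> scl c u \<in> V"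
    and norm_scl: "u \<in> V \<Longrightarrow> N (scl c u) = \<bar>c\<bar> * N u"
    and solid: "v \<in> V \<Longrightarrow> (\<And>n. \<bar>u n\<bar> \<le> \<bar>v n\<bar>) \<Longrightarrow> u \<in> V \<and> N u \<le> N v"
    and coord_le: "u \<in> V \<Longrightarrow> \<bar>u n\<bar> \<le> N u"
    and summable_mem: "summable (\<lambda>n. \<bar>u n\<bar>) \<Longrightarrow> u \<in> V \<and> N u \<le> (\<Sum>n. \<bar>u n\<bar>)"
    and tail_small: "u \<in> V \<Longrightarrow> e > 0 \<Longrightarrow> \<exists>n. N (tail n u) < e"
begin

lemma unit_seq_mem [simp]: "unit_seq n \<in> V" and norm_unit_le: "N (unit_seq n) \<le> 1"
proof -
  have "(\<lambda>i. \<bar>unit_seq n i\<bar>) sums (\<Sum>i\<in>{n}. \<bar>unit_seq n i\<bar>)"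
    by (rule sums_finite) (auto simp: unit_seq_def)
  hence s: "(\<lambda>i. \<bar>unit_seq n i\<bar>) sums 1" by (simp add: unit_seq_def)
  hence "summable (\<lambda>i. \<bar>unit_seq n i\<bar>)" "(\<Sum>i. \<bar>unit_seq n i\<bar>) = 1"
    by (auto simp: sums_iff)
  thus "unit_seq n \<in> V" "N (unit_seq n) \<le> 1" using summable_mem[of "unit_seq n"] by auto
qed

lemma zero_mem [simp]: "0 \<in> V" and norm_zero' [simp]: "N 0 = 0"
proof -
  have "scl 0 (unit_seq 0) = 0" by (auto simp: scl_def)
  thus "0 \<in> V" "N 0 = 0" using scl_mem[of "unit_seq 0" 0] norm_scl[of "unit_seq 0" 0] by auto
qed

lemma norm_nonneg: "u \<in> V \<Longrightarrow> 0 \<le> N u"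
  using coord_le[of u 0] by linarith

lemma uminus_mem: "u \<in> V \<Longrightarrow> - u \<in> V" and norm_uminus: "u \<in> V \<Longrightarrow> N (- u) = N u"
proof -
  have "scl (-1) u = - u" by (auto simp: scl_def fun_Compl_def)
  thus "u \<in> V \<Longrightarrow> - u \<in> V" "u \<in> V \<Longrightarrow> N (- u) = N u"
    using scl_mem[of u "-1"] norm_scl[of u "-1"] by auto
qed

lemma diff_mem: "u \<in> V \<Longrightarrow> v \<in> V \<Longrightarrow> u - v \<in> V"
  using add_mem[of u "- v"] uminus_mem[of v] by simp

lemma norm_minus_commute': "u \<in> V \<Longrightarrow> v \<in> V \<Longrightarrow> N (u - v) = N (v - u)"
  using norm_uminus[of "u - v"] by (simp add: diff_mem)

lemma norm_diff_triangle: "u \<in> V \<Longrightarrow> v \<in> V \<Longrightarrow> w \<in> V \<Longrightarrow> N (u - w) \<le> N (u - v) + N (v - w)"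
  using norm_add[of "u - v" "v - w"] by (simp add: diff_mem)

lemma norm_eq_0: "u \<in> V \<Longrightarrow> N u = 0 \<Longrightarrow> u = 0"
  using coord_le[of u] by (auto simp: zero_fun_def)

lemma head_mem: "u \<in> V \<Longrightarrow> head n u \<in> V" and norm_head: "u \<in> V \<Longrightarrow> N (head n u) \<le> N u"
  using solid[of u "head n u"] by (auto simp: head_def)

lemma tail_mem: "u \<in> V \<Longrightarrow> tail n u \<in> V" and norm_tail: "u \<in> V \<Longrightarrow> N (tail n u) \<le> N u"
  using solid[of u "tail n u"] by (auto simp: tail_def)

lemma norm_tail_mono: "u \<in> V \<Longrightarrow> n \<le> m \<Longrightarrow> N (tail m u) \<le> N (tail n u)"
  using solid[of "tail n u" "tail m u"] tail_mem by (auto simp: tail_def)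

section \<open>Bounded linear maps and strict differentiability\<close>

definition bdd_lin :: "((nat \<Rightarrow> real) \<Rightarrow> 'b::real_normed_vector) \<Rightarrow> bool" where
  "bdd_lin L \<longleftrightarrow> (\<forall>u\<in>V. \<forall>v\<in>V. L (u + v) = L u + L v) \<and> (\<forall>c. \<forall>u\<in>V. L (scl c u) = c *\<^sub>R L u) \<and>
     (\<exists>K. \<forall>u\<in>V. norm (L u) \<le> K * N u)"

definition bdd_lin_map :: "((nat \<Rightarrow> real) \<Rightarrow> nat \<Rightarrow> real) \<Rightarrow> bool" where
  "bdd_lin_map D \<longleftrightarrow> (\<forall>u\<in>V. D u \<in> V) \<and> (\<forall>u\<in>V. \<forall>v\<in>V. D (u + v) = D u + D v) \<and>
     (\<forall>c. \<forall>u\<in>V. D (scl c u) = scl c (D u)) \<and> (\<exists>K. \<forall>u\<in>V. N (D u) \<le> K * N u)"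

text \<open>Strict differentiability: at every point of an open set it is equivalent to being \<open>C\<^sup>1\<close>
  there, and it is preserved by composition without keeping track of the continuity of the
  derivative.\<close>

definition strict_deriv :: "((nat \<Rightarrow> real) \<Rightarrow> 'b::real_normed_vector) \<Rightarrow> ((nat \<Rightarrow> real) \<Rightarrow> 'b)
    \<Rightarrow> (nat \<Rightarrow> real) \<Rightarrow> bool" where
  "strict_deriv f L x \<longleftrightarrow> bdd_lin L \<and> (\<forall>e>0. \<exists>d>0. \<forall>y\<in>V. \<forall>z\<in>V. N (y - x) < d \<longrightarrow> N (z - x) < d \<longrightarrow>
     norm (f y - f z - L (y - z)) \<le> e * N (y - z))"

definition strict_deriv_map :: "((nat \<Rightarrow> real) \<Rightarrow> nat \<Rightarrow> real) \<Rightarrow> ((nat \<Rightarrow> real) \<Rightarrow> nat \<Rightarrow> real)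
    \<Rightarrow> (nat \<Rightarrow> real) \<Rightarrow> bool" where
  "strict_deriv_map F D x \<longleftrightarrow> (\<forall>y\<in>V. F y \<in> V) \<and> bdd_lin_map D \<and>
     (\<forall>e>0. \<exists>d>0. \<forall>y\<in>V. \<forall>z\<in>V. N (y - x) < d \<longrightarrow> N (z - x) < d \<longrightarrow>
       N (F y - F z - D (y - z)) \<le> e * N (y - z))"

lemma bdd_lin_bound: "bdd_lin L \<Longrightarrow> \<exists>K>0. \<forall>u\<in>V. norm (L u) \<le> K * N u"
proof -
  assume "bdd_lin L"
  then obtain K where K: "\<forall>u\<in>V. norm (L u) \<le> K * N u" unfolding bdd_lin_def by blast
  have "norm (L u) \<le> (\<bar>K\<bar> + 1) * N u" if "u \<in> V" for u
  proof -
    have "K * N u \<le> (\<bar>K\<bar> + 1) * N u" using norm_nonneg[OF that] by (intro mult_right_mono) auto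
    thus ?thesis using K that by force
  qed
  thus ?thesis by (intro exI[of _ "\<bar>K\<bar> + 1"]) auto
qed

lemma bdd_lin_map_bound: "bdd_lin_map D \<Longrightarrow> \<exists>K>0. \<forall>u\<in>V. N (D u) \<le> K * N u"
proof -
  assume "bdd_lin_map D"
  then obtain K where K: "\<forall>u\<in>V. N (D u) \<le> K * N u" unfolding bdd_lin_map_def by blast
  have "N (D u) \<le> (\<bar>K\<bar> + 1) * N u" if "u \<in> V" for u
  proof -
    have "K * N u \<le> (\<bar>K\<bar> + 1) * N u" using norm_nonneg[OF that] by (intro mult_right_mono) auto
    thus ?thesis using K that by force
  qed
  thus ?thesis by (intro exI[of _ "\<bar>K\<bar> + 1"]) auto
qed

lemma bdd_lin_add: "bdd_lin L \<Longrightarrow> u \<in> V \<Longrightarrow> v \<in> V \<Longrightarrow> L (u + v) = L u + L v"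
  and bdd_lin_scl: "bdd_lin L \<Longrightarrow> u \<in> V \<Longrightarrow> L (scl c u) = c *\<^sub>R L u"
  by (auto simp: bdd_lin_def)

lemma bdd_lin_zero: "bdd_lin L \<Longrightarrow> L 0 = 0"
  using bdd_lin_add[of L 0 0] by simp

lemma bdd_lin_diff: "bdd_lin L \<Longrightarrow> u \<in> V \<Longrightarrow> v \<in> V \<Longrightarrow> L (u - v) = L u - L v"
  using bdd_lin_add[of L "u - v" v] by (simp add: diff_mem)

lemma bdd_lin_map_mem: "bdd_lin_map D \<Longrightarrow> u \<in> V \<Longrightarrow> D u \<in> V"
  and bdd_lin_map_add: "bdd_lin_map D \<Longrightarrow> u \<in> V \<Longrightarrow> v \<in> V \<Longrightarrow> D (u + v) = D u + D v"
  and bdd_lin_map_scl: "bdd_lin_map D \<Longrightarrow> u \<in> V \<Longrightarrow> D (scl c u) = scl c (D u)"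
  by (auto simp: bdd_lin_map_def)

lemma bdd_lin_map_diff: "bdd_lin_map D \<Longrightarrow> u \<in> V \<Longrightarrow> v \<in> V \<Longrightarrow> D (u - v) = D u - D v"
  using bdd_lin_map_add[of D "u - v" v] by (simp add: diff_mem)

lemma strict_deriv_bdd_lin: "strict_deriv f L x \<Longrightarrow> bdd_lin L" by (simp add: strict_deriv_def)
lemma strict_deriv_map_linV: "strict_deriv_map F D x \<Longrightarrow> bdd_lin_map D" by (simp add: strict_deriv_map_def)

lemma strict_derivD: "strict_deriv f L x \<Longrightarrow> e > 0 \<Longrightarrow> \<exists>d>0. \<forall>y\<in>V. \<forall>z\<in>V. N (y - x) < d \<longrightarrow> N (z - x) < d \<longrightarrow>
     norm (f y - f z - L (y - z)) \<le> e * N (y - z)"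
  by (simp add: strict_deriv_def)

lemma strict_deriv_mapD: "strict_deriv_map F D x \<Longrightarrow> e > 0 \<Longrightarrow> \<exists>d>0. \<forall>y\<in>V. \<forall>z\<in>V. N (y - x) < d \<longrightarrow> N (z - x) < d \<longrightarrow>
     N (F y - F z - D (y - z)) \<le> e * N (y - z)"
  by (simp add: strict_deriv_map_def)

lemma bdd_lin_cong: "bdd_lin L \<Longrightarrow> (\<And>v. v \<in> V \<Longrightarrow> L' v = L v) \<Longrightarrow> bdd_lin L'"
  by (simp add: bdd_lin_def add_mem scl_mem)

lemma strict_deriv_cong: "strict_deriv f L x \<Longrightarrow> (\<And>v. v \<in> V \<Longrightarrow> L' v = L v) \<Longrightarrow> strict_deriv f L' x"
  using bdd_lin_cong[of L L'] by (simp add: strict_deriv_def diff_mem)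

lemma bdd_lin_map_cong: "bdd_lin_map L \<Longrightarrow> (\<And>v. v \<in> V \<Longrightarrow> L' v = L v) \<Longrightarrow> bdd_lin_map L'"
  by (simp add: bdd_lin_map_def add_mem scl_mem)

lemma strict_deriv_map_cong: "strict_deriv_map F D x \<Longrightarrow> (\<And>v. v \<in> V \<Longrightarrow> D' v = D v) \<Longrightarrow> strict_deriv_map F D' x"
  using bdd_lin_map_cong[of D D'] by (simp add: strict_deriv_map_def diff_mem)

lemma strict_deriv_local:
  assumes "strict_deriv f L x" "r > 0" "\<And>y. y \<in> V \<Longrightarrow> N (y - x) < r \<Longrightarrow> g y = f y"
  shows "strict_deriv g L x"
  unfolding strict_deriv_def
proof (intro conjI allI impI)
  show "bdd_lin L" using assms(1) by (rule strict_deriv_bdd_lin)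
  fix e :: real assume "e > 0"
  then obtain d where d: "d > 0" "\<forall>y\<in>V. \<forall>z\<in>V. N (y - x) < d \<longrightarrow> N (z - x) < d \<longrightarrow>
     norm (f y - f z - L (y - z)) \<le> e * N (y - z)" using strict_derivD[OF assms(1)] by blast
  show "\<exists>d>0. \<forall>y\<in>V. \<forall>z\<in>V. N (y - x) < d \<longrightarrow> N (z - x) < d \<longrightarrow>
     norm (g y - g z - L (y - z)) \<le> e * N (y - z)"
    using d assms(2,3) by (intro exI[of _ "min d r"]) auto
qed

lemma strict_deriv_Lipschitz:
  assumes "strict_deriv f L x"
  obtains K d where "K > 0" "d > 0" "\<And>y z. y \<in> V \<Longrightarrow> z \<in> V \<Longrightarrow> N (y - x) < d \<Longrightarrow> N (z - x) < d
    \<Longrightarrow> norm (f y - f z) \<le> K * N (y - z)"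
proof -
  obtain K where K: "K > 0" "\<forall>u\<in>V. norm (L u) \<le> K * N u" using bdd_lin_bound[OF strict_deriv_bdd_lin[OF assms]] by blast
  obtain d where d: "d > 0" "\<forall>y\<in>V. \<forall>z\<in>V. N (y - x) < d \<longrightarrow> N (z - x) < d \<longrightarrow>
     norm (f y - f z - L (y - z)) \<le> 1 * N (y - z)" using strict_derivD[OF assms, of 1] by auto
  have "norm (f y - f z) \<le> (K + 1) * N (y - z)"
    if "y \<in> V" "z \<in> V" "N (y - x) < d" "N (z - x) < d" for y z
  proof -
    have "norm (f y - f z) \<le> norm (f y - f z - L (y - z)) + norm (L (y - z))"
      using norm_triangle_ineq[of "f y - f z - L (y - z)" "L (y - z)"] by simp
    also have "\<dots> \<le> 1 * N (y - z) + K * N (y - z)"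
      using d K that diff_mem by (intro add_mono) auto
    finally show ?thesis by (simp add: algebra_simps)
  qed
  thus ?thesis using that[of "K + 1" d] K d by auto
qed

lemma strict_deriv_map_Lipschitz:
  assumes "strict_deriv_map f L x"
  obtains K d where "K > 0" "d > 0" "\<And>y z. y \<in> V \<Longrightarrow> z \<in> V \<Longrightarrow> N (y - x) < d \<Longrightarrow> N (z - x) < d
    \<Longrightarrow> N (f y - f z) \<le> K * N (y - z)"
proof -
  have lL: "bdd_lin_map L" and fm: "\<And>y. y \<in> V \<Longrightarrow> f y \<in> V" using assms by (auto simp: strict_deriv_map_def)
  obtain K where K: "K > 0" "\<forall>u\<in>V. N (L u) \<le> K * N u" using bdd_lin_map_bound[OF lL] by blast
  obtain d where d: "d > 0" "\<forall>y\<in>V. \<forall>z\<in>V. N (y - x) < d \<longrightarrow> N (z - x) < d \<longrightarrow>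
     N (f y - f z - L (y - z)) \<le> 1 * N (y - z)" using strict_deriv_mapD[OF assms, of 1] by auto
  have "N (f y - f z) \<le> (K + 1) * N (y - z)"
    if "y \<in> V" "z \<in> V" "N (y - x) < d" "N (z - x) < d" for y z
  proof -
    have "N (f y - f z) \<le> N (f y - f z - L (y - z)) + N (L (y - z))"
      using norm_add[of "f y - f z - L (y - z)" "L (y - z)"] that fm lL by (simp add: diff_mem bdd_lin_map_mem)
    also have "\<dots> \<le> 1 * N (y - z) + K * N (y - z)"
      using d K that diff_mem by (intro add_mono) auto
    finally show ?thesis by (simp add: algebra_simps)
  qed
  thus ?thesis using that[of "K + 1" d] K d by auto
qed

lemma strict_deriv_continuous:
  assumes "strict_deriv f L x" "x \<in> V" "e > 0"
  shows "\<exists>d>0. \<forall>y\<in>V. N (y - x) < d \<longrightarrow> norm (f y - f x) < e"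
proof -
  obtain K d where K: "K > 0" "d > 0" "\<And>y z. y \<in> V \<Longrightarrow> z \<in> V \<Longrightarrow> N (y - x) < d \<Longrightarrow> N (z - x) < d
    \<Longrightarrow> norm (f y - f z) \<le> K * N (y - z)" using strict_deriv_Lipschitz[OF assms(1)] by blast
  show ?thesis
  proof (intro exI[of _ "min d (e / K)"] conjI ballI impI)
    show "min d (e / K) > 0" using K assms by simp
    fix y assume y: "y \<in> V" "N (y - x) < min d (e / K)"
    have "norm (f y - f x) \<le> K * N (y - x)" using K y assms by auto
    also have "\<dots> < e" using y K by (simp add: pos_less_divide_eq mult.commute)
    finally show "norm (f y - f x) < e" .
  qed
qed

lemma strict_deriv_map_continuous:
  assumes "strict_deriv_map f L x" "x \<in> V" "e > 0"
  shows "\<exists>d>0. \<forall>y\<in>V. N (y - x) < d \<longrightarrow> N (f y - f x) < e"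
proof -
  obtain K d where K: "K > 0" "d > 0" "\<And>y z. y \<in> V \<Longrightarrow> z \<in> V \<Longrightarrow> N (y - x) < d \<Longrightarrow> N (z - x) < d
    \<Longrightarrow> N (f y - f z) \<le> K * N (y - z)" using strict_deriv_map_Lipschitz[OF assms(1)] by blast
  show ?thesis
  proof (intro exI[of _ "min d (e / K)"] conjI ballI impI)
    show "min d (e / K) > 0" using K assms by simp
    fix y assume y: "y \<in> V" "N (y - x) < min d (e / K)"
    have "N (f y - f x) \<le> K * N (y - x)" using K y assms by auto
    also have "\<dots> < e" using y K by (simp add: pos_less_divide_eq mult.commute)
    finally show "N (f y - f x) < e" .
  qed
qed

lemma bdd_lin_compose: "bdd_lin L \<Longrightarrow> bdd_lin_map D \<Longrightarrow> bdd_lin (\<lambda>v. L (D v))"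
proof -
  assume a: "bdd_lin L" "bdd_lin_map D"
  obtain K where K: "K > 0" "\<forall>u\<in>V. norm (L u) \<le> K * N u" using bdd_lin_bound[OF a(1)] by blast
  obtain M where M: "M > 0" "\<forall>u\<in>V. N (D u) \<le> M * N u" using bdd_lin_map_bound[OF a(2)] by blast
  have "norm (L (D u)) \<le> (K * M) * N u" if "u \<in> V" for u
  proof -
    have "norm (L (D u)) \<le> K * N (D u)" using K that bdd_lin_map_mem[OF a(2)] by auto
    also have "\<dots> \<le> K * (M * N u)" using M K that by (intro mult_left_mono) auto
    finally show ?thesis by (simp add: algebra_simps)
  qed
  thus ?thesis using a unfolding bdd_lin_def bdd_lin_map_def by (auto simp: add_mem scl_mem)
qed

lemma bdd_lin_map_compose: "bdd_lin_map L \<Longrightarrow> bdd_lin_map D \<Longrightarrow> bdd_lin_map (\<lambda>v. L (D v))"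
proof -
  assume a: "bdd_lin_map L" "bdd_lin_map D"
  obtain K where K: "K > 0" "\<forall>u\<in>V. N (L u) \<le> K * N u" using bdd_lin_map_bound[OF a(1)] by blast
  obtain M where M: "M > 0" "\<forall>u\<in>V. N (D u) \<le> M * N u" using bdd_lin_map_bound[OF a(2)] by blast
  have "N (L (D u)) \<le> (K * M) * N u" if "u \<in> V" for u
  proof -
    have "N (L (D u)) \<le> K * N (D u)" using K that bdd_lin_map_mem[OF a(2)] by auto
    also have "\<dots> \<le> K * (M * N u)" using M K that by (intro mult_left_mono) auto
    finally show ?thesis by (simp add: algebra_simps)
  qed
  thus ?thesis using a unfolding bdd_lin_map_def by (auto simp: add_mem scl_mem)
qed

lemma strict_deriv_compose:
  assumes F: "strict_deriv_map F D x" and f: "strict_deriv f L (F x)" and x: "x \<in> V"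
  shows "strict_deriv (\<lambda>y. f (F y)) (\<lambda>v. L (D v)) x"
  unfolding strict_deriv_def
proof (intro conjI allI impI)
  have lL: "bdd_lin L" and lD: "bdd_lin_map D" using F f by (auto simp: strict_deriv_def strict_deriv_map_def)
  have Fm: "\<And>y. y \<in> V \<Longrightarrow> F y \<in> V" using F by (simp add: strict_deriv_map_def)
  show "bdd_lin (\<lambda>v. L (D v))" using lL lD by (rule bdd_lin_compose)
  fix e :: real assume e: "e > 0"
  obtain KL where KL: "KL > 0" "\<forall>u\<in>V. norm (L u) \<le> KL * N u" using bdd_lin_bound[OF lL] by blast
  obtain K d0 where K: "K > 0" "d0 > 0" "\<And>y z. y \<in> V \<Longrightarrow> z \<in> V \<Longrightarrow> N (y - x) < d0 \<Longrightarrow> N (z - x) < d0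
    \<Longrightarrow> N (F y - F z) \<le> K * N (y - z)" using strict_deriv_map_Lipschitz[OF F] by blast
  obtain d1 where d1: "d1 > 0" "\<forall>y\<in>V. \<forall>z\<in>V. N (y - F x) < d1 \<longrightarrow> N (z - F x) < d1 \<longrightarrow>
     norm (f y - f z - L (y - z)) \<le> (e / (2 * K)) * N (y - z)" using strict_derivD[OF f, of "e / (2 * K)"] e K by auto
  obtain d2 where d2: "d2 > 0" "\<forall>y\<in>V. \<forall>z\<in>V. N (y - x) < d2 \<longrightarrow> N (z - x) < d2 \<longrightarrow>
     N (F y - F z - D (y - z)) \<le> (e / (2 * KL)) * N (y - z)" using strict_deriv_mapD[OF F, of "e / (2 * KL)"] e KL by auto
  obtain d3 where d3: "d3 > 0" "\<forall>y\<in>V. N (y - x) < d3 \<longrightarrow> N (F y - F x) < d1"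
    using strict_deriv_map_continuous[OF F x d1(1)] by blast
  have "norm (f (F y) - f (F z) - L (D (y - z))) \<le> e * N (y - z)"
    if yz: "y \<in> V" "z \<in> V" "N (y - x) < min d0 (min d2 d3)" "N (z - x) < min d0 (min d2 d3)" for y z
  proof -
    have m: "F y - F z \<in> V" "D (y - z) \<in> V" using Fm yz lD by (auto simp: diff_mem bdd_lin_map_mem)
    have "norm (f (F y) - f (F z) - L (F y - F z)) \<le> (e / (2 * K)) * N (F y - F z)"
      using d1 d3 Fm yz by auto
    also have "\<dots> \<le> (e / (2 * K)) * (K * N (y - z))"
      using K e yz by (intro mult_left_mono) auto
    finally have 1: "norm (f (F y) - f (F z) - L (F y - F z)) \<le> e / 2 * N (y - z)" using K by simp
    have "norm (L (F y - F z - D (y - z))) \<le> KL * N (F y - F z - D (y - z))"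
      using KL m by (auto simp: diff_mem)
    also have "\<dots> \<le> KL * ((e / (2 * KL)) * N (y - z))"
      using KL d2 yz by (intro mult_left_mono) auto
    finally have 2: "norm (L (F y - F z - D (y - z))) \<le> e / 2 * N (y - z)" using KL by simp
    have "f (F y) - f (F z) - L (D (y - z)) =
        (f (F y) - f (F z) - L (F y - F z)) + L (F y - F z - D (y - z))"
      using bdd_lin_diff[OF lL m] by simp
    hence "norm (f (F y) - f (F z) - L (D (y - z))) \<le>
        norm (f (F y) - f (F z) - L (F y - F z)) + norm (L (F y - F z - D (y - z)))"
      by (metis norm_triangle_ineq)
    thus ?thesis using 1 2 by linarith
  qed
  thus "\<exists>d>0. \<forall>y\<in>V. \<forall>z\<in>V. N (y - x) < d \<longrightarrow> N (z - x) < d \<longrightarrow>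
     norm (f (F y) - f (F z) - L (D (y - z))) \<le> e * N (y - z)"
    using K d2 d3 by (intro exI[of _ "min d0 (min d2 d3)"]) auto
qed

lemma strict_deriv_map_compose:
  assumes F: "strict_deriv_map F D x" and f: "strict_deriv_map f L (F x)" and x: "x \<in> V"
  shows "strict_deriv_map (\<lambda>y. f (F y)) (\<lambda>v. L (D v)) x"
  unfolding strict_deriv_map_def
proof (intro conjI allI impI)
  have lL: "bdd_lin_map L" and lD: "bdd_lin_map D" using F f by (auto simp: strict_deriv_map_def)
  have Fm: "\<And>y. y \<in> V \<Longrightarrow> F y \<in> V" and fm: "\<And>y. y \<in> V \<Longrightarrow> f y \<in> V"
    using F f by (auto simp: strict_deriv_map_def)
  show "\<forall>y\<in>V. f (F y) \<in> V" using Fm fm by blast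
  show "bdd_lin_map (\<lambda>v. L (D v))" using lL lD by (rule bdd_lin_map_compose)
  fix e :: real assume e: "e > 0"
  obtain KL where KL: "KL > 0" "\<forall>u\<in>V. N (L u) \<le> KL * N u" using bdd_lin_map_bound[OF lL] by blast
  obtain K d0 where K: "K > 0" "d0 > 0" "\<And>y z. y \<in> V \<Longrightarrow> z \<in> V \<Longrightarrow> N (y - x) < d0 \<Longrightarrow> N (z - x) < d0
    \<Longrightarrow> N (F y - F z) \<le> K * N (y - z)" using strict_deriv_map_Lipschitz[OF F] by blast
  obtain d1 where d1: "d1 > 0" "\<forall>y\<in>V. \<forall>z\<in>V. N (y - F x) < d1 \<longrightarrow> N (z - F x) < d1 \<longrightarrow>
     N (f y - f z - L (y - z)) \<le> (e / (2 * K)) * N (y - z)" using strict_deriv_mapD[OF f, of "e / (2 * K)"] e K by auto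
  obtain d2 where d2: "d2 > 0" "\<forall>y\<in>V. \<forall>z\<in>V. N (y - x) < d2 \<longrightarrow> N (z - x) < d2 \<longrightarrow>
     N (F y - F z - D (y - z)) \<le> (e / (2 * KL)) * N (y - z)" using strict_deriv_mapD[OF F, of "e / (2 * KL)"] e KL by auto
  obtain d3 where d3: "d3 > 0" "\<forall>y\<in>V. N (y - x) < d3 \<longrightarrow> N (F y - F x) < d1"
    using strict_deriv_map_continuous[OF F x d1(1)] by blast
  have "N (f (F y) - f (F z) - L (D (y - z))) \<le> e * N (y - z)"
    if yz: "y \<in> V" "z \<in> V" "N (y - x) < min d0 (min d2 d3)" "N (z - x) < min d0 (min d2 d3)" for y z
  proof -
    have m: "F y - F z \<in> V" "D (y - z) \<in> V" using Fm yz lD by (auto simp: diff_mem bdd_lin_map_mem)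
    have "N (f (F y) - f (F z) - L (F y - F z)) \<le> (e / (2 * K)) * N (F y - F z)"
      using d1 d3 Fm yz by auto
    also have "\<dots> \<le> (e / (2 * K)) * (K * N (y - z))"
      using K e yz by (intro mult_left_mono) auto
    finally have 1: "N (f (F y) - f (F z) - L (F y - F z)) \<le> e / 2 * N (y - z)" using K by simp
    have "N (L (F y - F z - D (y - z))) \<le> KL * N (F y - F z - D (y - z))"
      using KL m by (auto simp: diff_mem)
    also have "\<dots> \<le> KL * ((e / (2 * KL)) * N (y - z))"
      using KL d2 yz by (intro mult_left_mono) auto
    finally have 2: "N (L (F y - F z - D (y - z))) \<le> e / 2 * N (y - z)" using KL by simp
    have eq: "f (F y) - f (F z) - L (D (y - z)) =
        (f (F y) - f (F z) - L (F y - F z)) + L (F y - F z - D (y - z))"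
      using bdd_lin_map_diff[OF lL m] by simp
    have "N (f (F y) - f (F z) - L (D (y - z))) \<le>
        N (f (F y) - f (F z) - L (F y - F z)) + N (L (F y - F z - D (y - z)))"
      unfolding eq by (rule norm_add) (use m Fm fm yz lL in \<open>auto simp: diff_mem bdd_lin_map_mem\<close>)
    thus ?thesis using 1 2 by linarith
  qed
  thus "\<exists>d>0. \<forall>y\<in>V. \<forall>z\<in>V. N (y - x) < d \<longrightarrow> N (z - x) < d \<longrightarrow>
     N (f (F y) - f (F z) - L (D (y - z))) \<le> e * N (y - z)"
    using K d2 d3 by (intro exI[of _ "min d0 (min d2 d3)"]) auto
qed

lemma strict_deriv_of_bdd_lin: "bdd_lin L \<Longrightarrow> strict_deriv L L x"
  unfolding strict_deriv_def using bdd_lin_diff[of L] norm_nonneg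
  by (auto simp: diff_mem intro!: exI[of _ 1] mult_nonneg_nonneg)

lemma bdd_lin_coord: "bdd_lin (\<lambda>v. v n)"
  unfolding bdd_lin_def using coord_le by (auto intro!: exI[of _ 1])

lemma strict_deriv_coord: "strict_deriv (\<lambda>x. x n) (\<lambda>v. v n) x"
  by (rule strict_deriv_of_bdd_lin[OF bdd_lin_coord])

lemma bdd_lin_0: "bdd_lin (\<lambda>v. 0)" by (auto simp: bdd_lin_def intro!: exI[of _ 0])

lemma strict_deriv_const: "strict_deriv (\<lambda>x. c) (\<lambda>v. 0) x"
  using norm_nonneg by (auto simp: strict_deriv_def bdd_lin_0 diff_mem intro!: exI[of _ 1])

lemma bdd_lin_plus: "bdd_lin L \<Longrightarrow> bdd_lin M \<Longrightarrow> bdd_lin (\<lambda>v. L v + M v)"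
proof -
  assume a: "bdd_lin L" "bdd_lin M"
  obtain K where K: "K > 0" "\<forall>u\<in>V. norm (L u) \<le> K * N u" using bdd_lin_bound[OF a(1)] by blast
  obtain K' where K': "K' > 0" "\<forall>u\<in>V. norm (M u) \<le> K' * N u" using bdd_lin_bound[OF a(2)] by blast
  have "norm (L u + M u) \<le> (K + K') * N u" if "u \<in> V" for u
    using K K' that norm_triangle_ineq[of "L u" "M u"] by (force simp: algebra_simps)
  hence "\<exists>K. \<forall>u\<in>V. norm (L u + M u) \<le> K * N u" by blast
  thus ?thesis using a by (simp add: bdd_lin_def algebra_simps)
qed

lemma strict_deriv_add:
  assumes "strict_deriv f L x" "strict_deriv g M x" shows "strict_deriv (\<lambda>y. f y + g y) (\<lambda>v. L v + M v) x"
  unfolding strict_deriv_def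
proof (intro conjI allI impI)
  show "bdd_lin (\<lambda>v. L v + M v)" using assms by (intro bdd_lin_plus strict_deriv_bdd_lin)
  fix e :: real assume e: "e > 0"
  obtain d where d: "d > 0" "\<forall>y\<in>V. \<forall>z\<in>V. N (y - x) < d \<longrightarrow> N (z - x) < d \<longrightarrow>
     norm (f y - f z - L (y - z)) \<le> e/2 * N (y - z)" using strict_derivD[OF assms(1), of "e/2"] e by auto
  obtain d' where d': "d' > 0" "\<forall>y\<in>V. \<forall>z\<in>V. N (y - x) < d' \<longrightarrow> N (z - x) < d' \<longrightarrow>
     norm (g y - g z - M (y - z)) \<le> e/2 * N (y - z)" using strict_derivD[OF assms(2), of "e/2"] e by auto
  have "norm (f y + g y - (f z + g z) - (L (y - z) + M (y - z))) \<le> e * N (y - z)"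
    if "y \<in> V" "z \<in> V" "N (y - x) < min d d'" "N (z - x) < min d d'" for y z
  proof -
    have "norm (f y + g y - (f z + g z) - (L (y - z) + M (y - z))) =
      norm ((f y - f z - L (y - z)) + (g y - g z - M (y - z)))" by (simp add: algebra_simps)
    also have "\<dots> \<le> e/2 * N (y - z) + e/2 * N (y - z)"
      using d d' that by (intro norm_triangle_mono) auto
    finally show ?thesis by simp
  qed
  thus "\<exists>d>0. \<forall>y\<in>V. \<forall>z\<in>V. N (y - x) < d \<longrightarrow> N (z - x) < d \<longrightarrow>
     norm (f y + g y - (f z + g z) - (L (y - z) + M (y - z))) \<le> e * N (y - z)"
    using d d' by (intro exI[of _ "min d d'"]) auto
qed

lemma bdd_lin_cmult: "bdd_lin L \<Longrightarrow> bdd_lin (\<lambda>v. c *\<^sub>R L v)"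
proof -
  assume a: "bdd_lin L"
  obtain K where K: "K > 0" "\<forall>u\<in>V. norm (L u) \<le> K * N u" using bdd_lin_bound[OF a(1)] by blast
  have "norm (c *\<^sub>R L u) \<le> (\<bar>c\<bar> * K) * N u" if "u \<in> V" for u
    using K that by (simp add: mult_left_mono mult.assoc)
  hence "\<exists>K. \<forall>u\<in>V. norm (c *\<^sub>R L u) \<le> K * N u" by blast
  moreover have "c *\<^sub>R L (scl b u) = b *\<^sub>R c *\<^sub>R L u" if "u \<in> V" for b u
    using that a by (simp add: bdd_lin_scl)
  ultimately show ?thesis using a by (simp add: bdd_lin_def scaleR_add_right del: norm_scaleR)
qed

lemma strict_deriv_cmult:
  assumes "strict_deriv f L x" shows "strict_deriv (\<lambda>y. c *\<^sub>R f y) (\<lambda>v. c *\<^sub>R L v) x"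
  unfolding strict_deriv_def
proof (intro conjI allI impI)
  show "bdd_lin (\<lambda>v. c *\<^sub>R L v)" using assms by (intro bdd_lin_cmult strict_deriv_bdd_lin)
  fix e :: real assume e: "e > 0"
  obtain d where d: "d > 0" "\<forall>y\<in>V. \<forall>z\<in>V. N (y - x) < d \<longrightarrow> N (z - x) < d \<longrightarrow>
     norm (f y - f z - L (y - z)) \<le> e / (\<bar>c\<bar> + 1) * N (y - z)" using strict_derivD[OF assms(1), of "e / (\<bar>c\<bar> + 1)"] e by auto
  have "norm (c *\<^sub>R f y - c *\<^sub>R f z - c *\<^sub>R L (y - z)) \<le> e * N (y - z)"
    if yz: "y \<in> V" "z \<in> V" "N (y - x) < d" "N (z - x) < d" for y z
  proof -
    have n: "0 \<le> N (y - z)" using yz by (simp add: norm_nonneg diff_mem)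
    have "norm (c *\<^sub>R f y - c *\<^sub>R f z - c *\<^sub>R L (y - z)) = \<bar>c\<bar> * norm (f y - f z - L (y - z))"
      by (metis norm_scaleR scaleR_right_diff_distrib)
    also have "\<dots> \<le> (\<bar>c\<bar> + 1) * (e / (\<bar>c\<bar> + 1) * N (y - z))"
      using d yz n e by (intro mult_mono) auto
    also have "\<dots> = e * N (y - z)" by (simp add: field_simps)
    finally show ?thesis .
  qed
  thus "\<exists>d>0. \<forall>y\<in>V. \<forall>z\<in>V. N (y - x) < d \<longrightarrow> N (z - x) < d \<longrightarrow>
     norm (c *\<^sub>R f y - c *\<^sub>R f z - c *\<^sub>R L (y - z)) \<le> e * N (y - z)"
    using d by (intro exI[of _ d]) auto
qed

lemma strict_deriv_diff:
  assumes "strict_deriv f L x" "strict_deriv g M x" shows "strict_deriv (\<lambda>y. f y - g y) (\<lambda>v. L v - M v) x"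
  using strict_deriv_add[OF assms(1) strict_deriv_cmult[OF assms(2), of "-1"]] by simp

text \<open>The outer function is required to be strictly differentiable at one value only, so the
  lemma serves both continuously differentiable functions and the piecewise quadratic
  cut-offs.\<close>

lemma strict_deriv_real_compose:
  fixes f :: "(nat \<Rightarrow> real) \<Rightarrow> real"
  assumes f: "strict_deriv f L x" and x: "x \<in> V"
    and G: "\<And>e. e > 0 \<Longrightarrow> \<exists>d>0. \<forall>a b. \<bar>a - f x\<bar> < d \<longrightarrow> \<bar>b - f x\<bar> < d \<longrightarrow> \<bar>G a - G b - G' * (a - b)\<bar> \<le> e * \<bar>a - b\<bar>"
  shows "strict_deriv (\<lambda>y. G (f y)) (\<lambda>v. G' * L v) x"
  unfolding strict_deriv_def
proof (intro conjI allI impI)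
  show "bdd_lin (\<lambda>v. G' * L v)" using bdd_lin_cmult[OF strict_deriv_bdd_lin[OF f], of G'] by simp
  fix e :: real assume e: "e > 0"
  obtain K d0 where K: "K > 0" "d0 > 0" "\<And>y z. y \<in> V \<Longrightarrow> z \<in> V \<Longrightarrow> N (y - x) < d0 \<Longrightarrow> N (z - x) < d0
    \<Longrightarrow> norm (f y - f z) \<le> K * N (y - z)" using strict_deriv_Lipschitz[OF f] by blast
  obtain d1 where d1: "d1 > 0" "\<forall>a b. \<bar>a - f x\<bar> < d1 \<longrightarrow> \<bar>b - f x\<bar> < d1 \<longrightarrow> \<bar>G a - G b - G' * (a - b)\<bar> \<le> (e / (2 * K)) * \<bar>a - b\<bar>"
    using G[of "e / (2 * K)"] e K by auto
  obtain d2 where d2: "d2 > 0" "\<forall>y\<in>V. \<forall>z\<in>V. N (y - x) < d2 \<longrightarrow> N (z - x) < d2 \<longrightarrow>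
     norm (f y - f z - L (y - z)) \<le> (e / (2 * (\<bar>G'\<bar> + 1))) * N (y - z)"
    using strict_derivD[OF f, of "e / (2 * (\<bar>G'\<bar> + 1))"] e by auto
  obtain d3 where d3: "d3 > 0" "\<forall>y\<in>V. N (y - x) < d3 \<longrightarrow> norm (f y - f x) < d1"
    using strict_deriv_continuous[OF f x d1(1)] by blast
  have "norm (G (f y) - G (f z) - G' * L (y - z)) \<le> e * N (y - z)"
    if yz: "y \<in> V" "z \<in> V" "N (y - x) < min d0 (min d2 d3)" "N (z - x) < min d0 (min d2 d3)" for y z
  proof -
    have n: "0 \<le> N (y - z)" using yz by (simp add: norm_nonneg diff_mem)
    have "\<bar>G (f y) - G (f z) - G' * (f y - f z)\<bar> \<le> (e / (2 * K)) * \<bar>f y - f z\<bar>"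
      using d1 d3 yz by auto
    also have "\<dots> \<le> (e / (2 * K)) * (K * N (y - z))"
      using K(3)[of y z] K(1) e yz by (intro mult_left_mono) auto
    finally have 1: "\<bar>G (f y) - G (f z) - G' * (f y - f z)\<bar> \<le> e / 2 * N (y - z)" using K by simp
    have "\<bar>G'\<bar> * \<bar>f y - f z - L (y - z)\<bar> \<le> (\<bar>G'\<bar> + 1) * ((e / (2 * (\<bar>G'\<bar> + 1))) * N (y - z))"
      using d2 yz n e by (intro mult_mono) auto
    also have "\<dots> = e / 2 * N (y - z)" by (simp add: field_simps)
    finally have 2: "\<bar>G' * (f y - f z - L (y - z))\<bar> \<le> e / 2 * N (y - z)" by (simp add: abs_mult)
    have "G (f y) - G (f z) - G' * L (y - z) = (G (f y) - G (f z) - G' * (f y - f z)) + G' * (f y - f z - L (y - z))"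
      by (simp add: algebra_simps)
    thus ?thesis using 1 2 unfolding real_norm_def by linarith
  qed
  thus "\<exists>d>0. \<forall>y\<in>V. \<forall>z\<in>V. N (y - x) < d \<longrightarrow> N (z - x) < d \<longrightarrow>
     norm (G (f y) - G (f z) - G' * L (y - z)) \<le> e * N (y - z)"
    using K d2 d3 by (intro exI[of _ "min d0 (min d2 d3)"]) auto
qed

end

lemma real_strict_derivI:
  fixes G G' :: "real \<Rightarrow> real"
  assumes r: "r > 0" and D: "\<And>t. \<bar>t - c\<bar> < r \<Longrightarrow> (G has_real_derivative G' t) (at t)"
    and cont: "isCont G' c" and e: "e > 0"
  shows "\<exists>d>0. \<forall>a b. \<bar>a - c\<bar> < d \<longrightarrow> \<bar>b - c\<bar> < d \<longrightarrow> \<bar>G a - G b - G' c * (a - b)\<bar> \<le> e * \<bar>a - b\<bar>"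
proof -
  obtain d where d: "d > 0" "\<And>t. \<bar>t - c\<bar> < d \<Longrightarrow> \<bar>G' t - G' c\<bar> < e"
    using cont e unfolding continuous_at_eps_delta dist_real_def by metis
  have *: "\<bar>G a - G b - G' c * (a - b)\<bar> \<le> e * \<bar>a - b\<bar>"
    if "\<bar>a - c\<bar> < min d r" "\<bar>b - c\<bar> < min d r" "b < a" for a b
  proof -
    have "\<exists>z>b. z < a \<and> G a - G b = (a - b) * G' z"
      using that by (intro MVT2 D) auto
    then obtain z where z: "b < z" "z < a" "G a - G b = (a - b) * G' z" by blast
    have "\<bar>z - c\<bar> < d" using z that by linarith
    hence "\<bar>G' z - G' c\<bar> \<le> e" using d(2)[of z] by simp
    have "G a - G b - G' c * (a - b) = (a - b) * (G' z - G' c)" using z by (simp add: algebra_simps)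
    hence "\<bar>G a - G b - G' c * (a - b)\<bar> = \<bar>a - b\<bar> * \<bar>G' z - G' c\<bar>" by (simp add: abs_mult)
    also have "\<dots> \<le> \<bar>a - b\<bar> * e" using \<open>\<bar>G' z - G' c\<bar> \<le> e\<close> by (intro mult_left_mono) auto
    finally show ?thesis by (simp add: mult.commute)
  qed
  have "\<bar>G a - G b - G' c * (a - b)\<bar> \<le> e * \<bar>a - b\<bar>"
    if "\<bar>a - c\<bar> < min d r" "\<bar>b - c\<bar> < min d r" for a b
  proof (cases a b rule: linorder_cases)
    case less
    have "G b - G a - G' c * (b - a) = - (G a - G b - G' c * (a - b))" by (simp add: algebra_simps)
    thus ?thesis using *[OF that(2,1) less] by (simp add: abs_minus_commute)
  qed (use * that in auto)
  thus ?thesis using d r by (intro exI[of _ "min d r"]) auto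
qed

context seq_lattice
begin

lemma strict_deriv_deriv_compose:
  fixes f :: "(nat \<Rightarrow> real) \<Rightarrow> real"
  assumes "strict_deriv f L x" "x \<in> V" "r > 0" "\<And>t. \<bar>t - f x\<bar> < r \<Longrightarrow> (G has_real_derivative G' t) (at t)"
    "isCont G' (f x)"
  shows "strict_deriv (\<lambda>y. G (f y)) (\<lambda>v. G' (f x) * L v) x"
  using strict_deriv_real_compose[OF assms(1,2) real_strict_derivI[OF assms(3-5)]] .

text \<open>Polarization, \<open>f g = ((f + g)^2 - (f - g)^2) / 4\<close>, reduces the product rule
  to the chain rule for squaring.\<close>

lemma strict_deriv_mult:
  fixes f g :: "(nat \<Rightarrow> real) \<Rightarrow> real"
  assumes f: "strict_deriv f L x" and g: "strict_deriv g M x" and x: "x \<in> V"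
  shows "strict_deriv (\<lambda>y. f y * g y) (\<lambda>v. L v * g x + f x * M v) x"
proof -
  have sq: "strict_deriv (\<lambda>y. (h y)\<^sup>2) (\<lambda>v. 2 * h x * H v) x" if "strict_deriv h H x" for h H :: "(nat \<Rightarrow> real) \<Rightarrow> real"
    by (rule strict_deriv_deriv_compose[OF that x, where r = 1 and G = "\<lambda>t. t\<^sup>2" and G' = "\<lambda>t. 2 * t", simplified])
       (auto intro!: derivative_eq_intros continuous_intros)
  have "strict_deriv (\<lambda>y. (1/4) *\<^sub>R ((f y + g y)\<^sup>2 - (f y - g y)\<^sup>2))
     (\<lambda>v. (1/4) *\<^sub>R (2 * (f x + g x) * (L v + M v) - 2 * (f x - g x) * (L v - M v))) x"
    by (intro strict_deriv_cmult strict_deriv_diff sq strict_deriv_add f g)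
  moreover have "(1/4) *\<^sub>R ((f y + g y)\<^sup>2 - (f y - g y)\<^sup>2) = f y * g y" for y
    by (simp add: power2_eq_square algebra_simps)
  moreover have "(1/4) *\<^sub>R (2 * (f x + g x) * (L v + M v) - 2 * (f x - g x) * (L v - M v))
     = L v * g x + f x * M v" for v
    by (simp add: field_simps)
  ultimately show ?thesis by (simp only:)
qed

lemma strict_deriv_divide:
  fixes f g :: "(nat \<Rightarrow> real) \<Rightarrow> real"
  assumes f: "strict_deriv f L x" and g: "strict_deriv g M x" and x: "x \<in> V" and pos: "g x > 0"
  shows "strict_deriv (\<lambda>y. f y / g y) (\<lambda>v. L v / g x - f x * M v / (g x)\<^sup>2) x"
proof -
  have "strict_deriv (\<lambda>y. inverse (g y)) (\<lambda>v. (- 1 / (g x)\<^sup>2) * M v) x"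
  proof (rule strict_deriv_deriv_compose[OF g x pos, where G = "\<lambda>t. inverse t" and G' = "\<lambda>t. - 1 / t\<^sup>2"])
    fix t assume "\<bar>t - g x\<bar> < g x"
    hence "t \<noteq> 0" using pos by auto
    thus "(inverse has_real_derivative - 1 / t\<^sup>2) (at t)"
      using DERIV_inverse[of t UNIV] by (simp add: power2_eq_square divide_inverse)
  qed (use pos in \<open>auto intro!: continuous_intros\<close>)
  from strict_deriv_mult[OF f this x] have "strict_deriv (\<lambda>y. f y * inverse (g y))
    (\<lambda>v. L v * inverse (g x) + f x * (- 1 / (g x)\<^sup>2 * M v)) x" .
  moreover have "L v * inverse (g x) + f x * (- 1 / (g x)\<^sup>2 * M v) = L v / g x - f x * M v / (g x)\<^sup>2" for v
    by (simp add: divide_inverse)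
  ultimately show ?thesis by (simp add: divide_inverse mult.assoc mult.commute mult.left_commute)
qed

text \<open>By homogeneity a bound near 0 is a bound everywhere; \<open>v\<close> is scaled into the
  small ball.\<close>

lemma bdd_lin_norm_le:
  assumes "bdd_lin L" "d > 0" "x \<in> V" "\<And>v. v \<in> V \<Longrightarrow> N v < d \<Longrightarrow> norm (L v) \<le> K * N v" "v \<in> V"
  shows "norm (L v) \<le> K * N v"
proof -
  define c where "c = d / (2 * (N v + 1))"
  have c: "c > 0" using assms norm_nonneg[of v] by (auto simp: c_def)
  have "N (scl c v) < d"
  proof -
    have "N (scl c v) = d / 2 * (N v / (N v + 1))" using norm_scl[OF assms(5), of c] c norm_nonneg[OF assms(5)] by (simp add: c_def field_simps)
    also have "\<dots> \<le> d / 2 * 1" using assms norm_nonneg[of v] by (intro mult_left_mono) auto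
    finally show ?thesis using assms by simp
  qed
  hence "norm (L (scl c v)) \<le> K * N (scl c v)" using assms by (simp add: scl_mem)
  hence "c * norm (L v) \<le> c * (K * N v)" using assms c by (simp add: bdd_lin_scl norm_scl algebra_simps)
  thus ?thesis using c by simp
qed

lemma strict_deriv_norm_le:
  assumes "strict_deriv f L x" "x \<in> V" and K: "\<And>y z. y \<in> V \<Longrightarrow> z \<in> V \<Longrightarrow> norm (f y - f z) \<le> K * N (y - z)"
    and v: "v \<in> V"
  shows "norm (L v) \<le> K * N v"
proof (rule field_le_epsilon)
  fix e :: real assume e: "e > 0"
  define e' where "e' = e / (N v + 1)"
  have e': "e' > 0" using e norm_nonneg[OF v] by (simp add: e'_def)
  obtain d where d: "d > 0" "\<forall>y\<in>V. \<forall>z\<in>V. N (y - x) < d \<longrightarrow> N (z - x) < d \<longrightarrow>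
     norm (f y - f z - L (y - z)) \<le> e' * N (y - z)" using strict_derivD[OF assms(1) e'] by blast
  have "norm (L v) \<le> (K + e') * N v"
  proof (rule bdd_lin_norm_le[OF strict_deriv_bdd_lin[OF assms(1)] d(1) assms(2) _ v])
    fix v assume v: "v \<in> V" "N v < d"
    have "norm (f (x + v) - f x - L v) \<le> e' * N v"
      using d(2)[rule_format, of "x + v" x] v assms(2) d(1) by (simp add: add_mem)
    moreover have "norm (f (x + v) - f x) \<le> K * N v"
      using K[of "x + v" x] v assms(2) by (simp add: add_mem)
    moreover have "norm (L v) \<le> norm (f (x + v) - f x) + norm (f (x + v) - f x - L v)"
      using norm_triangle_ineq4[of "f (x + v) - f x" "f (x + v) - f x - L v"] by simp
    ultimately show "norm (L v) \<le> (K + e') * N v" by (simp add: algebra_simps)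
  qed
  also have "\<dots> \<le> K * N v + e"
    using e norm_nonneg[OF v] by (simp add: e'_def field_simps)
  finally show "norm (L v) \<le> K * N v + e" .
qed

text \<open>The strict estimate at \<open>x\<close> also covers pairs of points clustering at a
  nearby \<open>y\<close>. There \<open>Df x\<close> and \<open>Df y\<close> approximate the same
  increments, so they are close. This is how continuity of the derivative is recovered from strict
  differentiability.\<close>

lemma strict_deriv_deriv_continuous:
  assumes "strict_deriv f (Df x) x" "x \<in> V" "e > 0"
  shows "\<exists>d>0. \<forall>y\<in>V. N (y - x) < d \<longrightarrow> strict_deriv f (Df y) y \<longrightarrow> (\<forall>v\<in>V. norm (Df y v - Df x v) \<le> e * N v)"
proof -
  obtain d where d: "d > 0" "\<forall>y\<in>V. \<forall>z\<in>V. N (y - x) < d \<longrightarrow> N (z - x) < d \<longrightarrow>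
     norm (f y - f z - Df x (y - z)) \<le> e/2 * N (y - z)" using strict_derivD[OF assms(1), of "e/2"] assms(3) by auto
  show ?thesis
  proof (intro exI[of _ d] conjI ballI impI)
    fix y v assume y: "y \<in> V" "N (y - x) < d" "strict_deriv f (Df y) y" and v: "v \<in> V"
    obtain d' where d': "d' > 0" "\<forall>w\<in>V. \<forall>z\<in>V. N (w - y) < d' \<longrightarrow> N (z - y) < d' \<longrightarrow>
      norm (f w - f z - Df y (w - z)) \<le> e/2 * N (w - z)" using strict_derivD[OF y(3), of "e/2"] assms(3) by auto
    have l: "bdd_lin (Df x)" "bdd_lin (Df y)" using assms y by (auto intro: strict_deriv_bdd_lin)
    have "bdd_lin (\<lambda>v. Df y v - Df x v)" using bdd_lin_plus[OF l(2) bdd_lin_cmult[OF l(1), of "-1"]] by simp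
    thus "norm (Df y v - Df x v) \<le> e * N v"
    proof (rule bdd_lin_norm_le[where d = "min d' (d - N (y - x))"])
      show "0 < min d' (d - N (y - x))" using y d' by simp
      fix v assume v: "v \<in> V" "N v < min d' (d - N (y - x))"
      have "N (y + v - x) < d" using norm_add[of "y - x" v] v y assms by (simp add: diff_mem algebra_simps)
      hence 1: "norm (f (y + v) - f y - Df x v) \<le> e/2 * N v"
        using d(2)[rule_format, of "y + v" y] v y by (simp add: add_mem)
      have 2: "norm (f (y + v) - f y - Df y v) \<le> e/2 * N v"
        using d'(2)[rule_format, of "y + v" y] v y d' by (simp add: add_mem)
      have "norm (Df y v - Df x v) = norm ((f (y + v) - f y - Df x v) - (f (y + v) - f y - Df y v))"
        by simp
      also have "\<dots> \<le> norm (f (y + v) - f y - Df x v) + norm (f (y + v) - f y - Df y v)"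
        by (rule norm_triangle_ineq4)
      also have "\<dots> \<le> e * N v" using 1 2 by linarith
      finally show "norm (Df y v - Df x v) \<le> e * N v" .
    qed (use v assms in auto)
  qed (rule d)
qed

end

section \<open>Smoothing Lipschitz functions coordinatewise\<close>

context seq_lattice
begin

lemma strict_deriv_map_add:
  assumes "strict_deriv_map F D x" "strict_deriv_map G E x" shows "strict_deriv_map (\<lambda>y. F y + G y) (\<lambda>v. D v + E v) x"
  unfolding strict_deriv_map_def
proof (intro conjI allI impI)
  have lD: "bdd_lin_map D" and lE: "bdd_lin_map E" and Fm: "\<And>y. y \<in> V \<Longrightarrow> F y \<in> V" and Gm: "\<And>y. y \<in> V \<Longrightarrow> G y \<in> V"
    using assms by (auto simp: strict_deriv_map_def)
  show "\<forall>y\<in>V. F y + G y \<in> V" using Fm Gm by (simp add: add_mem)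
  obtain K where K: "K > 0" "\<forall>u\<in>V. N (D u) \<le> K * N u" using bdd_lin_map_bound[OF lD] by blast
  obtain K' where K': "K' > 0" "\<forall>u\<in>V. N (E u) \<le> K' * N u" using bdd_lin_map_bound[OF lE] by blast
  have "N (D u + E u) \<le> (K + K') * N u" if "u \<in> V" for u
    using K K' that norm_add[OF bdd_lin_map_mem[OF lD that] bdd_lin_map_mem[OF lE that]] by (force simp: algebra_simps)
  hence "\<exists>K. \<forall>u\<in>V. N (D u + E u) \<le> K * N u" by blast
  moreover have "scl c (D u) + scl c (E u) = scl c (D u + E u)" for c u
    by (auto simp: scl_def algebra_simps)
  ultimately show "bdd_lin_map (\<lambda>v. D v + E v)"
    using lD lE unfolding bdd_lin_map_def by (simp add: add_mem algebra_simps)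
  fix e :: real assume e: "e > 0"
  obtain d where d: "d > 0" "\<forall>y\<in>V. \<forall>z\<in>V. N (y - x) < d \<longrightarrow> N (z - x) < d \<longrightarrow>
     N (F y - F z - D (y - z)) \<le> e/2 * N (y - z)" using strict_deriv_mapD[OF assms(1), of "e/2"] e by auto
  obtain d' where d': "d' > 0" "\<forall>y\<in>V. \<forall>z\<in>V. N (y - x) < d' \<longrightarrow> N (z - x) < d' \<longrightarrow>
     N (G y - G z - E (y - z)) \<le> e/2 * N (y - z)" using strict_deriv_mapD[OF assms(2), of "e/2"] e by auto
  have "N (F y + G y - (F z + G z) - (D (y - z) + E (y - z))) \<le> e * N (y - z)"
    if yz: "y \<in> V" "z \<in> V" "N (y - x) < min d d'" "N (z - x) < min d d'" for y z
  proof -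
    have m: "F y - F z - D (y - z) \<in> V" "G y - G z - E (y - z) \<in> V"
      using yz Fm Gm bdd_lin_map_mem[OF lD] bdd_lin_map_mem[OF lE] by (simp_all add: diff_mem)
    have "F y + G y - (F z + G z) - (D (y - z) + E (y - z)) =
      (F y - F z - D (y - z)) + (G y - G z - E (y - z))" by (simp add: algebra_simps)
    hence "N (F y + G y - (F z + G z) - (D (y - z) + E (y - z))) \<le>
      N (F y - F z - D (y - z)) + N (G y - G z - E (y - z))"
      using norm_add[OF m] by metis
    also have "\<dots> \<le> e/2 * N (y - z) + e/2 * N (y - z)"
      using d d' yz by (intro add_mono) auto
    finally show ?thesis by simp
  qed
  thus "\<exists>d>0. \<forall>y\<in>V. \<forall>z\<in>V. N (y - x) < d \<longrightarrow> N (z - x) < d \<longrightarrow>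
     N (F y + G y - (F z + G z) - (D (y - z) + E (y - z))) \<le> e * N (y - z)"
    using d d' by (intro exI[of _ "min d d'"]) auto
qed

lemma norm_scl_unit: "N (scl a (unit_seq n)) \<le> \<bar>a\<bar>"
  using norm_scl[OF unit_seq_mem, of a n] mult_left_mono[OF norm_unit_le[of n], of "\<bar>a\<bar>"] by simp

lemma strict_deriv_map_unit:
  fixes g :: "(nat \<Rightarrow> real) \<Rightarrow> real"
  assumes "strict_deriv g L x" shows "strict_deriv_map (\<lambda>y. scl (g y) (unit_seq n)) (\<lambda>v. scl (L v) (unit_seq n)) x"
  unfolding strict_deriv_map_def
proof (intro conjI allI impI)
  have lL: "bdd_lin L" using assms by (rule strict_deriv_bdd_lin)
  obtain K where K: "K > 0" "\<forall>u\<in>V. norm (L u) \<le> K * N u" using bdd_lin_bound[OF lL] by blast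
  have "N (scl (L u) (unit_seq n)) \<le> K * N u" if "u \<in> V" for u
    using norm_scl_unit[of "L u" n] K that by force
  hence "\<exists>K. \<forall>u\<in>V. N (scl (L u) (unit_seq n)) \<le> K * N u" by blast
  moreover have "scl (L (u + v)) (unit_seq n) = scl (L u) (unit_seq n) + scl (L v) (unit_seq n)" if "u \<in> V" "v \<in> V" for u v
    using bdd_lin_add[OF lL that] by (auto simp: fun_eq_iff algebra_simps)
  moreover have "scl (L (scl c u)) (unit_seq n) = scl c (scl (L u) (unit_seq n))" if "u \<in> V" for c u
    using bdd_lin_scl[OF lL that] by (auto simp: fun_eq_iff)
  ultimately show "bdd_lin_map (\<lambda>v. scl (L v) (unit_seq n))" unfolding bdd_lin_map_def by (simp add: scl_mem)
  show "\<forall>y\<in>V. scl (g y) (unit_seq n) \<in> V" by (simp add: scl_mem)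
  fix e :: real assume e: "e > 0"
  obtain d where d: "d > 0" "\<forall>y\<in>V. \<forall>z\<in>V. N (y - x) < d \<longrightarrow> N (z - x) < d \<longrightarrow>
     norm (g y - g z - L (y - z)) \<le> e * N (y - z)" using strict_derivD[OF assms e] by blast
  have "N (scl (g y) (unit_seq n) - scl (g z) (unit_seq n) - scl (L (y - z)) (unit_seq n)) \<le> e * N (y - z)"
    if yz: "y \<in> V" "z \<in> V" "N (y - x) < d" "N (z - x) < d" for y z
  proof -
    have "scl (g y) (unit_seq n) - scl (g z) (unit_seq n) - scl (L (y - z)) (unit_seq n)
      = scl (g y - g z - L (y - z)) (unit_seq n)"
      by (auto simp: fun_eq_iff algebra_simps)
    thus ?thesis using norm_scl_unit[of "g y - g z - L (y - z)" n] d yz by force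
  qed
  thus "\<exists>d>0. \<forall>y\<in>V. \<forall>z\<in>V. N (y - x) < d \<longrightarrow> N (z - x) < d \<longrightarrow>
     N (scl (g y) (unit_seq n) - scl (g z) (unit_seq n) - scl (L (y - z)) (unit_seq n)) \<le> e * N (y - z)"
    using d by blast
qed

lemma strict_deriv_map_zero: "strict_deriv_map (\<lambda>x. 0) (\<lambda>v. 0) x"
proof -
  have "scl 0 (unit_seq 0) = 0" by (auto simp: scl_def)
  thus ?thesis using strict_deriv_map_unit[OF strict_deriv_const[of 0 x], of 0] by simp
qed

text \<open>A map acting on each coordinate separately inherits differentiability from its scalar
  parts because their second-order error has one constant for all coordinates; solidity turns the
  coordinatewise error bound into a norm bound.\<close>

lemma strict_deriv_map_tail:
  assumes k: "\<And>n a b t. \<bar>k n a - k n b - k' n t * (a - b)\<bar> \<le> 2 * max \<bar>a - t\<bar> \<bar>b - t\<bar> * \<bar>a - b\<bar>"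
    and r: "r > 0" "\<And>y i. y \<in> V \<Longrightarrow> N (y - x) < r \<Longrightarrow> n \<le> i \<Longrightarrow> F y i = k i (y i)"
    and F: "\<And>y. y \<in> V \<Longrightarrow> F y \<in> V" and x: "x \<in> V"
    and k': "\<And>i. n \<le> i \<Longrightarrow> \<bar>k' i (x i)\<bar> \<le> 1"
  shows "strict_deriv_map (\<lambda>y. tail n (F y)) (\<lambda>v. tail n (\<lambda>i. k' i (x i) * v i)) x"
  unfolding strict_deriv_map_def
proof (intro conjI allI impI)
  show "\<forall>y\<in>V. tail n (F y) \<in> V" using F by (simp add: tail_mem)
  have D: "tail n (\<lambda>i. k' i (x i) * v i) \<in> V \<and> N (tail n (\<lambda>i. k' i (x i) * v i)) \<le> N v" if "v \<in> V" for v
    by (rule solid[OF that]) (auto simp: tail_def abs_mult k' mult_left_le_one_le)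
  hence "\<exists>K. \<forall>u\<in>V. N (tail n (\<lambda>i. k' i (x i) * u i)) \<le> K * N u" by (intro exI[of _ 1]) auto
  thus "bdd_lin_map (\<lambda>v. tail n (\<lambda>i. k' i (x i) * v i))"
    using D unfolding bdd_lin_map_def by (auto simp: fun_eq_iff tail_def algebra_simps)
  fix e :: real assume e: "e > 0"
  define d where "d = min r (e / 2)"
  have "N (tail n (F y) - tail n (F z) - tail n (\<lambda>i. k' i (x i) * (y - z) i)) \<le> e * N (y - z)"
    if yz: "y \<in> V" "z \<in> V" "N (y - x) < d" "N (z - x) < d" for y z
  proof -
    have "\<bar>(tail n (F y) - tail n (F z) - tail n (\<lambda>i. k' i (x i) * (y - z) i)) i\<bar> \<le> \<bar>scl e (y - z) i\<bar>" for i
    proof (cases "n \<le> i")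
      case True
      have "\<bar>y i - x i\<bar> \<le> e / 2" "\<bar>z i - x i\<bar> \<le> e / 2"
        using coord_le[of "y - x" i] coord_le[of "z - x" i] yz x by (auto simp: d_def diff_mem)
      hence "2 * max \<bar>y i - x i\<bar> \<bar>z i - x i\<bar> * \<bar>y i - z i\<bar> \<le> e * \<bar>y i - z i\<bar>"
        by (intro mult_right_mono) auto
      with k[of i "y i" "z i" "x i"]
      have "\<bar>k i (y i) - k i (z i) - k' i (x i) * (y i - z i)\<bar> \<le> e * \<bar>y i - z i\<bar>" by linarith
      thus ?thesis using True yz r e by (simp add: tail_def d_def abs_mult)
    qed (simp add: tail_def)
    hence "N (tail n (F y) - tail n (F z) - tail n (\<lambda>i. k' i (x i) * (y - z) i)) \<le> N (scl e (y - z))"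
      using solid[of "scl e (y - z)"] yz by (simp add: scl_mem diff_mem)
    thus ?thesis using e yz by (simp add: norm_scl diff_mem)
  qed
  thus "\<exists>d>0. \<forall>y\<in>V. \<forall>z\<in>V. N (y - x) < d \<longrightarrow> N (z - x) < d \<longrightarrow>
     N (tail n (F y) - tail n (F z) - tail n (\<lambda>i. k' i (x i) * (y - z) i)) \<le> e * N (y - z)"
    using r e by (intro exI[of _ d]) (auto simp: d_def)
qed

text \<open>Lipschitz partial derivatives in the directions \<open>J\<close>, with a quantitative
  error. Only increments \<open>t \<ge> 0\<close> are asked for, which suits averaging over a window
  to the right; negative ones follow from the Lipschitz bound.\<close>

definition coord_deriv :: "nat set \<Rightarrow> ((nat \<Rightarrow> real) \<Rightarrow> real) \<Rightarrow> (nat \<Rightarrow> (nat \<Rightarrow> real) \<Rightarrow> real) \<Rightarrow> real \<Rightarrow> bool" where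
  "coord_deriv J g D C \<longleftrightarrow> (\<forall>j\<in>J. \<forall>x\<in>V.
      (\<forall>t\<ge>0. \<bar>g (x + scl t (unit_seq j)) - g x - t * D j x\<bar> \<le> C * t\<^sup>2) \<and>
      (\<forall>y\<in>V. \<bar>D j x - D j y\<bar> \<le> C * N (x - y)))"

lemma coord_derivD:
  "coord_deriv J g D C \<Longrightarrow> j \<in> J \<Longrightarrow> x \<in> V \<Longrightarrow> t \<ge> 0 \<Longrightarrow> \<bar>g (x + scl t (unit_seq j)) - g x - t * D j x\<bar> \<le> C * t\<^sup>2"
  "coord_deriv J g D C \<Longrightarrow> j \<in> J \<Longrightarrow> x \<in> V \<Longrightarrow> y \<in> V \<Longrightarrow> \<bar>D j x - D j y\<bar> \<le> C * N (x - y)"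
  unfolding coord_deriv_def by blast+

text \<open>Continuous partial derivatives imply differentiability: since \<open>g\<close> depends
  on \<open>n\<close> coordinates, an increment is a telescoping sum of \<open>n\<close>
  one-coordinate increments.\<close>

lemma strict_deriv_of_coord_deriv:
  assumes coord_deriv: "coord_deriv {..<n} g D C" and g: "\<And>x. x \<in> V \<Longrightarrow> g (head n x) = g x" and C: "C \<ge> 0" and x: "x \<in> V"
  shows "strict_deriv g (\<lambda>v. \<Sum>j<n. D j x * v j) x"
  unfolding strict_deriv_def
proof (intro conjI allI impI)
  have "bdd_lin (\<lambda>v. \<Sum>j<m. D j x * v j)" for m
  proof (induction m)
    case (Suc m)
    show ?case using bdd_lin_plus[OF Suc bdd_lin_cmult[OF bdd_lin_coord, of "D m x" m]] by simp
  qed (simp add: bdd_lin_0)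
  thus "bdd_lin (\<lambda>v. \<Sum>j<n. D j x * v j)" .
  have step: "\<bar>g (p + scl t (unit_seq j)) - g p - t * D j p\<bar> \<le> 2 * C * t\<^sup>2"
    if "j < n" "p \<in> V" for j p t
  proof (cases "t \<ge> 0")
    case True
    have "\<bar>g (p + scl t (unit_seq j)) - g p - t * D j p\<bar> \<le> C * t\<^sup>2"
      using that True by (intro coord_derivD(1)[OF coord_deriv]) auto
    moreover have "0 \<le> C * t\<^sup>2" using C by simp
    ultimately show ?thesis by linarith
  next
    case False
    \<comment> \<open>A negative step from \<open>p\<close> is a positive step from
      \<open>q\<close>; moving the partial derivative from \<open>q\<close> back to \<open>p\<close>
      costs another \<open>C * t^2\<close>.\<close>
    define q where "q = p + scl t (unit_seq j)"
    have q: "q \<in> V" using that by (simp add: q_def add_mem scl_mem)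
    have p: "p = q + scl (- t) (unit_seq j)" by (auto simp: q_def fun_eq_iff)
    have 1: "\<bar>g p - g q - (- t) * D j q\<bar> \<le> C * (- t)\<^sup>2"
    proof -
      have "\<bar>g (q + scl (- t) (unit_seq j)) - g q - (- t) * D j q\<bar> \<le> C * (- t)\<^sup>2"
        using that q False by (intro coord_derivD(1)[OF coord_deriv]) auto
      thus ?thesis by (simp only: p[symmetric])
    qed
    have "\<bar>D j q - D j p\<bar> \<le> C * N (q - p)" using that q by (intro coord_derivD(2)[OF coord_deriv]) auto
    also have "\<dots> \<le> C * \<bar>t\<bar>"
      using norm_scl_unit[of t j] C by (intro mult_left_mono) (auto simp: q_def)
    finally have "\<bar>t\<bar> * \<bar>D j q - D j p\<bar> \<le> \<bar>t\<bar> * (C * \<bar>t\<bar>)" by (intro mult_left_mono) auto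
    moreover have "\<bar>t\<bar> * (C * \<bar>t\<bar>) = C * (\<bar>t\<bar> * \<bar>t\<bar>)" by (simp only: mult_ac)
    ultimately have 2: "\<bar>t * (D j q - D j p)\<bar> \<le> C * t\<^sup>2"
      by (simp add: abs_mult power2_eq_square)
    have "g q - g p - t * D j p = - (g p - g q - (- t) * D j q) + t * (D j q - D j p)"
      by (simp add: algebra_simps)
    hence "\<bar>g q - g p - t * D j p\<bar> \<le> C * t\<^sup>2 + C * t\<^sup>2" using 1 2 by (simp only: power2_minus)
    thus ?thesis by (simp add: q_def)
  qed
  fix e :: real assume e: "e > 0"
  \<comment> \<open>Each of the \<open>n\<close> increments will contribute an error of at most
    \<open>6 * C * d * N (y - z)\<close>: \<open>4 C d\<close> from the expansion and
    \<open>2 C d\<close> from moving the base point. The added 1 keeps the denominator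
    positive.\<close>
  define d where "d = e / (6 * C * n + 1)"
  have den: "6 * C * n + 1 > 0" using C by (simp add: add_nonneg_pos)
  have d: "d > 0" using e den by (simp add: d_def)
  have "norm (g y - g z - (\<Sum>j<n. D j x * (y - z) j)) \<le> e * N (y - z)"
    if yz: "y \<in> V" "z \<in> V" "N (y - x) < d" "N (z - x) < d" for y z
  proof -
    \<comment> \<open>A path from \<open>z\<close> to a point with the head of \<open>y\<close>,
      changing one coordinate at a time.\<close>
    define p where "p j = head j y + tail j z" for j
    have pm: "p j \<in> V" for j using yz by (simp add: p_def add_mem head_mem tail_mem)
    have p0: "p 0 = z" by (auto simp: p_def head_def tail_def)
    have "head n (p n) = head n y" by (auto simp: p_def head_def tail_def)
    hence pn: "g (p n) = g y" using g[OF pm, of n] g[of y] yz by simp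
    have ps: "p (Suc j) = p j + scl (y j - z j) (unit_seq j)" for j
      by (auto simp: p_def head_def tail_def unit_seq_def fun_eq_iff less_Suc_eq)
    have tel: "g y - g z = (\<Sum>j<n. g (p (Suc j)) - g (p j))"
      using sum_lessThan_telescope[of "\<lambda>j. g (p j)" n] pn p0 by simp
    have nyz: "N (y - z) \<le> 2 * d" using norm_diff_triangle[of y x z] yz x norm_minus_commute'[of x z] by simp
    have n0: "0 \<le> N (y - z)" using yz by (simp add: norm_nonneg diff_mem)
    have b: "\<bar>g (p (Suc j)) - g (p j) - D j x * (y - z) j\<bar> \<le> 6 * C * d * N (y - z)" if j: "j < n" for j
    proof -
      have a: "\<bar>y j - z j\<bar> \<le> N (y - z)" using coord_le[of "y - z" j] yz by (simp add: diff_mem)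
      have 1: "\<bar>g (p (Suc j)) - g (p j) - (y j - z j) * D j (p j)\<bar> \<le> 2 * C * (y j - z j)\<^sup>2"
        using step[OF j pm] by (simp add: ps)
      have "(y j - z j)\<^sup>2 = \<bar>y j - z j\<bar> * \<bar>y j - z j\<bar>" by (simp add: power2_eq_square)
      also have "\<dots> \<le> (2 * d) * N (y - z)" using a nyz n0 by (intro mult_mono) auto
      finally have "2 * C * (y j - z j)\<^sup>2 \<le> 2 * C * ((2 * d) * N (y - z))"
        using C by (intro mult_left_mono) auto
      with 1 have 2: "\<bar>g (p (Suc j)) - g (p j) - (y j - z j) * D j (p j)\<bar> \<le> 4 * C * d * N (y - z)"
        by simp
      have "p j - x = head j (y - x) + tail j (z - x)" by (auto simp: p_def head_def tail_def)
      hence "N (p j - x) \<le> N (y - x) + N (z - x)"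
        using norm_add[of "head j (y - x)" "tail j (z - x)"] norm_head[of "y - x" j] norm_tail[of "z - x" j] yz x
        by (simp add: head_mem tail_mem diff_mem)
      hence pd': "N (p j - x) \<le> 2 * d" using yz by simp
      have "\<bar>D j (p j) - D j x\<bar> \<le> C * N (p j - x)" using j pm x by (intro coord_derivD(2)[OF coord_deriv]) auto
      also have "\<dots> \<le> C * (2 * d)" using pd' C by (intro mult_left_mono) auto
      finally have "\<bar>y j - z j\<bar> * \<bar>D j (p j) - D j x\<bar> \<le> N (y - z) * (C * (2 * d))"
        using a n0 by (intro mult_mono) auto
      hence 3: "\<bar>(y j - z j) * (D j (p j) - D j x)\<bar> \<le> 2 * C * d * N (y - z)"
        by (simp only: abs_mult) (simp add: mult_ac)
      have "g (p (Suc j)) - g (p j) - D j x * (y - z) j =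
        (g (p (Suc j)) - g (p j) - (y j - z j) * D j (p j)) + (y j - z j) * (D j (p j) - D j x)"
        by (simp add: algebra_simps)
      thus ?thesis using 2 3 by linarith
    qed
    have "g y - g z - (\<Sum>j<n. D j x * (y - z) j) = (\<Sum>j<n. g (p (Suc j)) - g (p j) - D j x * (y - z) j)"
      by (simp add: tel sum_subtractf)
    hence "norm (g y - g z - (\<Sum>j<n. D j x * (y - z) j)) \<le> (\<Sum>j<n. \<bar>g (p (Suc j)) - g (p j) - D j x * (y - z) j\<bar>)"
      by (simp add: sum_abs del: minus_apply)
    also have "\<dots> \<le> (\<Sum>j<n. 6 * C * d * N (y - z))" using b by (intro sum_mono) auto
    also have "\<dots> = (6 * C * n * d) * N (y - z)" by simp
    also have "\<dots> \<le> e * N (y - z)"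
    proof (intro mult_right_mono n0)
      have "6 * C * n * d \<le> (6 * C * n + 1) * d" using d by (simp add: algebra_simps)
      also have "\<dots> = e" using den by (simp add: d_def)
      finally show "6 * C * n * d \<le> e" .
    qed
    finally show ?thesis .
  qed
  thus "\<exists>d>0. \<forall>y\<in>V. \<forall>z\<in>V. N (y - x) < d \<longrightarrow> N (z - x) < d \<longrightarrow>
     norm (g y - g z - (\<Sum>j<n. D j x * (y - z) j)) \<le> e * N (y - z)" using d by blast
qed

text \<open>A moving average over a window of length \<open>\<delta>\<close> in direction
  \<open>i\<close> keeps the Lipschitz constant and all regularity already gained in the directions
  \<open>J\<close>, and makes the function differentiable in direction \<open>i\<close> as
  well.\<close>

lemma average_coordinate:
  assumes lip: "\<And>x y. x \<in> V \<Longrightarrow> y \<in> V \<Longrightarrow> \<bar>g x - g y\<bar> \<le> \<kappa> * N (x - y)" and \<kappa>: "\<kappa> \<ge> 0"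
    and coord_deriv: "coord_deriv J g D C" and C: "C \<ge> 0" and \<delta>: "\<delta> > 0" and i: "i < n"
    and g: "\<And>x. x \<in> V \<Longrightarrow> g (head n x) = g x"
  shows "\<exists>g' D' C'. (\<forall>x\<in>V. \<forall>y\<in>V. \<bar>g' x - g' y\<bar> \<le> \<kappa> * N (x - y)) \<and> coord_deriv (insert i J) g' D' C' \<and> C' \<ge> 0 \<and>
    (\<forall>x\<in>V. \<bar>g' x - g x\<bar> \<le> \<kappa> * \<delta>) \<and> (\<forall>x\<in>V. g' (head n x) = g' x)"
proof -
  define g' where "g' x = (1 / \<delta>) * integral {0..\<delta>} (\<lambda>t. g (x + scl t (unit_seq i)))" for x
  \<comment> \<open>The derivative of a moving average along its own direction is the difference
    quotient over the window; the partial derivatives in other directions are simply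
    averaged.\<close>
  define D' where "D' j x = (if j = i then (g (x + scl \<delta> (unit_seq i)) - g x) / \<delta>
     else (1 / \<delta>) * integral {0..\<delta>} (\<lambda>t. D j (x + scl t (unit_seq i))))" for j x
  define C' where "C' = C + 2 * \<kappa> / \<delta>"
  have xm: "x + scl t (unit_seq i) \<in> V" if "x \<in> V" for x t using that by (simp add: add_mem scl_mem)
  have dm: "N ((x + scl t (unit_seq i)) - (x + scl t' (unit_seq i))) \<le> \<bar>t - t'\<bar>" for x t t'
  proof -
    have "(x + scl t (unit_seq i)) - (x + scl t' (unit_seq i)) = scl (t - t') (unit_seq i)"
      by (auto simp: fun_eq_iff algebra_simps)
    thus ?thesis using norm_scl_unit by simp
  qed
  have lipc: "continuous_on A (\<lambda>t. f (x + scl t (unit_seq i)))"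
    if f: "\<And>x y. x \<in> V \<Longrightarrow> y \<in> V \<Longrightarrow> \<bar>f x - f y\<bar> \<le> K * N (x - y)" and "K \<ge> 0" "x \<in> V"
    for f :: "(nat \<Rightarrow> real) \<Rightarrow> real" and K x A
  proof (rule continuous_on_subset)
    show "continuous_on UNIV (\<lambda>t. f (x + scl t (unit_seq i)))"
    proof (rule lipschitz_on_continuous_on)
      show "K-lipschitz_on UNIV (\<lambda>t. f (x + scl t (unit_seq i)))"
      proof (rule lipschitz_onI)
        fix s t :: real
        have "\<bar>f (x + scl s (unit_seq i)) - f (x + scl t (unit_seq i))\<bar> \<le> K * N ((x + scl s (unit_seq i)) - (x + scl t (unit_seq i)))"
          using that by (intro f xm) auto
        also have "\<dots> \<le> K * \<bar>s - t\<bar>" using dm that by (intro mult_left_mono) auto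
        finally show "dist (f (x + scl s (unit_seq i))) (f (x + scl t (unit_seq i))) \<le> K * dist s t"
          by (simp add: dist_real_def)
      qed (use that in simp)
    qed
  qed simp
  have gc: "continuous_on A (\<lambda>t. g (x + scl t (unit_seq i)))" if "x \<in> V" for x A
    using lipc[OF lip \<kappa> that] .
  have Dlip: "\<bar>D j x - D j y\<bar> \<le> C * N (x - y)" if "j \<in> J" "x \<in> V" "y \<in> V" for j x y
    using that by (intro coord_derivD(2)[OF coord_deriv]) auto
  have Dc: "continuous_on A (\<lambda>t. D j (x + scl t (unit_seq i)))" if "x \<in> V" "j \<in> J" for x A j
    using lipc[OF Dlip[OF that(2)] C that(1)] .
  have ib: "\<bar>(1 / \<delta>) * integral {0..\<delta>} f\<bar> \<le> B"
    if "continuous_on {0..\<delta>} f" "\<And>t. t \<in> {0..\<delta>} \<Longrightarrow> \<bar>f t\<bar> \<le> B" for f :: "real \<Rightarrow> real" and B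
  proof -
    have "norm (integral {0..\<delta>} f) \<le> B * (\<delta> - 0)"
      using that \<delta> by (intro integral_bound) auto
    thus ?thesis using \<delta> by (simp add: abs_mult field_simps)
  qed
  have cint: "f integrable_on {a..b}" if "continuous_on {a..b} f" for f :: "real \<Rightarrow> real" and a b
    using that by (rule integrable_continuous_real)
  have avg_lip: "\<bar>(1 / \<delta>) * integral {0..\<delta>} (\<lambda>t. f (x + scl t (unit_seq i))) - (1 / \<delta>) * integral {0..\<delta>} (\<lambda>t. f (y + scl t (unit_seq i)))\<bar> \<le> K * N (x - y)"
    if f: "\<And>x y. x \<in> V \<Longrightarrow> y \<in> V \<Longrightarrow> \<bar>f x - f y\<bar> \<le> K * N (x - y)" and K: "K \<ge> 0" and xy: "x \<in> V" "y \<in> V"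
    for f :: "(nat \<Rightarrow> real) \<Rightarrow> real" and K x y
  proof -
    have "(1 / \<delta>) * integral {0..\<delta>} (\<lambda>t. f (x + scl t (unit_seq i))) - (1 / \<delta>) * integral {0..\<delta>} (\<lambda>t. f (y + scl t (unit_seq i)))
      = (1 / \<delta>) * integral {0..\<delta>} (\<lambda>t. f (x + scl t (unit_seq i)) - f (y + scl t (unit_seq i)))"
      using lipc[OF f K] xy by (subst integral_diff) (auto intro!: cint simp: right_diff_distrib)
    moreover have "\<bar>(1 / \<delta>) * integral {0..\<delta>} (\<lambda>t. f (x + scl t (unit_seq i)) - f (y + scl t (unit_seq i)))\<bar> \<le> K * N (x - y)"
    proof (rule ib)
      show "continuous_on {0..\<delta>} (\<lambda>t. f (x + scl t (unit_seq i)) - f (y + scl t (unit_seq i)))"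
        using lipc[OF f K] xy by (intro continuous_on_diff) auto
      fix t
      have "(x + scl t (unit_seq i)) - (y + scl t (unit_seq i)) = x - y" by simp
      thus "\<bar>f (x + scl t (unit_seq i)) - f (y + scl t (unit_seq i))\<bar> \<le> K * N (x - y)"
        using f[OF xm xm, of x y t t] xy by metis
    qed
    ultimately show ?thesis by simp
  qed
  have L: "\<bar>g' x - g' y\<bar> \<le> \<kappa> * N (x - y)" if "x \<in> V" "y \<in> V" for x y
    unfolding g'_def using avg_lip[OF lip \<kappa> that] .
  have near: "\<bar>g' x - g x\<bar> \<le> \<kappa> * \<delta>" if x: "x \<in> V" for x
  proof -
    have "g' x - g x = (1 / \<delta>) * integral {0..\<delta>} (\<lambda>t. g (x + scl t (unit_seq i)) - g x)"
      using gc[OF x] \<delta> by (subst integral_diff) (auto intro!: cint simp: g'_def field_simps)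
    moreover have "\<bar>(1 / \<delta>) * integral {0..\<delta>} (\<lambda>t. g (x + scl t (unit_seq i)) - g x)\<bar> \<le> \<kappa> * \<delta>"
    proof (rule ib)
      show "continuous_on {0..\<delta>} (\<lambda>t. g (x + scl t (unit_seq i)) - g x)"
        using gc[OF x] by (intro continuous_on_diff) auto
      fix t assume t: "t \<in> {0..\<delta>}"
      have "\<bar>g (x + scl t (unit_seq i)) - g x\<bar> \<le> \<kappa> * N (x + scl t (unit_seq i) - x)" using x by (intro lip xm)
      also have "\<dots> \<le> \<kappa> * \<delta>" using norm_scl_unit[of t i] t \<kappa> by (intro mult_left_mono) auto
      finally show "\<bar>g (x + scl t (unit_seq i)) - g x\<bar> \<le> \<kappa> * \<delta>" .
    qed
    ultimately show ?thesis by simp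
  qed
  have hd': "g' (head n x) = g' x" if x: "x \<in> V" for x
  proof -
    have "g (head n x + scl t (unit_seq i)) = g (x + scl t (unit_seq i))" for t
    proof -
      have "head n x + scl t (unit_seq i) = head n (x + scl t (unit_seq i))"
        using i by (auto simp: head_def unit_seq_def fun_eq_iff)
      thus ?thesis using g[OF xm[OF x]] by simp
    qed
    thus ?thesis by (simp add: g'_def)
  qed
  have C': "C \<le> C'" "2 * \<kappa> / \<delta> \<le> C'" "0 \<le> C'" using C \<kappa> \<delta> by (auto simp: C'_def)
  have 1: "\<bar>g' (x + scl t (unit_seq j)) - g' x - t * D' j x\<bar> \<le> C' * t\<^sup>2"
    if j: "j \<in> insert i J" and x: "x \<in> V" and t: "t \<ge> 0" for j x t
  proof (cases "j = i")
    case False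
    hence jJ: "j \<in> J" using j by simp
    have xj: "x + scl t (unit_seq j) \<in> V" using x by (simp add: add_mem scl_mem)
    have "g' (x + scl t (unit_seq j)) - g' x - t * D' j x = (1 / \<delta>) * integral {0..\<delta>}
      (\<lambda>s. g (x + scl t (unit_seq j) + scl s (unit_seq i)) - g (x + scl s (unit_seq i)) - t * D j (x + scl s (unit_seq i)))"
    proof -
      have i1: "(\<lambda>s. g (x + scl t (unit_seq j) + scl s (unit_seq i))) integrable_on {0..\<delta>}"
        "(\<lambda>s. g (x + scl s (unit_seq i))) integrable_on {0..\<delta>}"
        "(\<lambda>s. t * D j (x + scl s (unit_seq i))) integrable_on {0..\<delta>}"
        using gc[OF x] gc[OF xj] Dc[OF x jJ] by (auto intro!: cint continuous_on_mult)
      have "integral {0..\<delta>} (\<lambda>s. g (x + scl t (unit_seq j) + scl s (unit_seq i)) - g (x + scl s (unit_seq i)) - t * D j (x + scl s (unit_seq i)))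
        = integral {0..\<delta>} (\<lambda>s. g (x + scl t (unit_seq j) + scl s (unit_seq i))) - integral {0..\<delta>} (\<lambda>s. g (x + scl s (unit_seq i)))
          - t * integral {0..\<delta>} (\<lambda>s. D j (x + scl s (unit_seq i)))"
        using i1 by (simp add: integral_diff integrable_diff)
      thus ?thesis using False by (simp add: g'_def D'_def right_diff_distrib)
    qed
    moreover have "\<bar>(1 / \<delta>) * integral {0..\<delta>}
      (\<lambda>s. g (x + scl t (unit_seq j) + scl s (unit_seq i)) - g (x + scl s (unit_seq i)) - t * D j (x + scl s (unit_seq i)))\<bar> \<le> C * t\<^sup>2"
    proof (rule ib)
      show "continuous_on {0..\<delta>} (\<lambda>s. g (x + scl t (unit_seq j) + scl s (unit_seq i)) - g (x + scl s (unit_seq i)) - t * D j (x + scl s (unit_seq i)))"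
        using gc[OF x] gc[OF xj] Dc[OF x jJ] by (intro continuous_on_diff continuous_on_mult) auto
      fix s
      have "x + scl t (unit_seq j) + scl s (unit_seq i) = (x + scl s (unit_seq i)) + scl t (unit_seq j)" by (simp add: algebra_simps)
      hence *: "g (x + scl t (unit_seq j) + scl s (unit_seq i)) = g ((x + scl s (unit_seq i)) + scl t (unit_seq j))" by (rule arg_cong)
      show "\<bar>g (x + scl t (unit_seq j) + scl s (unit_seq i)) - g (x + scl s (unit_seq i)) - t * D j (x + scl s (unit_seq i))\<bar> \<le> C * t\<^sup>2"
        unfolding * by (rule coord_derivD(1)[OF coord_deriv jJ xm[OF x] t])
    qed
    moreover have "C * t\<^sup>2 \<le> C' * t\<^sup>2" using C' by (intro mult_right_mono) auto
    ultimately show ?thesis by linarith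
  next
    case True
    define G where "G s = g (x + scl s (unit_seq i))" for s
    have Gc: "continuous_on A G" for A using gc[OF x] by (simp add: G_def[abs_def])
    have Glip: "\<bar>G a - G b\<bar> \<le> \<kappa> * \<bar>a - b\<bar>" for a b
    proof -
      have "\<bar>G a - G b\<bar> \<le> \<kappa> * N ((x + scl a (unit_seq i)) - (x + scl b (unit_seq i)))" unfolding G_def by (intro lip xm x)
      also have "\<dots> \<le> \<kappa> * \<bar>a - b\<bar>" using dm \<kappa> by (intro mult_left_mono) auto
      finally show ?thesis .
    qed
    have Gs: "continuous_on A (\<lambda>s. G (\<delta> + s))" for A
      by (rule continuous_on_compose2[OF Gc[of UNIV]]) (auto intro!: continuous_intros)
    note ci = cint[OF Gc] cint[OF Gs] cint[OF continuous_on_diff[OF Gs Gc]] integrable_const_ivl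
    have sh: "integral {0..b} (\<lambda>s. G (a + s)) = integral {a..a + b} G" for a b
      using integral_shift[of 0 a b G] Gc by (simp add: o_def add.commute)
    have e1: "x + scl t (unit_seq i) + scl s (unit_seq i) = x + scl (t + s) (unit_seq i)" for s
      by (auto simp: fun_eq_iff algebra_simps)
    \<comment> \<open>Shifting the window by \<open>t\<close> gains a piece at one end and loses one
      at the other. What remains is an integral of length \<open>t\<close> whose integrand is within
      \<open>2 * \<kappa> * t\<close> of its value at 0.\<close>
    have "integral {0..t} G + integral {t..t + \<delta>} G = integral {0..t + \<delta>} G"
      using t \<delta> Gc by (intro Henstock_Kurzweil_Integration.integral_combine cint) auto
    moreover have "integral {0..\<delta>} G + integral {\<delta>..\<delta> + t} G = integral {0..\<delta> + t} G"
      using t \<delta> Gc by (intro Henstock_Kurzweil_Integration.integral_combine cint) auto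
    ultimately have "integral {t..t + \<delta>} G - integral {0..\<delta>} G = integral {\<delta>..\<delta> + t} G - integral {0..t} G"
      by (simp add: add.commute)
    also have "\<dots> = integral {0..t} (\<lambda>s. G (\<delta> + s)) - integral {0..t} G" by (simp add: sh)
    also have "\<dots> = integral {0..t} (\<lambda>s. G (\<delta> + s) - G s)"
      by (rule integral_diff[symmetric]) (rule ci)+
    finally have 2: "integral {t..t + \<delta>} G - integral {0..\<delta>} G = integral {0..t} (\<lambda>s. G (\<delta> + s) - G s)" .
    have "integral {0..t} (\<lambda>s. G (\<delta> + s) - G s) - t * (G \<delta> - G 0) = integral {0..t} (\<lambda>s. (G (\<delta> + s) - G s) - (G \<delta> - G 0))"
      using t integral_diff[OF ci(3) ci(4), of 0 t "G \<delta> - G 0"] by simp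
    moreover have "norm (integral {0..t} (\<lambda>s. (G (\<delta> + s) - G s) - (G \<delta> - G 0))) \<le> (2 * \<kappa> * t) * (t - 0)"
    proof (rule integral_bound)
      show "continuous_on {0..t} (\<lambda>s. (G (\<delta> + s) - G s) - (G \<delta> - G 0))"
        by (intro continuous_on_diff Gs Gc continuous_on_const)
      fix s assume s: "s \<in> {0..t}"
      have "\<kappa> * \<bar>s\<bar> \<le> \<kappa> * t" using s \<kappa> by (intro mult_left_mono) auto
      thus "norm ((G (\<delta> + s) - G s) - (G \<delta> - G 0)) \<le> 2 * \<kappa> * t"
        using Glip[of "\<delta> + s" \<delta>] Glip[of s 0] by simp
    qed (use t in auto)
    ultimately have 3: "\<bar>(integral {t..t + \<delta>} G - integral {0..\<delta>} G) - t * (G \<delta> - G 0)\<bar> \<le> 2 * \<kappa> * t\<^sup>2"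
      by (simp add: 2 power2_eq_square)
    have x0: "x + scl 0 (unit_seq i) = x" by (auto simp: fun_eq_iff)
    have "g' (x + scl t (unit_seq j)) - g' x - t * D' j x = (1 / \<delta>) * ((integral {t..t + \<delta>} G - integral {0..\<delta>} G) - t * (G \<delta> - G 0))"
    proof -
      have "(\<lambda>s. g (x + scl t (unit_seq j) + scl s (unit_seq i))) = (\<lambda>s. G (t + s))"
        using True by (simp only: e1 G_def)
      hence "g' (x + scl t (unit_seq j)) = (1 / \<delta>) * integral {t..t + \<delta>} G"
        using sh[of \<delta> t] by (simp add: g'_def)
      moreover have "g' x = (1 / \<delta>) * integral {0..\<delta>} G" by (simp add: g'_def G_def[abs_def])
      moreover have "D' j x = (1 / \<delta>) * (G \<delta> - G 0)" using True by (simp add: D'_def G_def x0)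
      ultimately show ?thesis by (simp only:) (simp add: algebra_simps)
    qed
    hence "\<bar>g' (x + scl t (unit_seq j)) - g' x - t * D' j x\<bar> \<le> (1 / \<delta>) * (2 * \<kappa> * t\<^sup>2)"
      using 3 \<delta> by (simp add: abs_mult divide_right_mono)
    also have "\<dots> \<le> C' * t\<^sup>2" using C' mult_right_mono[OF C'(2), of "t\<^sup>2"] by simp
    finally show ?thesis .
  qed
  have 2: "\<bar>D' j x - D' j y\<bar> \<le> C' * N (x - y)" if j: "j \<in> insert i J" and xy: "x \<in> V" "y \<in> V" for j x y
  proof -
    have n: "0 \<le> N (x - y)" using xy by (simp add: norm_nonneg diff_mem)
    show ?thesis
    proof (cases "j = i")
      case False
      hence jJ: "j \<in> J" using j by simp
      have "\<bar>D' j x - D' j y\<bar> \<le> C * N (x - y)"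
        using avg_lip[OF Dlip[OF jJ] C xy] False by (simp add: D'_def)
      also have "\<dots> \<le> C' * N (x - y)" using C' n by (intro mult_right_mono) auto
      finally show ?thesis .
    next
      case True
      have "(x + scl \<delta> (unit_seq i)) - (y + scl \<delta> (unit_seq i)) = x - y" by simp
      hence "\<bar>g (x + scl \<delta> (unit_seq i)) - g (y + scl \<delta> (unit_seq i))\<bar> \<le> \<kappa> * N (x - y)"
        using lip[OF xm xm, of x y \<delta> \<delta>] xy by metis
      hence "\<bar>(g (x + scl \<delta> (unit_seq i)) - g x) - (g (y + scl \<delta> (unit_seq i)) - g y)\<bar> \<le> 2 * \<kappa> * N (x - y)"
        using lip[OF xy] by linarith
      hence "(1 / \<delta>) * \<bar>(g (x + scl \<delta> (unit_seq i)) - g x) - (g (y + scl \<delta> (unit_seq i)) - g y)\<bar> \<le> (1 / \<delta>) * (2 * \<kappa> * N (x - y))"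
        using \<delta> by (intro mult_left_mono) auto
      hence "\<bar>D' j x - D' j y\<bar> \<le> (2 * \<kappa> / \<delta>) * N (x - y)"
        using True \<delta> by (simp add: D'_def diff_divide_distrib[symmetric])
      also have "\<dots> \<le> C' * N (x - y)" using C' n by (intro mult_right_mono) auto
      finally show ?thesis .
    qed
  qed
  have "coord_deriv (insert i J) g' D' C'" unfolding coord_deriv_def using 1 2 by blast
  thus ?thesis using L near hd' C' by blast
qed

text \<open>Restrict to the head and average the coordinates below \<open>n\<close> one after the
  other. The Lipschitz constant survives unchanged; the smoothness constant degrades with each step,
  but only its finiteness matters.\<close>

lemma smoothing:
  assumes lip: "\<And>x y. x \<in> V \<Longrightarrow> y \<in> V \<Longrightarrow> \<bar>r x - r y\<bar> \<le> \<kappa> * N (x - y)" and \<kappa>: "\<kappa> \<ge> 0" and \<theta>: "\<theta> > 0"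
  shows "\<exists>g dg. (\<forall>x\<in>V. strict_deriv g (dg x) x) \<and> (\<forall>x\<in>V. \<forall>y\<in>V. \<bar>g x - g y\<bar> \<le> \<kappa> * N (x - y)) \<and>
    (\<forall>x\<in>V. \<bar>g x - r (head n x)\<bar> \<le> \<theta>) \<and> (\<forall>x\<in>V. g (head n x) = g x)"
proof -
  \<comment> \<open>Each of the \<open>n\<close> averagings costs
    \<open>\<kappa> * \<delta>\<close>, so the total stays below \<open>\<theta>\<close>.\<close>
  define \<delta> where "\<delta> = \<theta> / (\<kappa> * n + 1)"
  have den: "\<kappa> * n + 1 > 0" using \<kappa> by (simp add: add_nonneg_pos)
  have \<delta>: "\<delta> > 0" using \<theta> den by (simp add: \<delta>_def)
  define Lip :: "((nat \<Rightarrow> real) \<Rightarrow> real) \<Rightarrow> bool"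
    where "Lip g \<longleftrightarrow> (\<forall>x\<in>V. \<forall>y\<in>V. \<bar>g x - g y\<bar> \<le> \<kappa> * N (x - y))" for g
  have "\<exists>g D C. Lip g \<and> coord_deriv {..<m} g D C \<and> C \<ge> 0 \<and>
    (\<forall>x\<in>V. \<bar>g x - r (head n x)\<bar> \<le> m * (\<kappa> * \<delta>)) \<and> (\<forall>x\<in>V. g (head n x) = g x)" if "m \<le> n" for m
    using that
  proof (induction m)
    case 0
    have "\<bar>r (head n x) - r (head n y)\<bar> \<le> \<kappa> * N (x - y)" if "x \<in> V" "y \<in> V" for x y
    proof -
      have "\<bar>r (head n x) - r (head n y)\<bar> \<le> \<kappa> * N (head n x - head n y)" using that by (intro lip head_mem)
      also have "head n x - head n y = head n (x - y)" by (auto simp: head_def)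
      also have "\<kappa> * N (head n (x - y)) \<le> \<kappa> * N (x - y)"
        using \<kappa> that by (intro mult_left_mono norm_head diff_mem)
      finally show ?thesis .
    qed
    hence Lip: "Lip (\<lambda>x. r (head n x))" unfolding Lip_def by blast
    have "head n (head n x) = head n x" for x by (auto simp: head_def)
    moreover have "coord_deriv {..<0} (\<lambda>x. r (head n x)) (\<lambda>_ _. 0) 0" by (simp add: coord_deriv_def)
    ultimately show ?case
      by (intro exI[of _ "\<lambda>x. r (head n x)"] exI[of _ "\<lambda>_ _. 0"] exI[of _ 0]) (simp add: Lip)
  next
    case (Suc m)
    then obtain g D C where g: "Lip g" "coord_deriv {..<m} g D C" "C \<ge> 0"
      "\<forall>x\<in>V. \<bar>g x - r (head n x)\<bar> \<le> m * (\<kappa> * \<delta>)" "\<forall>x\<in>V. g (head n x) = g x" by auto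
    have Lg: "\<bar>g x - g y\<bar> \<le> \<kappa> * N (x - y)" if "x \<in> V" "y \<in> V" for x y
      using g(1) that unfolding Lip_def by blast
    have mn: "m < n" using Suc.prems by simp
    have gh: "g (head n x) = g x" if "x \<in> V" for x using g(5) that by blast
    from average_coordinate[OF Lg \<kappa> g(2,3) \<delta> mn gh]
    obtain g' D' C' where g': "Lip g'" "coord_deriv (insert m {..<m}) g' D' C'" "C' \<ge> 0"
      "\<forall>x\<in>V. \<bar>g' x - g x\<bar> \<le> \<kappa> * \<delta>" "\<forall>x\<in>V. g' (head n x) = g' x"
      unfolding Lip_def by blast
    have "\<bar>g' x - r (head n x)\<bar> \<le> Suc m * (\<kappa> * \<delta>)" if "x \<in> V" for x
      using g(4) g'(4) that by (force simp: algebra_simps)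
    moreover have "insert m {..<m} = {..<Suc m}" by auto
    ultimately show ?case using g' by (intro exI[of _ g'] exI[of _ D'] exI[of _ C']) auto
  qed
  from this[of n] obtain g D C where g: "Lip g" "coord_deriv {..<n} g D C" "C \<ge> 0"
    "\<forall>x\<in>V. \<bar>g x - r (head n x)\<bar> \<le> n * (\<kappa> * \<delta>)" "\<forall>x\<in>V. g (head n x) = g x" by auto
  have "n * (\<kappa> * \<delta>) \<le> (\<kappa> * n + 1) * \<delta>" using \<delta> by (simp add: algebra_simps)
  also have "\<dots> = \<theta>" using den by (simp add: \<delta>_def)
  finally have "\<forall>x\<in>V. \<bar>g x - r (head n x)\<bar> \<le> \<theta>" using g(4) by force
  moreover have "\<forall>x\<in>V. strict_deriv g (\<lambda>v. \<Sum>j<n. D j x * v j) x"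
    using strict_deriv_of_coord_deriv[OF g(2) _ g(3)] g(5) by blast
  ultimately show ?thesis using g(1,5) unfolding Lip_def
    by (intro exI[of _ g] exI[of _ "\<lambda>x v. \<Sum>j<n. D j x * v j"] conjI)
qed

end

section \<open>Damping far coordinates\<close>

text \<open>Quantitative form of having a \<open>K\<close>-Lipschitz derivative. The constant is
  uniform in the base point, as infinitely many coordinates have to be treated at once.\<close>

definition quad_deriv :: "real \<Rightarrow> (real \<Rightarrow> real) \<Rightarrow> (real \<Rightarrow> real) \<Rightarrow> bool" where
  "quad_deriv K G G' \<longleftrightarrow> (\<forall>a b t. \<bar>G a - G b - G' t * (a - b)\<bar> \<le> K * max \<bar>a - t\<bar> \<bar>b - t\<bar> * \<bar>a - b\<bar>)"

lemma quad_derivD: "quad_deriv K G G' \<Longrightarrow> \<bar>G a - G b - G' t * (a - b)\<bar> \<le> K * max \<bar>a - t\<bar> \<bar>b - t\<bar> * \<bar>a - b\<bar>"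
  by (simp add: quad_deriv_def)

lemma quad_deriv_strict:
  assumes "quad_deriv K G G'" "e > 0"
  shows "\<exists>d>0. \<forall>a b. \<bar>a - c\<bar> < d \<longrightarrow> \<bar>b - c\<bar> < d \<longrightarrow> \<bar>G a - G b - G' c * (a - b)\<bar> \<le> e * \<bar>a - b\<bar>"
proof (intro exI[of _ "e / (\<bar>K\<bar> + 1)"] conjI allI impI)
  show "e / (\<bar>K\<bar> + 1) > 0" using assms by simp
  fix a b assume ab: "\<bar>a - c\<bar> < e / (\<bar>K\<bar> + 1)" "\<bar>b - c\<bar> < e / (\<bar>K\<bar> + 1)"
  have "K * max \<bar>a - c\<bar> \<bar>b - c\<bar> \<le> (\<bar>K\<bar> + 1) * (e / (\<bar>K\<bar> + 1))"
    using ab by (intro mult_mono) auto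
  also have "\<dots> = e" by simp
  finally have "K * max \<bar>a - c\<bar> \<bar>b - c\<bar> * \<bar>a - b\<bar> \<le> e * \<bar>a - b\<bar>" by (rule mult_right_mono) simp
  with quad_derivD[OF assms(1), of a b c] show "\<bar>G a - G b - G' c * (a - b)\<bar> \<le> e * \<bar>a - b\<bar>" by linarith
qed

lemma quad_deriv_add: "quad_deriv K G G' \<Longrightarrow> quad_deriv L H H' \<Longrightarrow> quad_deriv (K + L) (\<lambda>t. G t + H t) (\<lambda>t. G' t + H' t)"
  unfolding quad_deriv_def
proof (intro allI)
  fix a b t :: real
  assume 1: "\<forall>a b t. \<bar>G a - G b - G' t * (a - b)\<bar> \<le> K * max \<bar>a - t\<bar> \<bar>b - t\<bar> * \<bar>a - b\<bar>"
    and 2: "\<forall>a b t. \<bar>H a - H b - H' t * (a - b)\<bar> \<le> L * max \<bar>a - t\<bar> \<bar>b - t\<bar> * \<bar>a - b\<bar>"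
  have "G a + H a - (G b + H b) - (G' t + H' t) * (a - b) =
    (G a - G b - G' t * (a - b)) + (H a - H b - H' t * (a - b))" by (simp add: algebra_simps)
  also have "\<bar>\<dots>\<bar> \<le> K * max \<bar>a - t\<bar> \<bar>b - t\<bar> * \<bar>a - b\<bar> + L * max \<bar>a - t\<bar> \<bar>b - t\<bar> * \<bar>a - b\<bar>"
    using 1[rule_format, of a b t] 2[rule_format, of a b t] by linarith
  finally show "\<bar>G a + H a - (G b + H b) - (G' t + H' t) * (a - b)\<bar> \<le> (K + L) * max \<bar>a - t\<bar> \<bar>b - t\<bar> * \<bar>a - b\<bar>"
    by (simp add: algebra_simps)
qed

lemma quad_deriv_cmult: "quad_deriv K G G' \<Longrightarrow> quad_deriv (\<bar>c\<bar> * K) (\<lambda>t. c * G t) (\<lambda>t. c * G' t)"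
  unfolding quad_deriv_def
proof (intro allI)
  fix a b t :: real
  assume 1: "\<forall>a b t. \<bar>G a - G b - G' t * (a - b)\<bar> \<le> K * max \<bar>a - t\<bar> \<bar>b - t\<bar> * \<bar>a - b\<bar>"
  have "c * G a - c * G b - c * G' t * (a - b) = c * (G a - G b - G' t * (a - b))" by (simp add: algebra_simps)
  also have "\<bar>\<dots>\<bar> \<le> \<bar>c\<bar> * (K * max \<bar>a - t\<bar> \<bar>b - t\<bar> * \<bar>a - b\<bar>)"
    using 1 by (simp add: abs_mult mult_left_mono)
  finally show "\<bar>c * G a - c * G b - c * G' t * (a - b)\<bar> \<le> \<bar>c\<bar> * K * max \<bar>a - t\<bar> \<bar>b - t\<bar> * \<bar>a - b\<bar>"
    by (simp only: mult.assoc)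
qed

lemma quad_deriv_shift: "quad_deriv K G G' \<Longrightarrow> quad_deriv K (\<lambda>t. G (t + c)) (\<lambda>t. G' (t + c))"
  unfolding quad_deriv_def
proof (intro allI)
  fix a b t :: real
  assume "\<forall>a b t. \<bar>G a - G b - G' t * (a - b)\<bar> \<le> K * max \<bar>a - t\<bar> \<bar>b - t\<bar> * \<bar>a - b\<bar>"
  from this[rule_format, of "a + c" "b + c" "t + c"]
  show "\<bar>G (a + c) - G (b + c) - G' (t + c) * (a - b)\<bar> \<le> K * max \<bar>a - t\<bar> \<bar>b - t\<bar> * \<bar>a - b\<bar>" by simp
qed

lemma quad_deriv_affine: "K \<ge> 0 \<Longrightarrow> quad_deriv K (\<lambda>t. c * t + d) (\<lambda>t. c)"
  by (auto simp: quad_deriv_def algebra_simps max_def)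

section \<open>Piecewise quadratic cut-offs\<close>

definition pos2 :: "real \<Rightarrow> real" where "pos2 t = (max 0 t)\<^sup>2"

lemma quad_deriv_pos2: "quad_deriv 2 pos2 (\<lambda>t. 2 * max 0 t)"
proof -
  have *: "\<bar>pos2 a - pos2 b - 2 * max 0 t * (a - b)\<bar> \<le> 2 * max \<bar>a - t\<bar> \<bar>b - t\<bar> * \<bar>a - b\<bar>"
    if "b \<le> a" for a b t :: real
  proof -
    \<comment> \<open>\<open>\<xi>\<close> is the exact slope of the chord of \<open>pos2\<close>
      between \<open>b\<close> and \<open>a\<close>; comparing it with the derivative at
      \<open>t\<close> replaces the mean value theorem.\<close>
    define \<xi> where "\<xi> = (if b < 0 \<and> 0 < a then a * (a / (a - b)) else max 0 a + max 0 b)"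
    have 1: "pos2 a - pos2 b = \<xi> * (a - b)"
    proof (cases "b < 0 \<and> 0 < a")
      case True
      hence "a * (a / (a - b)) * (a - b) = a * a" by simp
      thus ?thesis using True by (simp add: \<xi>_def pos2_def max_def power2_eq_square)
    next
      case False
      thus ?thesis using that by (auto simp: \<xi>_def pos2_def max_def power2_eq_square algebra_simps)
    qed
    have x: "a / (a - b) \<le> 1 \<and> 0 \<le> a / (a - b)" if "b < 0" "0 < a" using that by auto
    have 2: "0 \<le> \<xi> \<and> \<xi> \<le> a" if "b < 0" "0 < a"
      using x[OF that] that mult_left_mono[of "a / (a - b)" 1 a] by (auto simp: \<xi>_def)
    have "\<bar>\<xi> - 2 * max 0 t\<bar> \<le> 2 * max \<bar>a - t\<bar> \<bar>b - t\<bar>"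
    proof (cases "b < 0 \<and> 0 < a")
      case True
      thus ?thesis using 2 by (auto simp: max_def abs_if)
    next
      case False
      thus ?thesis using that unfolding \<xi>_def by (auto simp: max_def abs_if)
    qed
    hence "\<bar>\<xi> - 2 * max 0 t\<bar> * \<bar>a - b\<bar> \<le> 2 * max \<bar>a - t\<bar> \<bar>b - t\<bar> * \<bar>a - b\<bar>"
      by (rule mult_right_mono) simp
    moreover have "pos2 a - pos2 b - 2 * max 0 t * (a - b) = (\<xi> - 2 * max 0 t) * (a - b)"
      using 1 by (simp add: algebra_simps)
    ultimately show ?thesis by (simp add: abs_mult)
  qed
  show ?thesis unfolding quad_deriv_def
  proof (intro allI)
    fix a b t :: real
    show "\<bar>pos2 a - pos2 b - 2 * max 0 t * (a - b)\<bar> \<le> 2 * max \<bar>a - t\<bar> \<bar>b - t\<bar> * \<bar>a - b\<bar>"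
    proof (cases "b \<le> a")
      case False
      have "pos2 b - pos2 a - 2 * max 0 t * (b - a) = - (pos2 a - pos2 b - 2 * max 0 t * (a - b))"
        by (simp add: algebra_simps)
      hence "\<bar>pos2 b - pos2 a - 2 * max 0 t * (b - a)\<bar> = \<bar>pos2 a - pos2 b - 2 * max 0 t * (a - b)\<bar>"
        by (simp only: abs_minus_cancel)
      with *[of a b t] False show ?thesis by (simp only: abs_minus_commute[of a b] max.commute not_le less_imp_le)
    qed (rule *)
  qed
qed

text \<open>A quadratic spline with knots 1, 3/2 and 2: the weights 2, -4, 2 make it rise
  continuously differentiably from 0 at 1 to 1 at 2, with slope at most 2.\<close>

definition ramp :: "real \<Rightarrow> real" where
  "ramp t = 2 * pos2 (t + - 1) + ((- 4) * pos2 (t + - 3/2) + 2 * pos2 (t + - 2))"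

definition ramp' :: "real \<Rightarrow> real" where
  "ramp' t = 2 * (2 * max 0 (t + - 1)) + ((- 4) * (2 * max 0 (t + - 3/2)) + 2 * (2 * max 0 (t + - 2)))"

lemma quad_deriv_W: "quad_deriv (\<bar>2\<bar> * 2 + (\<bar>- 4\<bar> * 2 + \<bar>2\<bar> * 2)) ramp ramp'"
  unfolding ramp_def[abs_def] ramp'_def[abs_def]
  by (intro quad_deriv_add quad_deriv_cmult quad_deriv_shift[of _ pos2 "\<lambda>t. 2 * max 0 t"] quad_deriv_pos2)

lemma ramp_eq_0: "t \<le> 1 \<Longrightarrow> ramp t = 0" and ramp'_eq_0: "t \<le> 1 \<or> t \<ge> 2 \<Longrightarrow> ramp' t = 0"
  and ramp_eq_1: "t \<ge> 2 \<Longrightarrow> ramp t = 1"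
  by (auto simp: ramp_def ramp'_def pos2_def max_def power2_eq_square field_simps)

lemma ramp'_bounds: "0 \<le> ramp' t" "ramp' t \<le> 2"
  by (auto simp: ramp'_def max_def)

lemma ramp_bounds: "0 \<le> ramp t" "ramp t \<le> 1"
proof -
  have a: "(t - 1)\<^sup>2 * 2 \<le> 1" if "1 \<le> t" "t \<le> 3/2"
  proof -
    have "(t - 1) * (t - 1) \<le> (1/2) * (1/2)" using that by (intro mult_mono) auto
    thus ?thesis by (simp add: power2_eq_square)
  qed
  have b: "2 * (t - 1)\<^sup>2 - 4 * (t - 3/2)\<^sup>2 = 1 - 2 * (2 - t)\<^sup>2" by (simp add: power2_eq_square field_simps)
  have c: "(2 - t)\<^sup>2 * 2 \<le> 1" if "3/2 \<le> t" "t \<le> 2"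
  proof -
    have "(2 - t) * (2 - t) \<le> (1/2) * (1/2)" using that by (intro mult_mono) auto
    thus ?thesis by (simp add: power2_eq_square)
  qed
  consider "t \<le> 1" | "1 \<le> t" "t \<le> 3/2" | "3/2 \<le> t" "t \<le> 2" | "2 \<le> t" by linarith
  hence "0 \<le> ramp t \<and> ramp t \<le> 1"
  proof cases
    case 2
    hence "ramp t = 2 * (t - 1)\<^sup>2" by (simp add: ramp_def pos2_def max_def)
    thus ?thesis using a 2 by simp
  next
    case 3
    hence "ramp t = 2 * (t - 1)\<^sup>2 - 4 * (t - 3/2)\<^sup>2" by (auto simp: ramp_def pos2_def max_def)
    thus ?thesis using b c 3 by simp
  qed (simp_all add: ramp_eq_0 ramp_eq_1)
  thus "0 \<le> ramp t" "ramp t \<le> 1" by auto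
qed

text \<open>The functions \<open>s n\<close> are smooth versions of the norm of the tail starting at \<open>n\<close>, kept away
  from \<open>0\<close>. In \<open>c\<^sub>0\<close> they depend locally on finitely many coordinates; in \<open>\<ell>\<^sub>p\<close> the far
  coordinates enter their derivatives only through the duality map. Assumption \<open>ds_proportional\<close>
  covers both cases.\<close>

locale seq_space = seq_lattice +
  fixes s :: "nat \<Rightarrow> (nat \<Rightarrow> real) \<Rightarrow> real"
    and ds :: "nat \<Rightarrow> (nat \<Rightarrow> real) \<Rightarrow> (nat \<Rightarrow> real) \<Rightarrow> real"
  assumes dual: "bdd_lin (L :: _ \<Rightarrow> real) \<Longrightarrow> e > 0 \<Longrightarrow> \<exists>n. \<forall>v\<in>V. \<bar>L (tail n v)\<bar> \<le> e * N v"
    and s_strict_deriv: "x \<in> V \<Longrightarrow> strict_deriv (s n) (ds n x) x"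
    and s_ge: "x \<in> V \<Longrightarrow> (1/2) ^ n \<le> s n x"
    and tail_le_s: "x \<in> V \<Longrightarrow> N (tail n x) \<le> s n x"
    and s_le: "x \<in> V \<Longrightarrow> s n x \<le> 4 * (1/2) ^ n + N (tail n x)"
    and s_lip: "x \<in> V \<Longrightarrow> y \<in> V \<Longrightarrow> \<bar>s n x - s n y\<bar> \<le> N (x - y)"
    and ds_head: "x \<in> V \<Longrightarrow> i < n \<Longrightarrow> ds n x (unit_seq i) = 0"
    and ds_sign: "x \<in> V \<Longrightarrow> 0 \<le> x n * ds n x (unit_seq n)"
    and ds_small: "t > 0 \<Longrightarrow> \<exists>c>0. \<forall>x\<in>V. \<bar>x n\<bar> \<le> c \<longrightarrow> \<bar>ds n x (unit_seq n)\<bar> \<le> t"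
    and ds_proportional: "x \<in> V \<Longrightarrow> (\<And>m. m \<ge> M \<Longrightarrow> x m > 0) \<Longrightarrow>
      \<exists>a. (\<forall>m\<ge>M. a m > 0) \<and> (\<forall>n. \<exists>M'. \<forall>m\<ge>M'. \<forall>m'\<ge>M'.
        a m' * ds n x (unit_seq m) = a m * ds n x (unit_seq m'))"
begin

lemma ds_le: "x \<in> V \<Longrightarrow> v \<in> V \<Longrightarrow> \<bar>ds n x v\<bar> \<le> N v"
  using strict_deriv_norm_le[OF s_strict_deriv[of x n], of 1 v] s_lip[of _ _ n] by simp

lemma s_pos: "x \<in> V \<Longrightarrow> 0 < s n x"
  using s_ge[of x n] by (meson less_le_trans zero_less_divide_1_iff zero_less_numeral zero_less_power)

lemma coord_le_s: "x \<in> V \<Longrightarrow> \<bar>x n\<bar> \<le> s n x"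
  using coord_le[OF tail_mem, of x n n] tail_le_s[of x n] by (simp add: tail_def)

end

text \<open>One recursion with two uses: \<open>k n\<close> is the scalar map put in place of the
  \<open>n\<close>-th coordinate, the constant 0 for truncation and a positive function for bending,
  and \<open>c\<close> bounds what \<open>k\<close> adds at 0. Conditions on \<open>k\<close> are
  confined to \<open>\<bar>t\<bar> \<le> 1/4\<close> because coordinates that get changed are
  bounded by \<open>1/16 + 1/8\<close>.\<close>

locale damping = seq_space +
  fixes r :: "(nat \<Rightarrow> real) \<Rightarrow> real"
    and rad :: "nat \<Rightarrow> (nat \<Rightarrow> real) \<Rightarrow> real"
    and drad :: "nat \<Rightarrow> (nat \<Rightarrow> real) \<Rightarrow> (nat \<Rightarrow> real) \<Rightarrow> real"
    and k k' :: "nat \<Rightarrow> real \<Rightarrow> real" and c :: "nat \<Rightarrow> real"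
  assumes r_nonneg: "x \<in> V \<Longrightarrow> 0 \<le> r x" and r_le: "x \<in> V \<Longrightarrow> r x \<le> 1/16"
    and r_lip: "x \<in> V \<Longrightarrow> y \<in> V \<Longrightarrow> \<bar>r x - r y\<bar> \<le> 1/100 * N (x - y)"
    and rad_strict_deriv: "x \<in> V \<Longrightarrow> strict_deriv (rad n) (drad n x) x"
    and rad_lip: "x \<in> V \<Longrightarrow> y \<in> V \<Longrightarrow> \<bar>rad n x - rad n y\<bar> \<le> 1/100 * N (x - y)"
    and rad_near: "x \<in> V \<Longrightarrow> \<bar>rad n x - r (head n x)\<bar> \<le> (1/2) ^ n / 8"
    and k_qd: "quad_deriv 2 (k n) (k' n)"
    and k_disp: "\<bar>t\<bar> \<le> 1/4 \<Longrightarrow> \<bar>k n t - t\<bar> \<le> \<bar>t\<bar> + c n"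
    and k'_nonneg: "\<bar>t\<bar> \<le> 1/4 \<Longrightarrow> 0 \<le> k' n t" and k'_le: "\<bar>t\<bar> \<le> 1/4 \<Longrightarrow> k' n t \<le> 1"
    and c_mem: "c \<in> V" and c_nonneg: "0 \<le> c n" and c_tail: "N (tail n c) \<le> (1/2) ^ n"
begin

text \<open>The radius is taken at the modified head, the size of the tail at the original point.
  The ratio passed to \<open>ramp\<close> leaves the coordinate alone up to 1 and replaces it
  completely from 2 on.\<close>

primrec prefix :: "nat \<Rightarrow> (nat \<Rightarrow> real) \<Rightarrow> nat \<Rightarrow> real" where
  "prefix 0 x = 0"
| "prefix (Suc n) x = prefix n x + scl (x n + ramp (rad n (prefix n x) / s n x) * (k n (x n) - x n)) (unit_seq n)"

primrec dprefix :: "nat \<Rightarrow> (nat \<Rightarrow> real) \<Rightarrow> (nat \<Rightarrow> real) \<Rightarrow> nat \<Rightarrow> real" where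
  "dprefix 0 x v = 0"
| "dprefix (Suc n) x v = dprefix n x v + scl (v n + (ramp (rad n (prefix n x) / s n x) * ((k' n (x n) - 1) * v n) +
     ramp' (rad n (prefix n x) / s n x) * (drad n (prefix n x) (dprefix n x v) / s n x - rad n (prefix n x) * ds n x v / (s n x)\<^sup>2) *
       (k n (x n) - x n))) (unit_seq n)"

definition \<Phi> :: "(nat \<Rightarrow> real) \<Rightarrow> nat \<Rightarrow> real" where
  "\<Phi> x i = x i + ramp (rad i (prefix i x) / s i x) * (k i (x i) - x i)"

definition D\<Phi> :: "(nat \<Rightarrow> real) \<Rightarrow> (nat \<Rightarrow> real) \<Rightarrow> nat \<Rightarrow> real" where
  "D\<Phi> x v i = v i + (ramp (rad i (prefix i x) / s i x) * ((k' i (x i) - 1) * v i) +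
     ramp' (rad i (prefix i x) / s i x) * (drad i (prefix i x) (dprefix i x v) / s i x - rad i (prefix i x) * ds i x v / (s i x)\<^sup>2) *
       (k i (x i) - x i))"

lemma prefix_eq: "prefix n x = head n (\<Phi> x)"
proof (induction n)
  case (Suc n)
  show ?case by (subst prefix.simps(2), subst (1) Suc) (auto simp: head_def unit_seq_def \<Phi>_def fun_eq_iff less_Suc_eq)
qed (auto simp: head_def)

lemma dprefix_eq: "dprefix n x v = head n (D\<Phi> x v)"
proof (induction n)
  case (Suc n)
  show ?case by (subst dprefix.simps(2), subst (1) Suc) (auto simp: head_def unit_seq_def D\<Phi>_def fun_eq_iff less_Suc_eq)
qed (auto simp: head_def)

lemma prefix_mem: "prefix n x \<in> V"
proof (induction n)
  case 0
  show ?case unfolding prefix.simps by (rule zero_mem)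
next
  case (Suc n)
  show ?case unfolding prefix.simps by (intro add_mem scl_mem unit_seq_mem Suc)
qed

lemma prefix_strict_deriv: "x \<in> V \<Longrightarrow> strict_deriv_map (prefix n) (dprefix n x) x"
proof (induction n)
  case 0
  have "prefix 0 = (\<lambda>x. 0)" "dprefix 0 x = (\<lambda>v. 0)" by (rule ext, rule prefix.simps, rule ext, rule dprefix.simps)
  thus ?case by (simp only: strict_deriv_map_zero)
next
  case (Suc n)
  have q: "strict_deriv (\<lambda>y. rad n (prefix n y) / s n y)
     (\<lambda>v. drad n (prefix n x) (dprefix n x v) / s n x - rad n (prefix n x) * ds n x v / (s n x)\<^sup>2) x"
    by (rule strict_deriv_divide[OF strict_deriv_compose[OF Suc.IH[OF Suc.prems] rad_strict_deriv[OF prefix_mem] Suc.prems]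
          s_strict_deriv[OF Suc.prems] Suc.prems s_pos[OF Suc.prems]])
  have w: "strict_deriv (\<lambda>y. ramp (rad n (prefix n y) / s n y))
    (\<lambda>v. ramp' (rad n (prefix n x) / s n x) * (drad n (prefix n x) (dprefix n x v) / s n x - rad n (prefix n x) * ds n x v / (s n x)\<^sup>2)) x"
    by (rule strict_deriv_real_compose[OF q Suc.prems quad_deriv_strict[OF quad_deriv_W]])
  have kk: "strict_deriv (\<lambda>y. k n (y n) - y n) (\<lambda>v. k' n (x n) * v n - v n) x"
    by (rule strict_deriv_diff[OF strict_deriv_real_compose[OF strict_deriv_coord Suc.prems quad_deriv_strict[OF k_qd]] strict_deriv_coord])
  show ?case unfolding prefix.simps
    by (rule strict_deriv_map_cong[OF strict_deriv_map_add[OF Suc.IH[OF Suc.prems] strict_deriv_map_unit[OF strict_deriv_add[OF strict_deriv_coord strict_deriv_mult[OF w kk Suc.prems]]]]])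
       (unfold dprefix.simps, rule arg_cong[where f = "\<lambda>t. dprefix n x _ + scl t (unit_seq n)"], simp add: algebra_simps)
qed

lemma rad_small: "rad n (prefix n x) \<le> 3/16"
proof -
  have "head n (prefix n x) = prefix n x" by (auto simp: prefix_eq head_def)
  hence "rad n (prefix n x) \<le> r (prefix n x) + (1/2) ^ n / 8"
    using rad_near[OF prefix_mem[of n x], of n] unfolding abs_le_iff by simp
  moreover have "(1/2::real) ^ n \<le> 1" by (simp add: power_le_one)
  ultimately show ?thesis using r_le[OF prefix_mem, of n x] by simp
qed

definition active :: "(nat \<Rightarrow> real) \<Rightarrow> nat \<Rightarrow> bool" where
  "active x n \<longleftrightarrow> s n x \<le> rad n (prefix n x)"

lemma active_coord: "x \<in> V \<Longrightarrow> active x n \<Longrightarrow> \<bar>x n\<bar> \<le> 1/4"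
  using coord_le_s[of x n] rad_small[of n x] by (simp add: active_def)

lemma not_active:
  assumes "x \<in> V" "\<not> active x n" shows "\<Phi> x n = x n" "D\<Phi> x v n = v n"
proof -
  have "rad n (prefix n x) / s n x \<le> 1" using assms s_pos[of x n] by (simp add: active_def)
  thus "\<Phi> x n = x n" "D\<Phi> x v n = v n" by (auto simp: \<Phi>_def D\<Phi>_def ramp_eq_0 ramp'_eq_0)
qed

definition weight :: "(nat \<Rightarrow> real) \<Rightarrow> nat \<Rightarrow> real" where
  "weight x i = (if active x i then \<bar>x i\<bar> + c i else 0)"

lemma weight_nonneg: "0 \<le> weight x i" by (simp add: weight_def c_nonneg)

text \<open>Let \<open>j\<close> be the first active index. Before \<open>j\<close> nothing was
  changed, so the radius there is \<open>rad j (head j x)\<close>, whence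
  \<open>s j x \<le> r x + (1/100 + 1/8) * s j x\<close>. The weight lives on the tail from
  \<open>j\<close>, where coordinates and \<open>c\<close> each have norm at most
  \<open>s j x\<close>; altogether \<open>2 * s j x \<le> 3 * r x\<close>.\<close>

lemma weight_bound: assumes x: "x \<in> V" shows "weight x \<in> V" "N (weight x) \<le> 3 * r x"
proof -
  have "weight x \<in> V \<and> N (weight x) \<le> 3 * r x"
  proof (cases "\<exists>i. active x i")
    case False
    hence "weight x = 0" by (auto simp: weight_def fun_eq_iff)
    thus ?thesis using r_nonneg[OF x] by simp
  next
    case True
    define j where "j = (LEAST i. active x i)"
    have j: "active x j" "\<And>i. i < j \<Longrightarrow> \<not> active x i"
      using LeastI_ex[OF True] not_less_Least by (auto simp: j_def)
    have a: "tail j (\<lambda>i. \<bar>x i\<bar>) \<in> V \<and> N (tail j (\<lambda>i. \<bar>x i\<bar>)) \<le> N (tail j x)"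
      by (rule solid[OF tail_mem[OF x]]) (auto simp: tail_def)
    have ct: "tail j c \<in> V" by (rule tail_mem[OF c_mem])
    have "weight x \<in> V \<and> N (weight x) \<le> N (tail j (\<lambda>i. \<bar>x i\<bar>) + tail j c)"
    proof (rule solid)
      show "tail j (\<lambda>i. \<bar>x i\<bar>) + tail j c \<in> V" using a ct by (simp add: add_mem)
      fix i
      show "\<bar>weight x i\<bar> \<le> \<bar>(tail j (\<lambda>i. \<bar>x i\<bar>) + tail j c) i\<bar>"
        using j(2)[of i] c_nonneg[of i] by (auto simp: weight_def tail_def not_le)
    qed
    moreover have "N (tail j (\<lambda>i. \<bar>x i\<bar>) + tail j c) \<le> s j x + s j x"
      using norm_add[of "tail j (\<lambda>i. \<bar>x i\<bar>)" "tail j c"] a ct tail_le_s[OF x, of j] c_tail[of j] s_ge[OF x, of j] by simp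
    ultimately have 1: "weight x \<in> V \<and> N (weight x) \<le> 2 * s j x" by auto
    have hj: "prefix j x = head j x" using j(2) not_active[OF x] by (auto simp: prefix_eq head_def)
    have hm: "head j x \<in> V" using x by (rule head_mem)
    have hh: "head j (prefix j x) = prefix j x" by (auto simp: prefix_eq head_def)
    have "s j x \<le> rad j (prefix j x)" using j by (simp add: active_def)
    also have "\<dots> \<le> r (prefix j x) + (1/2) ^ j / 8" using rad_near[OF prefix_mem[of j x], of j] unfolding hh by linarith
    also have "r (prefix j x) \<le> r x + 1/100 * N (tail j x)"
    proof -
      have "head j x - x = - tail j x" by (auto simp: head_def tail_def)
      thus ?thesis using r_lip[OF hm x] norm_uminus[OF tail_mem[OF x, of j]] unfolding hj abs_le_iff by simp
    qed
    finally have "s j x \<le> r x + 1/100 * s j x + s j x / 8"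
      using tail_le_s[OF x, of j] s_ge[OF x, of j] by simp
    thus ?thesis using 1 r_nonneg[OF x] by linarith
  qed
  thus "weight x \<in> V" "N (weight x) \<le> 3 * r x" by auto
qed

lemma \<Phi>_disp: assumes x: "x \<in> V" shows "\<Phi> x \<in> V" "N (\<Phi> x - x) \<le> 3 * r x"
proof -
  have "\<Phi> x - x \<in> V \<and> N (\<Phi> x - x) \<le> N (weight x)"
  proof (rule solid[OF weight_bound(1)[OF x]])
    fix i
    show "\<bar>(\<Phi> x - x) i\<bar> \<le> \<bar>weight x i\<bar>"
    proof (cases "active x i")
      case True
      have "\<bar>ramp (rad i (prefix i x) / s i x) * (k i (x i) - x i)\<bar> \<le> 1 * (\<bar>x i\<bar> + c i)"
        unfolding abs_mult using ramp_bounds[of "rad i (prefix i x) / s i x"] k_disp[OF active_coord[OF x True]]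
        by (intro mult_mono) auto
      thus ?thesis using True c_nonneg[of i] by (simp add: \<Phi>_def weight_def)
    qed (simp add: not_active[OF x])
  qed
  moreover have "\<Phi> x = (\<Phi> x - x) + x" by simp
  ultimately show "\<Phi> x \<in> V" "N (\<Phi> x - x) \<le> 3 * r x"
    using weight_bound(2)[OF x] x add_mem by (metis, linarith)
qed

lemma rad_close: assumes x: "x \<in> V"
  shows "\<bar>rad n (prefix n x) - r x\<bar> \<le> (1/2) ^ n / 8 + 3/100 * r x + 1/100 * N (tail n x)"
proof -
  have hh: "head n (prefix n x) = prefix n x" by (auto simp: prefix_eq head_def)
  have "prefix n x - x = head n (\<Phi> x - x) + - tail n x" by (auto simp: prefix_eq head_def tail_def fun_eq_iff)
  hence "N (prefix n x - x) \<le> N (head n (\<Phi> x - x)) + N (tail n x)"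
    using norm_add[of "head n (\<Phi> x - x)" "- tail n x"] x \<Phi>_disp[OF x]
    by (simp add: norm_uminus head_mem tail_mem diff_mem uminus_mem)
  also have "N (head n (\<Phi> x - x)) \<le> 3 * r x"
    using norm_head[of "\<Phi> x - x" n] \<Phi>_disp[OF x] x by (simp add: diff_mem)
  finally have "\<bar>r (prefix n x) - r x\<bar> \<le> 3/100 * r x + 1/100 * N (tail n x)"
    using r_lip[OF prefix_mem x, of n x] by (simp add: field_simps)
  thus ?thesis using rad_near[OF prefix_mem[of n x], of n] unfolding hh by linarith
qed

text \<open>At an active index both \<open>(1/2)^n\<close> and the tail norm are dominated by the
  radius, so the errors in \<open>rad_close\<close> are a small fraction of it, and the local radius
  is comparable to \<open>r x\<close>.\<close>

lemma active_bounds: assumes x: "x \<in> V" "active x n"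
  shows "rad n (prefix n x) \<le> 2 * r x" "4/5 * r x \<le> rad n (prefix n x)" "s n x \<le> 2 * r x" "(1/2) ^ n \<le> 2 * r x"
proof -
  have a: "s n x \<le> rad n (prefix n x)" using x by (simp add: active_def)
  have "\<bar>rad n (prefix n x) - r x\<bar> \<le> rad n (prefix n x) / 8 + 3/100 * r x + 1/100 * rad n (prefix n x)"
    using rad_close[OF x(1), of n] a s_ge[OF x(1), of n] tail_le_s[OF x(1), of n] by linarith
  thus "rad n (prefix n x) \<le> 2 * r x" "4/5 * r x \<le> rad n (prefix n x)"
    using r_nonneg[OF x(1)] by linarith+
  thus "s n x \<le> 2 * r x" "(1/2) ^ n \<le> 2 * r x" using a s_ge[OF x(1), of n] by linarith+
qed

text \<open>The dangerous term is the derivative of \<open>ramp\<close>, of order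
  \<open>1 / s\<close>. It occurs only while \<open>s < rad < 2 * s\<close>, where
  \<open>s \<ge> 2/5 * r x\<close>; the factor \<open>1 / r x\<close> so produced is multiplied by a
  displacement at most \<open>weight x i\<close>, whose norm is again of order
  \<open>r x\<close>.\<close>

lemma D\<Phi>_coord: assumes x: "x \<in> V" and v: "v \<in> V" and r: "r x > 0"
  shows "\<bar>D\<Phi> x v i - v i\<bar> \<le> \<bar>v i\<bar> + (5 / r x) * (N (dprefix i x v) / 100 + 2 * N v) * weight x i"
proof (cases "active x i")
  case False
  thus ?thesis using not_active(2)[OF x False, of v] by (simp add: weight_def)
next
  case True
  define R S where "R = rad i (prefix i x)" and "S = s i x"
  have S: "S > 0" using s_pos x by (simp add: S_def)
  have dzV: "dprefix i x v \<in> V" using bdd_lin_map_mem[OF strict_deriv_map_linV[OF prefix_strict_deriv[OF x]] v] .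
  have dN: "0 \<le> N (dprefix i x v)" "0 \<le> N v" using dzV v by (auto intro: norm_nonneg)
  have weight: "weight x i = \<bar>x i\<bar> + c i" using True by (simp add: weight_def)
  have kd: "\<bar>k i (x i) - x i\<bar> \<le> weight x i" using k_disp[OF active_coord[OF x True]] weight by simp
  have drad: "\<bar>drad i (prefix i x) (dprefix i x v)\<bar> \<le> 1/100 * N (dprefix i x v)"
  proof -
    have "norm (drad i (prefix i x) (dprefix i x v)) \<le> 1/100 * N (dprefix i x v)"
      by (rule strict_deriv_norm_le[OF rad_strict_deriv[OF prefix_mem] prefix_mem _ dzV]) (use rad_lip in simp)
    thus ?thesis by simp
  qed
  have dS: "\<bar>ds i x v\<bar> \<le> N v" using ds_le x v .
  have 1: "\<bar>ramp (R / S) * ((k' i (x i) - 1) * v i)\<bar> \<le> \<bar>v i\<bar>"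
  proof -
    have "\<bar>k' i (x i) - 1\<bar> \<le> 1" using k'_nonneg[of "x i" i] k'_le[of "x i" i] active_coord[OF x True] by linarith
    hence "\<bar>(k' i (x i) - 1) * v i\<bar> \<le> 1 * \<bar>v i\<bar>" unfolding abs_mult by (intro mult_right_mono) auto
    hence "\<bar>ramp (R / S)\<bar> * \<bar>(k' i (x i) - 1) * v i\<bar> \<le> 1 * (1 * \<bar>v i\<bar>)"
      using ramp_bounds[of "R / S"] by (intro mult_mono) auto
    thus ?thesis by (simp add: abs_mult)
  qed
  have 2: "\<bar>ramp' (R / S) * (drad i (prefix i x) (dprefix i x v) / S - R * ds i x v / S\<^sup>2) * (k i (x i) - x i)\<bar>
    \<le> (5 / r x) * (N (dprefix i x v) / 100 + 2 * N v) * weight x i"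
  proof (cases "R / S < 2")
    case False
    hence "ramp' (R / S) = 0" by (simp add: ramp'_eq_0)
    thus ?thesis using r dN weight_nonneg[of x i] by (simp add: mult_nonneg_nonneg)
  next
    case RS: True
    have Rp: "R > 0" using active_bounds(2)[OF x True] r by (simp add: R_def)
    have "R < 2 * S" using RS S by (simp add: field_simps)
    hence "2/5 * r x \<le> S" using active_bounds(2)[OF x True] by (simp add: R_def)
    hence inv: "1 / S \<le> 5 / (2 * r x)" using r S by (simp add: field_simps)
    have "R * ds i x v / S\<^sup>2 = (R / S) * ds i x v * (1 / S)" using S by (simp add: power2_eq_square)
    hence "\<bar>R * ds i x v / S\<^sup>2\<bar> = \<bar>(R / S) * ds i x v\<bar> * (1 / S)" using S by (simp only: abs_mult) simp
    moreover have "\<bar>(R / S) * ds i x v\<bar> \<le> 2 * N v"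
      unfolding abs_mult using RS Rp S dS by (intro mult_mono) auto
    ultimately have a: "\<bar>R * ds i x v / S\<^sup>2\<bar> \<le> 2 * N v * (1 / S)"
      using S by (simp only:) (intro mult_right_mono, auto)
    have b: "\<bar>drad i (prefix i x) (dprefix i x v) / S\<bar> \<le> 1/100 * N (dprefix i x v) * (1 / S)"
      using mult_right_mono[OF drad, of "1 / S"] S by (simp add: abs_divide)
    have "\<bar>drad i (prefix i x) (dprefix i x v) / S - R * ds i x v / S\<^sup>2\<bar> \<le> (N (dprefix i x v) / 100 + 2 * N v) * (1 / S)"
      using a b unfolding distrib_right by linarith
    also have "\<dots> \<le> (N (dprefix i x v) / 100 + 2 * N v) * (5 / (2 * r x))"
      using inv dN by (intro mult_left_mono) auto
    finally have "\<bar>ramp' (R / S)\<bar> * \<bar>drad i (prefix i x) (dprefix i x v) / S - R * ds i x v / S\<^sup>2\<bar> * \<bar>k i (x i) - x i\<bar>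
      \<le> 2 * ((N (dprefix i x v) / 100 + 2 * N v) * (5 / (2 * r x))) * weight x i"
      using ramp'_bounds[of "R / S"] kd dN r by (intro mult_mono) (auto intro!: mult_nonneg_nonneg)
    also have "2 * ((N (dprefix i x v) / 100 + 2 * N v) * (5 / (2 * r x))) = (5 / r x) * (N (dprefix i x v) / 100 + 2 * N v)"
      using r by (simp add: field_simps)
    finally show ?thesis by (simp only: abs_mult)
  qed
  have "D\<Phi> x v i - v i = ramp (R / S) * ((k' i (x i) - 1) * v i) +
    ramp' (R / S) * (drad i (prefix i x) (dprefix i x v) / S - R * ds i x v / S\<^sup>2) * (k i (x i) - x i)"
    by (simp add: D\<Phi>_def R_def S_def)
  thus ?thesis using 1 2 by linarith
qed

text \<open>The factor \<open>5 / r x\<close> against the weight norm \<open>3 * r x\<close> gives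
  15, so the size of the derivative does not deteriorate as \<open>r x\<close> tends to 0. This is
  what makes the perturbation small in the derivative too.\<close>

lemma D\<Phi>_bound: assumes x: "x \<in> V" and v: "v \<in> V"
  shows "D\<Phi> x v \<in> V" "N (D\<Phi> x v - v) \<le> 40 * N v"
proof -
  have nv: "0 \<le> N v" using v by (rule norm_nonneg)
  have perturbation_concrete: "D\<Phi> x v - v \<in> V \<and> N (D\<Phi> x v - v) \<le> 40 * N v"
  proof (cases "r x > 0")
    case False
    hence "r x = 0" using r_nonneg[OF x] by simp
    hence "\<not> active x i" for i using active_bounds(3)[OF x, of i] s_pos[OF x, of i] by auto
    hence "D\<Phi> x v - v = 0" using not_active(2)[OF x] by (auto simp: fun_eq_iff)
    thus ?thesis using nv by simp
  next
    case r: True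
    have dzV: "dprefix n x v \<in> V" for n using bdd_lin_map_mem[OF strict_deriv_map_linV[OF prefix_strict_deriv[OF x]] v] .
    have wV: "weight x \<in> V" and wN: "N (weight x) \<le> 3 * r x" using weight_bound[OF x] by auto
    have av: "(\<lambda>i. \<bar>v i\<bar>) \<in> V \<and> N (\<lambda>i. \<bar>v i\<bar>) \<le> N v" by (rule solid[OF v]) auto
    have comb: "u \<in> V \<and> N u \<le> N v + 15 * B"
      if B: "B \<ge> 0" and u: "\<And>i. \<bar>u i\<bar> \<le> \<bar>v i\<bar> + (5 / r x) * B * weight x i" for u B
    proof -
      have sV: "scl ((5 / r x) * B) (weight x) \<in> V" using wV by (rule scl_mem)
      have "N (scl ((5 / r x) * B) (weight x)) = (5 / r x) * B * N (weight x)"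
        using norm_scl[OF wV, of "(5 / r x) * B"] B r by simp
      also have "\<dots> \<le> (5 / r x) * B * (3 * r x)" using wN B r by (intro mult_left_mono) auto
      also have "\<dots> = 15 * B" using r by simp
      finally have n: "N (scl ((5 / r x) * B) (weight x)) \<le> 15 * B" .
      have "u \<in> V \<and> N u \<le> N ((\<lambda>i. \<bar>v i\<bar>) + scl ((5 / r x) * B) (weight x))"
      proof (rule solid)
        show "(\<lambda>i. \<bar>v i\<bar>) + scl ((5 / r x) * B) (weight x) \<in> V" using av sV by (simp add: add_mem)
        fix i show "\<bar>u i\<bar> \<le> \<bar>((\<lambda>i. \<bar>v i\<bar>) + scl ((5 / r x) * B) (weight x)) i\<bar>"
          using u[of i] by simp
      qed
      moreover have "N ((\<lambda>i. \<bar>v i\<bar>) + scl ((5 / r x) * B) (weight x)) \<le> N v + 15 * B"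
        using norm_add[of "\<lambda>i. \<bar>v i\<bar>" "scl ((5 / r x) * B) (weight x)"] av sV n by simp
      ultimately show ?thesis by auto
    qed
    \<comment> \<open>With \<open>t = N (dprefix n x v)\<close> the estimate reads
      \<open>t \<le> 32 * N v + 15/100 * t\<close>, since \<open>rad\<close> is 1/100-Lipschitz; it
      can be solved for \<open>t\<close> with a bound independent of \<open>n\<close>.\<close>
    have dn: "N (dprefix n x v) \<le> 40 * N v" for n
    proof -
      define B where "B = N (dprefix n x v) / 100 + 2 * N v"
      have B: "B \<ge> 0" using norm_nonneg[OF dzV, of n] nv by (simp add: B_def)
      have "\<bar>(dprefix n x v - head n v) i\<bar> \<le> \<bar>v i\<bar> + (5 / r x) * B * weight x i" for i
      proof (cases "i < n")
        case True
        have "dprefix i x v = head i (dprefix n x v)" using True by (auto simp: dprefix_eq head_def)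
        hence "N (dprefix i x v) \<le> N (dprefix n x v)" using norm_head[OF dzV, of i n] by simp
        hence "(5 / r x) * (N (dprefix i x v) / 100 + 2 * N v) * weight x i \<le> (5 / r x) * B * weight x i"
          using r weight_nonneg[of x i] unfolding B_def by (intro mult_right_mono mult_left_mono) auto
        thus ?thesis using D\<Phi>_coord[OF x v r, of i] True by (simp add: dprefix_eq head_def)
      next
        case False
        have "0 \<le> (5 / r x) * B * weight x i" using r B weight_nonneg[of x i] by simp
        thus ?thesis using False by (simp add: dprefix_eq head_def)
      qed
      from comb[of B "dprefix n x v - head n v", OF B this] have "N (dprefix n x v - head n v) \<le> N v + 15 * B" by simp
      moreover have "N (dprefix n x v) \<le> N (dprefix n x v - head n v) + N (head n v)"
        using norm_add[of "dprefix n x v - head n v" "head n v"] dzV v by (simp add: diff_mem head_mem)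
      ultimately have "N (dprefix n x v) \<le> N v + 15 * B + N v" using norm_head[OF v, of n] by linarith
      thus ?thesis using nv unfolding B_def by simp
    qed
    \<comment> \<open>Here \<open>12/5 = 40/100 + 2\<close>, by the bound just obtained.\<close>
    have "\<bar>(D\<Phi> x v - v) i\<bar> \<le> \<bar>v i\<bar> + (5 / r x) * (12/5 * N v) * weight x i" for i
    proof -
      have "(5 / r x) * (N (dprefix i x v) / 100 + 2 * N v) * weight x i \<le> (5 / r x) * (12/5 * N v) * weight x i"
        using r weight_nonneg[of x i] dn[of i] by (intro mult_right_mono mult_left_mono) auto
      thus ?thesis using D\<Phi>_coord[OF x v r, of i] by simp
    qed
    from comb[of "12/5 * N v" "D\<Phi> x v - v", OF _ this] nv show ?thesis by simp
  qed
  moreover have "D\<Phi> x v = (D\<Phi> x v - v) + v" by simp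
  ultimately show "D\<Phi> x v \<in> V" "N (D\<Phi> x v - v) \<le> 40 * N v"
    using v add_mem by (metis, blast)
qed

text \<open>Where \<open>r\<close> is positive it beats both \<open>(1/2)^n\<close> and the tail
  norm for large \<open>n\<close>, on a whole ball: in units of \<open>\<tau>\<close>,
  \<open>s n y\<close> is at most 6 and the radius at least 90. The common index \<open>M\<close>
  for all \<open>y\<close> in the ball is what differentiability needs.\<close>

lemma eventually_full:
  assumes x: "x \<in> V" and r: "r x > 0"
  shows "\<exists>M. \<exists>\<rho>>0. \<forall>y\<in>V. N (y - x) < \<rho> \<longrightarrow> (\<forall>n\<ge>M. 2 \<le> rad n (prefix n y) / s n y \<and> active y n)"
proof -
  define \<tau> where "\<tau> = r x / 100"
  have \<tau>: "\<tau> > 0" using r by (simp add: \<tau>_def)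
  obtain m1 where m1: "N (tail m1 x) < \<tau>" using tail_small[OF x \<tau>] by blast
  obtain m2 where m2: "(1/2::real) ^ m2 < \<tau>" using real_arch_pow_inv[of \<tau> "1/2"] \<tau> by auto
  have "2 \<le> rad n (prefix n y) / s n y \<and> active y n"
    if y: "y \<in> V" "N (y - x) < \<tau>" and n: "n \<ge> max m1 m2" for y n
  proof -
    have "(1/2::real) ^ n \<le> (1/2) ^ m2" using n by (intro power_decreasing) auto
    hence a: "(1/2::real) ^ n < \<tau>" using m2 by linarith
    have "tail n y = tail n x + tail n (y - x)" by (auto simp: tail_def fun_eq_iff)
    hence "N (tail n y) \<le> N (tail n x) + N (tail n (y - x))"
      using norm_add[of "tail n x" "tail n (y - x)"] x y by (simp add: tail_mem diff_mem)
    also have "\<dots> \<le> N (tail m1 x) + N (y - x)"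
      using n x y by (intro add_mono norm_tail_mono norm_tail diff_mem) auto
    finally have b: "N (tail n y) < 2 * \<tau>" using m1 y by linarith
    have c: "r y \<ge> 99 * \<tau>" using r_lip[OF y(1) x] y(2) \<tau> unfolding \<tau>_def by linarith
    have "rad n (prefix n y) \<ge> 97/100 * r y - (1/2)^n / 8 - 1/100 * N (tail n y)"
      using rad_close[OF y(1), of n] by linarith
    hence d: "rad n (prefix n y) \<ge> 90 * \<tau>" using a b c \<tau> by linarith
    have e: "s n y \<le> 6 * \<tau>" using s_le[OF y(1), of n] a b by linarith
    have "2 * s n y \<le> rad n (prefix n y)" using d e \<tau> by linarith
    thus ?thesis using s_pos[OF y(1), of n] by (simp add: active_def field_simps)
  qed
  thus ?thesis using \<tau> by blast
qed

lemma full: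
  assumes "2 \<le> rad n (prefix n y) / s n y"
  shows "\<Phi> y n = k n (y n)" "D\<Phi> y v n = k' n (y n) * v n"
  using assms by (simp_all add: \<Phi>_def D\<Phi>_def ramp_eq_1 ramp'_eq_0 algebra_simps)

text \<open>On a ball \<open>\<Phi>\<close> is a finite head, differentiated by the recursion, plus
  a tail on which it acts coordinatewise through \<open>k\<close>.\<close>

lemma \<Phi>_strict_deriv: assumes x: "x \<in> V" and r: "r x > 0" shows "strict_deriv_map \<Phi> (D\<Phi> x) x"
proof -
  obtain M \<rho> where M: "\<rho> > 0" "\<And>y n. y \<in> V \<Longrightarrow> N (y - x) < \<rho> \<Longrightarrow> n \<ge> M \<Longrightarrow> 2 \<le> rad n (prefix n y) / s n y \<and> active y n"
    using eventually_full[OF x r] by blast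
  have x0: "N (x - x) < \<rho>" using M by simp
  have t: "strict_deriv_map (\<lambda>y. tail M (\<Phi> y)) (\<lambda>v. tail M (\<lambda>i. k' i (x i) * v i)) x"
  proof (rule strict_deriv_map_tail[where k = k])
    show "\<bar>k n a - k n b - k' n t * (a - b)\<bar> \<le> 2 * max \<bar>a - t\<bar> \<bar>b - t\<bar> * \<bar>a - b\<bar>" for n a b t
      using quad_derivD[OF k_qd] .
    show "\<bar>k' i (x i)\<bar> \<le> 1" if "M \<le> i" for i
    proof -
      have "\<bar>x i\<bar> \<le> 1/4" using active_coord[OF x] M(2)[OF x x0 that] by blast
      thus ?thesis using k'_nonneg[of "x i" i] k'_le[of "x i" i] by linarith
    qed
  qed (use M full(1) \<Phi>_disp x in auto)
  have "strict_deriv_map (\<lambda>y. prefix M y + tail M (\<Phi> y)) (\<lambda>v. dprefix M x v + tail M (\<lambda>i. k' i (x i) * v i)) x"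
    by (rule strict_deriv_map_add[OF prefix_strict_deriv[OF x] t])
  moreover have "prefix M y + tail M (\<Phi> y) = \<Phi> y" for y by (simp add: prefix_eq head_add_tail)
  moreover have "dprefix M x v + tail M (\<lambda>i. k' i (x i) * v i) = D\<Phi> x v" for v
    using full(2) M(2)[OF x x0] by (auto simp: dprefix_eq head_def tail_def fun_eq_iff)
  ultimately show ?thesis by (simp only:)
qed

lemma D\<Phi>_bdd_lin: assumes x: "x \<in> V" and r: "r x > 0" shows "bdd_lin_map (D\<Phi> x)"
  using strict_deriv_map_linV[OF \<Phi>_strict_deriv[OF assms]] .

text \<open>Induction along the recursion: as long as the earlier components of the derivative
  vanish, \<open>drad\<close> receives 0, and only \<open>v n\<close> and \<open>ds n x v\<close>
  can contribute to component \<open>n\<close>.\<close>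

lemma D\<Phi>_eq_0:
  assumes x: "x \<in> V" and full: "\<And>n. n \<ge> M \<Longrightarrow> D\<Phi> x v n = 0"
    and v: "\<And>n. n < M \<Longrightarrow> v n = 0" and ds: "\<And>n. n < M \<Longrightarrow> ds n x v = 0"
  shows "D\<Phi> x v = 0"
proof -
  have l: "drad n (prefix n x) 0 = 0" for n using bdd_lin_zero[OF strict_deriv_bdd_lin[OF rad_strict_deriv[OF prefix_mem]]] .
  have "D\<Phi> x v n = 0" if "n < M" for n
    using that
  proof (induction n rule: less_induct)
    case (less n)
    have "dprefix n x v = 0" unfolding dprefix_eq by (rule ext) (use less in \<open>simp add: head_def\<close>)
    thus ?case using v[OF less.prems] ds[OF less.prems] by (simp only: D\<Phi>_def l) simp
  qed
  hence "D\<Phi> x v n = 0" for n using full[of n] by (cases "n < M") auto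
  thus ?thesis by (intro ext) simp
qed

end

section \<open>Bending into eventually positive sequences\<close>

context damping
begin

lemma \<Phi>_id: assumes x: "x \<in> V" and r: "r x = 0" shows "\<Phi> x = x" "D\<Phi> x v = v"
proof -
  have "\<not> active x i" for i using active_bounds(3)[OF x, of i] s_pos[OF x, of i] r by auto
  thus "\<Phi> x = x" "D\<Phi> x v = v" using not_active[OF x] by auto
qed

text \<open>The equation \<open>D\<Phi> x u = unit_seq m\<close> is triangular: its \<open>n\<close>-th component involves only the
  coordinates \<open>u i\<close> with \<open>i \<ge> n\<close>, so it is solved from \<open>n = M - 1\<close> downwards.\<close>

lemma D\<Phi>_solve:
  assumes x: "x \<in> V" and full': "\<And>n. n \<ge> M \<Longrightarrow> 2 \<le> rad n (prefix n x) / s n x"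
    and pos: "\<And>n. 0 < 1 + ramp (rad n (prefix n x) / s n x) * (k' n (x n) - 1) -
      ramp' (rad n (prefix n x) / s n x) * (rad n (prefix n x) / (s n x)\<^sup>2) * ds n x (unit_seq n) * (k n (x n) - x n)"
    and m: "m \<ge> M" "k' m (x m) \<noteq> 0"
  shows "\<exists>u\<in>V. D\<Phi> x u = unit_seq m"
proof -
  define A where "A n = 1 + ramp (rad n (prefix n x) / s n x) * (k' n (x n) - 1)" for n
  define B where "B n = ramp' (rad n (prefix n x) / s n x) * (rad n (prefix n x) / (s n x)\<^sup>2) * (k n (x n) - x n)" for n
  \<comment> \<open>\<open>E u n\<close> is component \<open>n\<close> of \<open>D\<Phi> x u\<close>
    without the \<open>drad\<close> term; that term vanishes once all earlier components are
    0.\<close>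
  define E where "E u n = A n * u n - B n * ds n x u" for u n
  have ld: "bdd_lin (ds n x)" for n using strict_deriv_bdd_lin[OF s_strict_deriv[OF x]] .
  have bpos: "A n - B n * ds n x (unit_seq n) > 0" for n using pos[of n] by (simp add: A_def B_def mult_ac)
  have "\<exists>u\<in>V. (\<forall>n\<ge>M. u n = unit_seq m n / k' m (x m)) \<and> (\<forall>n<M. M - d \<le> n \<longrightarrow> E u n = 0)" for d
  proof (induction d)
    case 0
    show ?case by (intro bexI[of _ "scl (1 / k' m (x m)) (unit_seq m)"]) (auto simp: scl_mem)
  next
    case (Suc d)
    then obtain u where u: "u \<in> V" "\<forall>n\<ge>M. u n = unit_seq m n / k' m (x m)" "\<forall>n<M. M - d \<le> n \<longrightarrow> E u n = 0" by blast
    show ?case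
    proof (cases "Suc d \<le> M")
      case False
      hence "M - Suc d = M - d" by simp
      thus ?thesis using u by (intro bexI[of _ u]) auto
    next
      case True
      define n where "n = M - Suc d"
      have n: "n < M" "M - d = Suc n" using True by (auto simp: n_def)
      \<comment> \<open>Adding \<open>a\<close> times the \<open>n\<close>-th unit vector changes
        \<open>E u n\<close> by \<open>a\<close> times the positive diagonal coefficient. Equations
        with larger index are unaffected, because \<open>ds i x\<close> ignores coordinates below
        \<open>i\<close>.\<close>
      define a where "a = - E u n / (A n - B n * ds n x (unit_seq n))"
      define u' where "u' = u + scl a (unit_seq n)"
      have u'V: "u' \<in> V" using u by (simp add: u'_def add_mem scl_mem)
      have dsu': "ds i x u' = ds i x u + a * ds i x (unit_seq n)" for i
        using bdd_lin_add[OF ld u(1) scl_mem[OF unit_seq_mem]] bdd_lin_scl[OF ld unit_seq_mem] by (simp add: u'_def)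
      have "E u' n = E u n + a * (A n - B n * ds n x (unit_seq n))"
        unfolding E_def dsu' by (simp add: u'_def unit_seq_def algebra_simps)
      also have "\<dots> = 0" using bpos[of n] by (simp add: a_def)
      finally have 1: "E u' n = 0" .
      have 2: "E u' i = E u i" if "i > n" for i
        using ds_head[OF x that] that unfolding E_def dsu' by (simp add: u'_def unit_seq_def)
      have 3: "u' i = u i" if "i \<ge> M" for i using that n by (simp add: u'_def unit_seq_def)
      have "E u' i = 0" if "i < M" "M - Suc d \<le> i" for i
      proof (cases "i = n")
        case False
        hence "i > n" using that by (simp add: n_def)
        thus ?thesis using 2 u(3) n that by simp
      qed (use 1 in simp)
      thus ?thesis using u'V u(2) 3 by (intro bexI[of _ u']) auto
    qed
  qed
  from this[of M] obtain u where u: "u \<in> V" "\<forall>n\<ge>M. u n = unit_seq m n / k' m (x m)" "\<forall>n<M. E u n = 0" by auto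
  have "D\<Phi> x u n = 0" if "n < M" for n
    using that
  proof (induction n rule: less_induct)
    case (less n)
    have dz0: "dprefix n x u = 0" unfolding dprefix_eq by (rule ext) (use less in \<open>simp add: head_def\<close>)
    have l: "drad n (prefix n x) 0 = 0" using bdd_lin_zero[OF strict_deriv_bdd_lin[OF rad_strict_deriv[OF prefix_mem]]] .
    have "D\<Phi> x u n = E u n" unfolding D\<Phi>_def dz0 l E_def A_def B_def by (simp add: algebra_simps)
    thus ?case using u(3) less.prems by simp
  qed
  moreover have "D\<Phi> x u n = unit_seq m n" if "n \<ge> M" for n
    using full(2)[OF full'[OF that], of u] u(2) m that by (auto simp: unit_seq_def)
  ultimately have "D\<Phi> x u n = unit_seq m n" for n using m by (cases "n < M") (auto simp: unit_seq_def)
  thus ?thesis using u(1) by blast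
qed

end

text \<open>\<open>c n\<close> is the height added at 0 by the bend. It must be summably small, and
  so small that \<open>s n\<close> is nearly stationary in direction \<open>n\<close> while the
  coordinate is at most \<open>2 * c n\<close>.\<close>

locale bending = seq_space +
  fixes r :: "(nat \<Rightarrow> real) \<Rightarrow> real"
    and rad :: "nat \<Rightarrow> (nat \<Rightarrow> real) \<Rightarrow> real"
    and drad :: "nat \<Rightarrow> (nat \<Rightarrow> real) \<Rightarrow> (nat \<Rightarrow> real) \<Rightarrow> real"
    and c :: "nat \<Rightarrow> real"
  assumes r_nonneg: "x \<in> V \<Longrightarrow> 0 \<le> r x" and r_le: "x \<in> V \<Longrightarrow> r x \<le> 1/16"
    and r_lip: "x \<in> V \<Longrightarrow> y \<in> V \<Longrightarrow> \<bar>r x - r y\<bar> \<le> 1/100 * N (x - y)"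
    and rad_strict_deriv: "x \<in> V \<Longrightarrow> strict_deriv (rad n) (drad n x) x"
    and rad_lip: "x \<in> V \<Longrightarrow> y \<in> V \<Longrightarrow> \<bar>rad n x - rad n y\<bar> \<le> 1/100 * N (x - y)"
    and rad_near: "x \<in> V \<Longrightarrow> \<bar>rad n x - r (head n x)\<bar> \<le> (1/2) ^ n / 8"
    and c_pos: "0 < c n" and c_le: "c n \<le> (1/2) ^ (n + 2)"
    and c_small: "x \<in> V \<Longrightarrow> \<bar>x n\<bar> \<le> 2 * c n \<Longrightarrow> \<bar>ds n x (unit_seq n)\<bar> \<le> (1/2) ^ n / 16"
begin

lemma c_le_quarter: "c n \<le> 1/4"
proof -
  have "(1/2::real) ^ n \<le> 1" by (simp add: power_le_one)
  thus ?thesis using c_le[of n] by simp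
qed

lemma c_sum: "c \<in> V" "N (tail n c) \<le> (1/2) ^ n"
proof -
  have t: "tail n c \<in> V \<and> N (tail n c) \<le> (1/2) ^ n" for n
  proof -
    define b :: "nat \<Rightarrow> real" where "b i = (if i < n then 0 else (1/2) ^ (i - n) * (1/2) ^ (n + 2))" for i
    have "(\<lambda>i. (1/2::real) ^ i * (1/2) ^ (n + 2)) sums (2 * (1/2) ^ (n + 2))"
      using sums_mult2[OF geometric_sums[of "1/2 :: real"], of "(1/2) ^ (n + 2)"] by simp
    hence "(\<lambda>i. b (i + n)) sums (2 * (1/2) ^ (n + 2))" by (simp add: b_def)
    hence bs: "b sums (2 * (1/2) ^ (n + 2))" by (subst (asm) sums_zero_iff_shift) (auto simp: b_def)
    have le: "\<bar>tail n c i\<bar> \<le> b i" for i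
    proof (cases "i < n")
      case False
      hence "(1/2::real) ^ (i - n) * (1/2) ^ (n + 2) = (1/2) ^ (i + 2)" by (simp add: power_add[symmetric])
      thus ?thesis using False c_le[of i] c_pos[of i] by (simp add: tail_def b_def)
    qed (simp add: tail_def b_def)
    have sm: "summable (\<lambda>i. \<bar>tail n c i\<bar>)"
      by (rule summable_comparison_test[of _ b]) (use le bs in \<open>auto simp: sums_iff\<close>)
    have "(\<Sum>i. \<bar>tail n c i\<bar>) \<le> suminf b" using le sm bs by (intro suminf_le) (auto simp: sums_iff)
    also have "\<dots> = (1/2) * (1/2) ^ n" using bs by (simp add: sums_iff)
    also have "\<dots> \<le> 1 * (1/2) ^ n" by (intro mult_right_mono) auto
    finally show ?thesis using summable_mem[OF sm] by simp
  qed
  show "N (tail n c) \<le> (1/2) ^ n" using t by blast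
  have "tail 0 c = c" by (auto simp: tail_def)
  thus "c \<in> V" using t[of 0] by simp
qed

text \<open>Positive on \<open>[-1/4, 1/4]\<close>, with slope between \<open>c n\<close> and 1:
  negative inputs are squeezed to about \<open>c n\<close>, positive ones to about their square. The
  positive slope keeps far unit vectors in the range of the derivative.\<close>

definition bend :: "nat \<Rightarrow> real \<Rightarrow> real" where "bend n t = pos2 t + (c n * t + c n)"
definition bend' :: "nat \<Rightarrow> real \<Rightarrow> real" where "bend' n t = 2 * max 0 t + c n"

text \<open>The last three sign facts say that the displacement points against the sign of
  \<open>t\<close>, except possibly on the short interval from 0 to \<open>2 * c n\<close>.\<close>

lemma bend_disp: assumes t: "\<bar>t\<bar> \<le> 1/4"
  shows "\<bar>bend n t - t\<bar> \<le> \<bar>t\<bar> + c n" "t \<ge> 0 \<Longrightarrow> bend n t - t \<le> c n" "t \<le> 0 \<Longrightarrow> 0 \<le> bend n t - t"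
    "0 < bend n t" "t \<ge> 0 \<Longrightarrow> t > 2 * c n \<Longrightarrow> bend n t - t \<le> 0"
proof -
  have c: "0 < c n" "c n \<le> 1/4" using c_pos c_le_quarter by auto
  have 1: "bend n t - t = c n - t * (1 - t - c n)" if "t \<ge> 0"
    using that by (simp add: bend_def pos2_def power2_eq_square algebra_simps)
  have ct: "c n * \<bar>t\<bar> \<le> c n * 1" using t c by (intro mult_left_mono) auto
  have 2: "bend n t - t = c n - c n * \<bar>t\<bar> + \<bar>t\<bar>" if "t \<le> 0"
    using that by (simp add: bend_def pos2_def algebra_simps)
  have 3: "t * (1 - t - c n) \<ge> t * (1/2)" "t * (1 - t - c n) \<le> t * 1" if "t \<ge> 0"
    using that t c by (intro mult_left_mono; simp)+
  have "0 \<le> c n * \<bar>t\<bar>" using c by simp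
  thus "\<bar>bend n t - t\<bar> \<le> \<bar>t\<bar> + c n"
    using 1 2 3 ct c by (cases "t \<ge> 0") (simp_all add: abs_le_iff)
  show "t \<ge> 0 \<Longrightarrow> bend n t - t \<le> c n" using 1 3 by simp
  show "t \<le> 0 \<Longrightarrow> 0 \<le> bend n t - t" using 2 ct by simp
  show "t \<ge> 0 \<Longrightarrow> t > 2 * c n \<Longrightarrow> bend n t - t \<le> 0" using 1 3 by simp
  have "c n * (1 + t) > 0" using c t by (intro mult_pos_pos) auto
  moreover have "0 \<le> pos2 t" by (simp add: pos2_def)
  ultimately show "0 < bend n t" by (simp add: bend_def algebra_simps)
qed

sublocale h: damping V N s ds r rad drad bend bend' c
proof unfold_locales
  show "quad_deriv 2 (bend n) (bend' n)" for n
    using quad_deriv_add[OF quad_deriv_pos2 quad_deriv_affine[of 0 "c n" "c n"]] by (simp add: bend_def[abs_def] bend'_def[abs_def])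
  show "\<bar>t\<bar> \<le> 1/4 \<Longrightarrow> 0 \<le> bend' n t" "\<bar>t\<bar> \<le> 1/4 \<Longrightarrow> bend' n t \<le> 1" for n t
    using c_pos[of n] c_le_quarter[of n] by (auto simp: bend'_def)
qed (use r_nonneg r_le r_lip rad_strict_deriv rad_lip rad_near bend_disp c_pos c_sum in \<open>auto intro: less_imp_le\<close>)

sublocale P: damping V N s ds r rad drad "\<lambda>_ _. 0" "\<lambda>_ _. 0" "0"
proof unfold_locales
  show "quad_deriv 2 (\<lambda>_. 0) (\<lambda>_. 0)" by (simp add: quad_deriv_def)
  show "N (tail n 0) \<le> (1/2) ^ n" for n
  proof -
    have "tail n 0 = 0" by (auto simp: tail_def)
    thus ?thesis by simp
  qed
qed (use r_nonneg r_le r_lip rad_strict_deriv rad_lip rad_near in auto)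

text \<open>This is the diagonal coefficient required by \<open>h.D\<Phi>_solve\<close>. Its first
  part interpolates between 1 and \<open>bend'\<close>, hence is at least \<open>c n\<close>. The
  other part helps whenever the displacement opposes \<open>x n\<close>, by \<open>ds_sign\<close>;
  in the exceptional interval \<open>c_small\<close> keeps it below
  \<open>3/4 * c n\<close>.\<close>

lemma h_pos:
  assumes x: "x \<in> V"
  shows "0 < 1 + ramp (rad n (h.prefix n x) / s n x) * (bend' n (x n) - 1) -
      ramp' (rad n (h.prefix n x) / s n x) * (rad n (h.prefix n x) / (s n x)\<^sup>2) * ds n x (unit_seq n) * (bend n (x n) - x n)"
proof -
  define R S t w w' where "R = rad n (h.prefix n x)" and "S = s n x" and "t = x n" and "w = ramp (R / S)" and "w' = ramp' (R / S)"
  have S: "S > 0" using s_pos[OF x] by (simp add: S_def)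
  have c: "0 < c n" "c n \<le> 1/4" using c_pos c_le_quarter by auto
  have w: "0 \<le> w" "w \<le> 1" "0 \<le> w'" "w' \<le> 2" using ramp_bounds ramp'_bounds by (auto simp: w_def w'_def)
  have "c n \<le> 1 + w * (bend' n t - 1)"
  proof -
    have "w * (c n - 1) \<ge> 1 * (c n - 1)" using w c by (intro mult_right_mono_neg) auto
    moreover have "w * (bend' n t - 1) \<ge> w * (c n - 1)" using w by (intro mult_left_mono) (auto simp: bend'_def)
    ultimately show ?thesis by simp
  qed
  moreover have "w' * (R / S\<^sup>2) * ds n x (unit_seq n) * (bend n t - t) < c n"
  proof (cases "1 < R / S \<and> R / S < 2")
    case False
    hence "w' = 0" unfolding w'_def by (intro ramp'_eq_0) auto
    thus ?thesis using c by simp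
  next
    case True
    have act: "h.active x n" using True S by (simp add: h.active_def R_def S_def)
    have t: "\<bar>t\<bar> \<le> 1/4" using h.active_coord[OF x act] by (simp add: t_def)
    have "R / S\<^sup>2 = (R / S) * (1 / S)" by (simp add: power2_eq_square)
    moreover have "1 / S \<le> 2 ^ n"
      using s_ge[OF x, of n] S by (simp add: S_def field_simps power_divide)
    ultimately have RS: "0 \<le> R / S\<^sup>2" "R / S\<^sup>2 \<le> 2 * 2 ^ n"
      using True S mult_mono[of "R / S" 2 "1 / S" "2 ^ n"] by auto
    have p: "0 \<le> w' * (R / S\<^sup>2)" using w(3) RS(1) by (rule mult_nonneg_nonneg)
    have sg: "0 \<le> t * ds n x (unit_seq n)" using ds_sign[OF x, of n] by (simp add: t_def)
    consider "t < 0" | "t > 2 * c n" | "0 \<le> t" "t \<le> 2 * c n" by linarith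
    thus ?thesis
    proof cases
      case 1
      hence "ds n x (unit_seq n) \<le> 0" using sg by (simp add: zero_le_mult_iff)
      hence "ds n x (unit_seq n) * (bend n t - t) \<le> 0" using bend_disp(3)[OF t, of n] 1 by (intro mult_nonpos_nonneg) auto
      hence "w' * (R / S\<^sup>2) * (ds n x (unit_seq n) * (bend n t - t)) \<le> 0" using p by (rule mult_nonneg_nonpos[rotated])
      thus ?thesis using c by (simp add: mult.assoc)
    next
      case 2
      hence "ds n x (unit_seq n) \<ge> 0" using sg c by (simp add: zero_le_mult_iff)
      hence "ds n x (unit_seq n) * (bend n t - t) \<le> 0" using bend_disp(5)[OF t, of n] 2 c by (intro mult_nonneg_nonpos) auto
      hence "w' * (R / S\<^sup>2) * (ds n x (unit_seq n) * (bend n t - t)) \<le> 0" using p by (rule mult_nonneg_nonpos[rotated])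
      thus ?thesis using c by (simp add: mult.assoc)
    next
      case 3
      have d: "\<bar>ds n x (unit_seq n)\<bar> \<le> (1/2) ^ n / 16" using c_small[OF x, of n] 3 by (simp add: t_def)
      show ?thesis
      proof (cases "bend n t - t \<le> 0 \<and> 0 \<le> ds n x (unit_seq n)")
        case True
        hence "ds n x (unit_seq n) * (bend n t - t) \<le> 0" by (intro mult_nonneg_nonpos) auto
        hence "w' * (R / S\<^sup>2) * (ds n x (unit_seq n) * (bend n t - t)) \<le> 0" using p by (rule mult_nonneg_nonpos[rotated])
        thus ?thesis using c by (simp add: mult.assoc)
      next
        case False
        \<comment> \<open>The bounds 2 for \<open>ramp'\<close>, \<open>2 * 2^n\<close> for
          \<open>R / S^2\<close>, \<open>(1/2)^n / 16\<close> for \<open>ds\<close> and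
          \<open>3 * c n\<close> for the displacement multiply to \<open>3/4 * c n\<close>.\<close>
        have "\<bar>bend n t - t\<bar> \<le> 3 * c n" using bend_disp(1)[OF t, of n] 3 by simp
        hence "\<bar>w' * (R / S\<^sup>2) * ds n x (unit_seq n) * (bend n t - t)\<bar> \<le> (2 * (2 * 2 ^ n)) * ((1/2) ^ n / 16) * (3 * c n)"
          using w RS d unfolding abs_mult by (intro mult_mono) (auto intro!: mult_nonneg_nonneg)
        also have "\<dots> = (2 * (1/2)) ^ n * (3/4) * c n" unfolding power_mult_distrib by simp
        also have "\<dots> < c n" using c by simp
        finally show ?thesis by linarith
      qed
    qed
  qed
  ultimately show ?thesis by (simp add: w_def w'_def R_def S_def t_def)
qed

text \<open>Bending comes first, so that truncation acts at a point with eventually positive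
  coordinates.\<close>

definition trunc :: "(nat \<Rightarrow> real) \<Rightarrow> nat \<Rightarrow> real" where "trunc x = P.\<Phi> (h.\<Phi> x)"
definition dtrunc :: "(nat \<Rightarrow> real) \<Rightarrow> (nat \<Rightarrow> real) \<Rightarrow> nat \<Rightarrow> real" where
  "dtrunc x v = P.D\<Phi> (h.\<Phi> x) (h.D\<Phi> x v)"

lemma h_mem: "x \<in> V \<Longrightarrow> h.\<Phi> x \<in> V" by (rule h.\<Phi>_disp)
lemma M_mem: "x \<in> V \<Longrightarrow> trunc x \<in> V" unfolding trunc_def by (intro P.\<Phi>_disp h_mem)

lemma r_h: assumes x: "x \<in> V" shows "r (h.\<Phi> x) \<le> 2 * r x" "r x / 2 \<le> r (h.\<Phi> x)"
  using r_lip[OF h_mem[OF x] x] h.\<Phi>_disp(2)[OF x] r_nonneg[OF x] by linarith+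

lemma M_disp: assumes x: "x \<in> V" shows "N (trunc x - x) \<le> 10 * r x" "N (h.\<Phi> x - x) \<le> 10 * r x"
proof -
  have "N (trunc x - x) \<le> N (trunc x - h.\<Phi> x) + N (h.\<Phi> x - x)"
    using x by (intro norm_diff_triangle M_mem h_mem)
  moreover have "N (trunc x - h.\<Phi> x) \<le> 3 * r (h.\<Phi> x)"
    unfolding trunc_def using P.\<Phi>_disp(2)[OF h_mem[OF x]] .
  ultimately show "N (trunc x - x) \<le> 10 * r x" "N (h.\<Phi> x - x) \<le> 10 * r x"
    using h.\<Phi>_disp(2)[OF x] r_h[OF x] r_nonneg[OF x] by linarith+
qed

lemma dtrunc_bound: assumes x: "x \<in> V" and v: "v \<in> V"
  shows "h.D\<Phi> x v \<in> V" "dtrunc x v \<in> V" "N (h.D\<Phi> x v - v) \<le> 40 * N v" "N (dtrunc x v - v) \<le> 1700 * N v" "N (dtrunc x v) \<le> 1701 * N v"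
proof -
  have nv: "0 \<le> N v" using v by (rule norm_nonneg)
  have m1: "h.D\<Phi> x v \<in> V" and b1: "N (h.D\<Phi> x v - v) \<le> 40 * N v" using h.D\<Phi>_bound[OF x v] by auto
  have m2: "dtrunc x v \<in> V" and b2: "N (dtrunc x v - h.D\<Phi> x v) \<le> 40 * N (h.D\<Phi> x v)"
    unfolding dtrunc_def using P.D\<Phi>_bound[OF h_mem[OF x] m1] by auto
  have "N (h.D\<Phi> x v) \<le> N (h.D\<Phi> x v - v) + N v"
    using norm_add[of "h.D\<Phi> x v - v" v] m1 v by (simp add: diff_mem)
  moreover have "N (dtrunc x v - v) \<le> N (dtrunc x v - h.D\<Phi> x v) + N (h.D\<Phi> x v - v)"
    using m1 m2 v by (intro norm_diff_triangle)
  ultimately have b3: "N (dtrunc x v - v) \<le> 1700 * N v" using b1 b2 nv by linarith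
  moreover have "N (dtrunc x v) \<le> N (dtrunc x v - v) + N v"
    using norm_add[of "dtrunc x v - v" v] m2 v by (simp add: diff_mem)
  ultimately show "h.D\<Phi> x v \<in> V" "dtrunc x v \<in> V" "N (h.D\<Phi> x v - v) \<le> 40 * N v" "N (dtrunc x v - v) \<le> 1700 * N v" "N (dtrunc x v) \<le> 1701 * N v"
    using m1 m2 b1 by auto
qed

text \<open>An index \<open>i\<close> is active only if \<open>(1/2)^i\<close> is at most twice the
  radius function at the current point, and bending at most doubles that function. A small
  \<open>r x\<close> therefore protects the first \<open>n\<close> coordinates from both
  maps.\<close>

lemma dtrunc_tail: assumes x: "x \<in> V" and n: "4 * r x < (1/2) ^ n"
  shows "tail n (h.D\<Phi> x v - v) = h.D\<Phi> x v - v" "tail n (dtrunc x v - v) = dtrunc x v - v"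
proof -
  have p: "(1/2) ^ n \<le> (1/2::real) ^ i" if "i < n" for i using that by (intro power_decreasing) auto
  have h: "h.D\<Phi> x v i = v i" if "i < n" for i
  proof (rule h.not_active(2)[OF x])
    show "\<not> h.active x i" using h.active_bounds(4)[OF x, of i] p[OF that] n r_nonneg[OF x] by auto
  qed
  have "dtrunc x v i = h.D\<Phi> x v i" if "i < n" for i
    unfolding dtrunc_def
  proof (rule P.not_active(2)[OF h_mem[OF x]])
    show "\<not> P.active (h.\<Phi> x) i"
      using P.active_bounds(4)[OF h_mem[OF x], of i] p[OF that] n r_h(1)[OF x] by auto
  qed
  thus "tail n (h.D\<Phi> x v - v) = h.D\<Phi> x v - v" "tail n (dtrunc x v - v) = dtrunc x v - v"
    using h by (auto simp: tail_def fun_eq_iff not_le)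
qed

lemma M_strict_deriv: assumes x: "x \<in> V" and r: "r x > 0"
  shows "strict_deriv_map h.\<Phi> (h.D\<Phi> x) x" "strict_deriv_map trunc (dtrunc x) x"
proof -
  show h: "strict_deriv_map h.\<Phi> (h.D\<Phi> x) x" by (rule h.\<Phi>_strict_deriv[OF assms])
  have "r (h.\<Phi> x) > 0" using r_h(2)[OF x] r by linarith
  from strict_deriv_map_compose[OF h P.\<Phi>_strict_deriv[OF h_mem[OF x] this] x]
  show "strict_deriv_map trunc (dtrunc x) x" by (simp add: trunc_def[abs_def] dtrunc_def[abs_def])
qed

lemma M_id: assumes x: "x \<in> V" and r: "r x = 0"
  shows "h.\<Phi> x = x" "trunc x = x" "h.D\<Phi> x v = v" "dtrunc x v = v"
  using h.\<Phi>_id[OF x r] P.\<Phi>_id[OF x r] by (simp_all add: trunc_def dtrunc_def)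

text \<open>Beyond the truncation index the vectors \<open>dtrunc x u\<close> with \<open>h.D\<Phi> x u = unit_seq m\<close> are positive
  multiples of one another, since the coordinates of \<open>h.\<Phi> x\<close> are positive there.\<close>

lemma M_tail_structure:
  assumes x: "x \<in> V" and r: "r x > 0"
  shows "\<exists>M a w. w \<in> V \<and> (\<forall>m\<ge>M. a m > 0 \<and> (\<exists>u\<in>V. h.D\<Phi> x u = unit_seq m \<and> dtrunc x u = scl (a m) w))"
proof -
  define y where "y = h.\<Phi> x"
  have y: "y \<in> V" using h_mem[OF x] by (simp add: y_def)
  have ry: "r y > 0" using r_h(2)[OF x] r by (simp add: y_def)
  obtain M1 \<rho>1 where M1: "\<rho>1 > 0" "\<And>z. z \<in> V \<Longrightarrow> N (z - x) < \<rho>1 \<Longrightarrow> \<forall>n\<ge>M1. 2 \<le> rad n (h.prefix n z) / s n z \<and> h.active z n"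
    using h.eventually_full[OF x r] by blast
  obtain M2 \<rho>2 where M2: "\<rho>2 > 0" "\<And>z. z \<in> V \<Longrightarrow> N (z - y) < \<rho>2 \<Longrightarrow> \<forall>n\<ge>M2. 2 \<le> rad n (P.prefix n z) / s n z \<and> P.active z n"
    using P.eventually_full[OF y ry] by blast
  have f1: "2 \<le> rad n (h.prefix n x) / s n x" "h.active x n" if "n \<ge> M1" for n
    using M1(2)[OF x] M1(1) that by auto
  have f2: "2 \<le> rad n (P.prefix n y) / s n y" if "n \<ge> M2" for n
    using M2(2)[OF y] M2(1) that by auto
  have ypos: "y m > 0" if "m \<ge> M1" for m
    using h.full(1)[OF f1(1)[OF that]] bend_disp(4)[OF h.active_coord[OF x f1(2)[OF that]]] by (simp add: y_def)
  obtain a where a: "\<And>m. m \<ge> M1 \<Longrightarrow> a m > 0"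
    "\<And>n. \<exists>M'. \<forall>m\<ge>M'. \<forall>m'\<ge>M'. a m' * ds n y (unit_seq m) = a m * ds n y (unit_seq m')"
    using ds_proportional[OF y ypos] by blast
  then obtain M' where M': "\<And>n m m'. m \<ge> M' n \<Longrightarrow> m' \<ge> M' n \<Longrightarrow> a m' * ds n y (unit_seq m) = a m * ds n y (unit_seq m')"
    by metis
  \<comment> \<open>Only the finitely many tail functions \<open>s n\<close> with
    \<open>n < M2\<close> matter: beyond \<open>M2\<close> truncation is complete.\<close>
  define M where "M = Max (insert M1 (insert M2 (M' ` {..<M2})))"
  have Mge: "M \<ge> M1" "M \<ge> M2" "\<And>n. n < M2 \<Longrightarrow> M \<ge> M' n" 
    unfolding M_def by (intro Max_ge; simp)+
  have lP: "bdd_lin_map (P.D\<Phi> y)" by (rule P.D\<Phi>_bdd_lin[OF y ry])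
  define w where "w = scl (1 / a M) (P.D\<Phi> y (unit_seq M))"
  have wV: "w \<in> V" unfolding w_def by (intro scl_mem bdd_lin_map_mem[OF lP] unit_seq_mem)
  have "\<exists>u\<in>V. h.D\<Phi> x u = unit_seq m \<and> dtrunc x u = scl (a m) w" if m: "m \<ge> M" for m
  proof -
    have am: "a m > 0" "a M > 0" using a(1) m Mge by auto
    \<comment> \<open>The combination of two far unit vectors on which all \<open>ds n y\<close>
      with \<open>n < M2\<close> vanish, so that \<open>P.D\<Phi>_eq_0\<close> applies.\<close>
    define v where "v = scl (a M) (unit_seq m) - scl (a m) (unit_seq M)"
    have dsv: "ds n y v = 0" if "n < M2" for n
    proof -
      have ld: "bdd_lin (ds n y)" using strict_deriv_bdd_lin[OF s_strict_deriv[OF y]] .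
      have "ds n y v = a M * ds n y (unit_seq m) - a m * ds n y (unit_seq M)"
        using bdd_lin_diff[OF ld scl_mem[OF unit_seq_mem] scl_mem[OF unit_seq_mem]] bdd_lin_scl[OF ld unit_seq_mem] by (simp add: v_def)
      thus ?thesis using M'[of n m M] Mge(3)[OF that] m by simp
    qed
    have "P.D\<Phi> y v = 0"
    proof (rule P.D\<Phi>_eq_0[OF y, of M2])
      show "P.D\<Phi> y v n = 0" if "n \<ge> M2" for n using P.full(2)[OF f2[OF that]] by simp
      show "v n = 0" if "n < M2" for n using that m Mge by (simp add: v_def unit_seq_def)
    qed (rule dsv)
    hence "scl (a M) (P.D\<Phi> y (unit_seq m)) = scl (a m) (P.D\<Phi> y (unit_seq M))"
      using bdd_lin_map_diff[OF lP scl_mem[OF unit_seq_mem] scl_mem[OF unit_seq_mem]] bdd_lin_map_scl[OF lP unit_seq_mem] by (simp add: v_def)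
    hence "a M * P.D\<Phi> y (unit_seq m) i = a m * P.D\<Phi> y (unit_seq M) i" for i by (metis scl_apply)
    hence *: "P.D\<Phi> y (unit_seq m) = scl (a m) w" using am by (auto simp: w_def fun_eq_iff field_simps)
    have "\<exists>u\<in>V. h.D\<Phi> x u = unit_seq m"
    proof (rule h.D\<Phi>_solve[OF x, of M1])
      show "bend' m (x m) \<noteq> 0" using c_pos[of m] by (simp add: bend'_def)
    qed (use f1 h_pos[OF x] m Mge in auto)
    then obtain u where u: "u \<in> V" "h.D\<Phi> x u = unit_seq m" by blast
    hence "dtrunc x u = scl (a m) w" using * by (simp add: dtrunc_def y_def)
    thus ?thesis using u by blast
  qed
  thus ?thesis using wV a(1) Mge(1) by (intro exI[of _ M] exI[of _ a] exI[of _ w]) auto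
qed

end

section \<open>The perturbation theorem\<close>

text \<open>Run periodically through the finitely many signed axes.\<close>

lemma axis_sequence:
  "\<exists>u :: nat \<Rightarrow> real ^ 'd. (\<forall>m. norm (u m) \<le> 1) \<and>
     (\<forall>i \<sigma> M. \<sigma> \<in> {1, -1} \<longrightarrow> (\<exists>m\<ge>M. u m = \<sigma> *\<^sub>R axis i 1))"
proof -
  let ?T = "UNIV :: ('d \<times> bool) set"
  obtain e where e: "bij_betw e {0..<card ?T} ?T" using ex_bij_betw_nat_finite[of ?T] by auto
  define n where "n = card ?T"
  have n: "n > 0" by (simp add: n_def card_gt_0_iff)
  define u :: "nat \<Rightarrow> real ^ 'd" where
    "u m = (if snd (e (m mod n)) then 1 else -1) *\<^sub>R axis (fst (e (m mod n))) 1" for m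
  have "norm (u m) \<le> 1" for m by (simp add: u_def norm_axis_1)
  moreover have "\<exists>m\<ge>M. u m = \<sigma> *\<^sub>R axis i 1" if "\<sigma> \<in> {1, -1}" for i \<sigma> M
  proof -
    obtain j where j: "j < n" "e j = (i, \<sigma> = 1)"
      using e unfolding bij_betw_def n_def by (metis UNIV_I atLeastLessThan_iff imageE)
    have "M * n + j \<ge> M * 1" using n by (intro trans_le_add1 mult_le_mono2) simp
    moreover have "(M * n + j) mod n = j" using j by simp
    ultimately show ?thesis using j that by (intro exI[of _ "M * n + j"]) (auto simp: u_def)
  qed
  ultimately show ?thesis by blast
qed

section \<open>Gauge, surjectivity criterion, tails and weights\<close>

context seq_lattice
begin

text \<open>A supremum of tents \<open>\<rho> x0 - N (x - x0)\<close> is 1-Lipschitz and can be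
  scaled down. Picking a centre whose tent reaches half of the supremum ties each \<open>x\<close>
  to one \<open>x0\<close> whose local data is valid at \<open>x\<close>; this is the origin of 50
  against 100.\<close>

lemma gauge:
  assumes U: "U \<subseteq> V" "U \<noteq> {}" and \<rho>': "\<forall>x\<in>U. 0 < \<rho> x \<and> \<rho> x \<le> 1"
  shows "\<exists>r. (\<forall>x\<in>V. 0 \<le> r x \<and> r x \<le> 1/16) \<and> (\<forall>x\<in>V. \<forall>y\<in>V. \<bar>r x - r y\<bar> \<le> 1/100 * N (x - y)) \<and>
    (\<forall>x\<in>U. r x > 0) \<and> (\<forall>x\<in>V. r x > 0 \<longrightarrow> (\<exists>x0\<in>U. N (x - x0) < \<rho> x0 \<and> r x \<le> \<rho> x0 / 50))"
proof -
  have \<rho>: "0 < \<rho> x \<and> \<rho> x \<le> 1" if "x \<in> U" for x using \<rho>' that by blast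
  define g where "g x x0 = max 0 (\<rho> x0 - N (x - x0))" for x x0
  define r where "r x = (1/100) * (SUP x0\<in>U. g x x0)" for x
  have g01: "0 \<le> g x x0" "g x x0 \<le> 1" if "x \<in> V" "x0 \<in> U" for x x0
    using that U \<rho>[of x0] norm_nonneg[of "x - x0"] by (auto simp: g_def diff_mem subsetD)
  have bdd: "bdd_above (g x ` U)" if "x \<in> V" for x using g01[OF that] by (intro bdd_aboveI[of _ 1]) auto
  have up: "g x x0 \<le> (SUP x0\<in>U. g x x0)" if "x \<in> V" "x0 \<in> U" for x x0
    using cSUP_upper[OF that(2) bdd[OF that(1)]] .
  have le: "(SUP x0\<in>U. g x x0) \<le> 1" if "x \<in> V" for x using U(2) g01[OF that] by (intro cSUP_least) auto
  have ge: "0 \<le> (SUP x0\<in>U. g x x0)" if "x \<in> V" for x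
    using U(2) g01(1)[OF that] up[OF that] by (meson all_not_in_conv order_trans)
  have lip: "(SUP x0\<in>U. g x x0) \<le> (SUP x0\<in>U. g y x0) + N (x - y)" if "x \<in> V" "y \<in> V" for x y
  proof (rule cSUP_least[OF U(2)])
    fix x0 assume x0: "x0 \<in> U"
    have "N (y - x0) \<le> N (y - x) + N (x - x0)" using that x0 U by (intro norm_diff_triangle) auto
    moreover have "0 \<le> N (x - y)" using that by (simp add: norm_nonneg diff_mem)
    ultimately have "g x x0 \<le> g y x0 + N (x - y)" using norm_minus_commute'[OF that] by (simp add: g_def)
    thus "g x x0 \<le> (SUP x0\<in>U. g y x0) + N (x - y)" using up[OF that(2) x0] by linarith
  qed
  have 1: "\<bar>r x - r y\<bar> \<le> 1/100 * N (x - y)" if "x \<in> V" "y \<in> V" for x y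
    using lip[OF that] lip[OF that(2,1)] norm_minus_commute'[OF that] unfolding r_def abs_le_iff by simp
  have 2: "r x > 0" if "x \<in> U" for x
  proof -
    have "x \<in> V" using that U by blast
    moreover have "g x x > 0" using \<rho>[OF that] by (simp add: g_def)
    ultimately show ?thesis using up[of x x] that by (simp add: r_def)
  qed
  have 3: "\<exists>x0\<in>U. N (x - x0) < \<rho> x0 \<and> r x \<le> \<rho> x0 / 50" if x: "x \<in> V" "r x > 0" for x
  proof -
    let ?S = "SUP x0\<in>U. g x x0"
    have S: "?S > 0" using x by (simp add: r_def)
    hence "?S / 2 < ?S" by simp
    then obtain x0 where x0: "x0 \<in> U" "?S / 2 < g x x0"
      using less_cSUP_iff[OF U(2) bdd[OF x(1)], of "?S / 2"] by blast
    have n: "0 \<le> N (x - x0)" using x x0 U by (auto intro!: norm_nonneg diff_mem)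
    have "g x x0 > 0" using x0 S by linarith
    hence "N (x - x0) < \<rho> x0" "g x x0 \<le> \<rho> x0" using n by (auto simp: g_def max_def split: if_splits)
    thus ?thesis using x0 by (intro bexI[of _ x0]) (auto simp: r_def)
  qed
  show ?thesis
  proof (intro exI[of _ r] conjI ballI impI)
    fix x assume x: "x \<in> V"
    show "0 \<le> r x" using ge[OF x] by (simp add: r_def)
    show "r x \<le> 1/16" using le[OF x] unfolding r_def by linarith
  qed (use 1 2 3 in auto)
qed

text \<open>In finite dimension a proper subspace is orthogonal to some nonzero vector.\<close>

lemma bdd_lin_surj:
  fixes L :: "(nat \<Rightarrow> real) \<Rightarrow> real ^ 'd"
  assumes "bdd_lin L" "\<And>\<xi>. \<xi> \<noteq> 0 \<Longrightarrow> \<exists>v\<in>V. \<xi> \<bullet> L v \<noteq> 0"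
  shows "L ` V = UNIV"
proof (rule ccontr)
  assume ne: "L ` V \<noteq> UNIV"
  have "subspace (L ` V)"
  proof (rule subspaceI)
    have "L 0 = 0" by (rule bdd_lin_zero[OF assms(1)])
    thus "0 \<in> L ` V" by (metis image_eqI zero_mem)
    fix a b assume "a \<in> L ` V" "b \<in> L ` V"
    then obtain x y where "x \<in> V" "y \<in> V" "a = L x" "b = L y" by blast
    thus "a + b \<in> L ` V" using bdd_lin_add[OF assms(1), of x y] add_mem[of x y] by (metis image_eqI)
  next
    fix t a assume "a \<in> L ` V"
    then obtain x where "x \<in> V" "a = L x" by blast
    thus "t *\<^sub>R a \<in> L ` V" using bdd_lin_scl[OF assms(1), of x t] scl_mem[of x t] by (metis image_eqI)
  qed
  hence "span (L ` V) = L ` V" by (simp only: span_eq_iff)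
  hence "span (L ` V) \<noteq> UNIV" using ne by metis
  then obtain a where "a \<noteq> 0" "span (L ` V) \<subseteq> {x. a \<bullet> x = 0}"
    using span_not_univ_subset_hyperplane by blast
  thus False using assms(2)[of a] span_superset[of "L ` V"] by blast
qed

end

context seq_space
begin

text \<open>The axiom \<open>dual\<close>, that the unit vectors form a shrinking basis, is applied
  to each component. It is the reason why changes of far coordinates hardly change a derivative into
  a finite-dimensional space.\<close>

lemma dual_vec:
  fixes L :: "(nat \<Rightarrow> real) \<Rightarrow> real ^ 'd"
  assumes L: "bdd_lin L" and e: "e > 0"
  shows "\<exists>n0. \<forall>n\<ge>n0. \<forall>v\<in>V. norm (L (tail n v)) \<le> e * N v"
proof -
  define e' where "e' = e / CARD('d)"
  have e': "e' > 0" using e by (simp add: e'_def)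
  have "bdd_lin (\<lambda>v. L v $ i)" for i
  proof -
    obtain K where K: "\<forall>u\<in>V. norm (L u) \<le> K * N u" using L unfolding bdd_lin_def by blast
    have "norm (L u $ i) \<le> K * N u" if "u \<in> V" for u
      using component_le_norm_cart[of "L u" i] K that by force
    hence "\<exists>K. \<forall>u\<in>V. norm (L u $ i) \<le> K * N u" by blast
    thus ?thesis using L unfolding bdd_lin_def by simp
  qed
  hence "\<forall>i. \<exists>n. \<forall>v\<in>V. \<bar>L (tail n v) $ i\<bar> \<le> e' * N v" using dual[of "\<lambda>v. L v $ _" e'] e' by blast
  then obtain n where n: "\<And>i v. v \<in> V \<Longrightarrow> \<bar>L (tail (n i) v) $ i\<bar> \<le> e' * N v" by metis
  define n0 where "n0 = Max (range n)"
  have "norm (L (tail m v)) \<le> e * N v" if m: "m \<ge> n0" and v: "v \<in> V" for m v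
  proof -
    have "\<bar>L (tail m v) $ i\<bar> \<le> e' * N v" for i
    proof -
      have "n i \<le> m" using m Max_ge[of "range n" "n i"] by (simp add: n0_def)
      hence "tail m v = tail (n i) (tail m v)" by (auto simp: tail_def)
      hence "\<bar>L (tail m v) $ i\<bar> \<le> e' * N (tail m v)" using n[OF tail_mem[OF v, of m], of i] by simp
      also have "\<dots> \<le> e' * N v" using e' norm_tail[OF v] by (intro mult_left_mono) auto
      finally show ?thesis .
    qed
    hence "(\<Sum>i\<in>UNIV. \<bar>L (tail m v) $ i\<bar>) \<le> (\<Sum>i\<in>(UNIV :: 'd set). e' * N v)" by (intro sum_mono) auto
    also have "\<dots> = e * N v" by (simp add: e'_def)
    finally show ?thesis using norm_le_l1_cart[of "L (tail m v)"] by linarith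
  qed
  thus ?thesis by blast
qed

lemma bdd_lin_weighted_sum:
  fixes u :: "nat \<Rightarrow> real ^ 'd"
  assumes u: "\<And>m. norm (u m) \<le> 1"
  shows "bdd_lin (\<lambda>v. \<Sum>n. ((1/2) ^ n * v n) *\<^sub>R u n)" "(\<Sum>n. ((1/2) ^ n * unit_seq m n) *\<^sub>R u n) = (1/2) ^ m *\<^sub>R u m"
proof -
  have le: "norm (((1/2) ^ n * v n) *\<^sub>R u n) \<le> (1/2) ^ n * N v" if "v \<in> V" for v n
  proof -
    have "norm (((1/2) ^ n * v n) *\<^sub>R u n) = (1/2) ^ n * (\<bar>v n\<bar> * norm (u n))" by (simp add: abs_mult)
    also have "\<dots> \<le> (1/2) ^ n * (N v * 1)"
      using coord_le[OF that, of n] u[of n] norm_nonneg[OF that] by (intro mult_left_mono mult_mono) auto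
    finally show ?thesis by simp
  qed
  have gs: "(\<lambda>n. (1/2::real) ^ n * b) sums (2 * b)" for b
    using sums_mult2[OF geometric_sums[of "1/2 :: real"], of b] by simp
  have sn: "summable (\<lambda>n. norm (((1/2) ^ n * v n) *\<^sub>R u n))" if "v \<in> V" for v
    by (rule summable_comparison_test[OF _ sums_summable[OF gs[of "N v"]]]) (use le[OF that] in auto)
  have sm: "summable (\<lambda>n. ((1/2) ^ n * v n) *\<^sub>R u n)" if "v \<in> V" for v
    using sn[OF that] by (rule summable_norm_cancel)
  have b: "norm (\<Sum>n. ((1/2) ^ n * v n) *\<^sub>R u n) \<le> 2 * N v" if "v \<in> V" for v
  proof -
    have "norm (\<Sum>n. ((1/2) ^ n * v n) *\<^sub>R u n) \<le> (\<Sum>n. norm (((1/2) ^ n * v n) *\<^sub>R u n))"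
      by (rule summable_norm[OF sn[OF that]])
    also have "\<dots> \<le> (\<Sum>n. (1/2) ^ n * N v)"
      by (rule suminf_le[OF _ sn[OF that] sums_summable[OF gs]]) (use le[OF that] in blast)
    also have "\<dots> = 2 * N v" using gs[of "N v"] by (simp add: sums_iff)
    finally show ?thesis .
  qed
  show "bdd_lin (\<lambda>v. \<Sum>n. ((1/2) ^ n * v n) *\<^sub>R u n)"
    unfolding bdd_lin_def
  proof (intro conjI ballI allI)
    fix v w :: "nat \<Rightarrow> real" assume vw: "v \<in> V" "w \<in> V"
    show "(\<Sum>n. ((1/2) ^ n * (v + w) n) *\<^sub>R u n) = (\<Sum>n. ((1/2) ^ n * v n) *\<^sub>R u n) + (\<Sum>n. ((1/2) ^ n * w n) *\<^sub>R u n)"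
      using suminf_add[OF sm[OF vw(1)] sm[OF vw(2)]] by (simp add: algebra_simps)
  next
    fix t :: real and v :: "nat \<Rightarrow> real" assume v: "v \<in> V"
    show "(\<Sum>n. ((1/2) ^ n * scl t v n) *\<^sub>R u n) = t *\<^sub>R (\<Sum>n. ((1/2) ^ n * v n) *\<^sub>R u n)"
      using suminf_scaleR_right[OF sm[OF v], of t] by (simp add: algebra_simps)
  qed (use b in blast)
  have "(\<lambda>n. ((1/2) ^ n * unit_seq m n) *\<^sub>R u n) sums (\<Sum>n\<in>{m}. ((1/2) ^ n * unit_seq m n) *\<^sub>R u n)"
    by (rule sums_finite) (auto simp: unit_seq_def)
  thus "(\<Sum>n. ((1/2) ^ n * unit_seq m n) *\<^sub>R u n) = (1/2) ^ m *\<^sub>R u m" by (simp add: sums_iff unit_seq_def)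
qed

lemma c_exists: "\<exists>c. (\<forall>n. 0 < c n \<and> c n \<le> (1/2) ^ (n + 2)) \<and>
   (\<forall>n. \<forall>x\<in>V. \<bar>x n\<bar> \<le> 2 * c n \<longrightarrow> \<bar>ds n x (unit_seq n)\<bar> \<le> (1/2) ^ n / 16)"
proof -
  have "\<forall>n. \<exists>c>0. \<forall>x\<in>V. \<bar>x n\<bar> \<le> c \<longrightarrow> \<bar>ds n x (unit_seq n)\<bar> \<le> (1/2) ^ n / 16"
    by (intro allI ds_small) simp
  then obtain c where c: "\<And>n. c n > 0" "\<And>n x. x \<in> V \<Longrightarrow> \<bar>x n\<bar> \<le> c n \<Longrightarrow> \<bar>ds n x (unit_seq n)\<bar> \<le> (1/2) ^ n / 16" by metis
  show ?thesis
    \<comment> \<open>Half of the threshold is taken because the condition allows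
      \<open>2 * c n\<close>.\<close>
    using c by (intro exI[of _ "\<lambda>n. min ((1/2) ^ (n + 2)) (c n / 2)"] conjI allI ballI impI) auto
qed

text \<open>The conclusion asks for a Frechet derivative and its continuity separately: at points
  outside \<open>U\<close> these follow directly from the decay of \<open>\<phi> - f\<close> and of
  the derivatives. Inside \<open>U\<close> both come from strict differentiability.\<close>

theorem perturbation:
  fixes f :: "(nat \<Rightarrow> real) \<Rightarrow> real ^ 'd" and \<epsilon> :: "(nat \<Rightarrow> real) \<Rightarrow> real"
  assumes f: "\<And>x. x \<in> V \<Longrightarrow> strict_deriv f (Df x) x"
    and \<epsilon>: "\<And>x. x \<in> V \<Longrightarrow> \<epsilon> x > 0" "\<And>x e. x \<in> V \<Longrightarrow> e > 0 \<Longrightarrow> \<exists>d>0. \<forall>y\<in>V. N (y - x) < d \<longrightarrow> \<bar>\<epsilon> y - \<epsilon> x\<bar> < e"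
    and U: "U \<subseteq> V" "\<And>x. x \<in> U \<Longrightarrow> \<exists>d>0. \<forall>y\<in>V. N (y - x) < d \<longrightarrow> y \<in> U"
    and surj: "\<And>x. x \<in> V - U \<Longrightarrow> Df x ` V = UNIV"
  shows "\<exists>\<phi> D\<phi>. (\<forall>x\<in>V. bdd_lin (D\<phi> x)) \<and>
    (\<forall>x\<in>V. \<forall>e>0. \<exists>d>0. \<forall>h\<in>V. N h < d \<longrightarrow> norm (\<phi> (x + h) - \<phi> x - D\<phi> x h) \<le> e * N h) \<and>
    (\<forall>x\<in>V. \<forall>e>0. \<exists>d>0. \<forall>y\<in>V. N (y - x) < d \<longrightarrow> (\<forall>v\<in>V. norm (D\<phi> y v - D\<phi> x v) \<le> e * N v)) \<and>
    (\<forall>x\<in>V. norm (f x - \<phi> x) \<le> \<epsilon> x) \<and> (\<forall>x\<in>V - U. f x = \<phi> x) \<and> (\<forall>x\<in>V. D\<phi> x ` V = UNIV) \<and>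
    (\<forall>x\<in>V. \<forall>v\<in>V. norm (Df x v - D\<phi> x v) \<le> \<epsilon> x * N v)"
proof (cases "U = {}")
  case True
  have fr: "\<exists>d>0. \<forall>h\<in>V. N h < d \<longrightarrow> norm (f (x + h) - f x - Df x h) \<le> e * N h" if x: "x \<in> V" and e: "e > 0" for x e
  proof -
    obtain d where d: "d > 0" "\<forall>y\<in>V. \<forall>z\<in>V. N (y - x) < d \<longrightarrow> N (z - x) < d \<longrightarrow>
     norm (f y - f z - Df x (y - z)) \<le> e * N (y - z)" using strict_derivD[OF f[OF x] e] by blast
    have "norm (f (x + h) - f x - Df x h) \<le> e * N h" if "h \<in> V" "N h < d" for h
      using d(2)[rule_format, of "x + h" x] that x d(1) by (simp add: add_mem)
    thus ?thesis using d(1) by blast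
  qed
  have ct: "\<exists>d>0. \<forall>y\<in>V. N (y - x) < d \<longrightarrow> (\<forall>v\<in>V. norm (Df y v - Df x v) \<le> e * N v)" if "x \<in> V" "e > 0" for x e
    using strict_deriv_deriv_continuous[where f = f and Df = Df, OF f that(1) that(2)] f that(1) by blast
  have "0 \<le> \<epsilon> x * N v" if "x \<in> V" "v \<in> V" for x v
    using \<epsilon>(1)[OF that(1)] norm_nonneg[OF that(2)] by simp
  thus ?thesis using fr ct surj True \<epsilon>(1) strict_deriv_bdd_lin[OF f]
    by (intro exI[of _ f] exI[of _ Df]) (auto intro: less_imp_le)
next
  case ne: False
  obtain u :: "nat \<Rightarrow> real ^ 'd" where u: "\<And>m. norm (u m) \<le> 1"
    "\<And>i \<sigma> M. \<sigma> \<in> {1, -1} \<Longrightarrow> \<exists>m\<ge>M. u m = \<sigma> *\<^sub>R axis i 1" using axis_sequence by blast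
  define \<Lambda> where "\<Lambda> v = (\<Sum>n. ((1/2) ^ n * v n) *\<^sub>R u n)" for v :: "nat \<Rightarrow> real"
  have l\<Lambda>: "bdd_lin \<Lambda>" and \<Lambda>u: "\<And>m. \<Lambda> (unit_seq m) = (1/2) ^ m *\<^sub>R u m"
    using bdd_lin_weighted_sum[OF u(1)] by (simp_all add: \<Lambda>_def[abs_def])
  obtain K\<Lambda> where K\<Lambda>: "K\<Lambda> > 0" "\<And>v. v \<in> V \<Longrightarrow> norm (\<Lambda> v) \<le> K\<Lambda> * N v" using bdd_lin_bound[OF l\<Lambda>] by blast
  define F where "F x = f x - \<Lambda> x" for x
  define DF where "DF x v = Df x v - \<Lambda> v" for x v
  have sF: "strict_deriv F (DF x) x" if "x \<in> V" for x
    using strict_deriv_diff[OF f[OF that] strict_deriv_of_bdd_lin[OF l\<Lambda>]] by (simp add: F_def[abs_def] DF_def[abs_def])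
  have lF: "bdd_lin (DF x)" if "x \<in> V" for x using strict_deriv_bdd_lin[OF sF[OF that]] .
  \<comment> \<open>Local data at a centre \<open>x0\<close>: \<open>e\<close> is the tolerance,
    below \<open>\<epsilon>\<close> and below the distance to the complement of \<open>U\<close> and
    its square; \<open>K\<close> and \<open>\<rho>\<close> control values; \<open>n0\<close> is an
    index past which the derivatives are tiny on tails. The ball of radius \<open>2 * \<rho>\<close>
    leaves room for points moved by \<open>trunc\<close>, and \<open>\<rho> \<le> (1/2)^n0\<close>
    forces all changes beyond \<open>n0\<close>.\<close>
  define G where "G x0 \<rho> e K n0 \<longleftrightarrow> 0 < \<rho> \<and> \<rho> \<le> (1::real) \<and> 0 < e \<and>
     (\<forall>y\<in>V. N (y - x0) < \<rho> \<longrightarrow> y \<in> U \<and> e \<le> \<epsilon> y \<and> (\<forall>b\<in>V - U. e \<le> N (y - b) \<and> e \<le> (N (y - b))\<^sup>2)) \<and>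
     (\<forall>y\<in>V. \<forall>z\<in>V. N (y - x0) < 2 * \<rho> \<longrightarrow> N (z - x0) < 2 * \<rho> \<longrightarrow> norm (F y - F z) \<le> K * N (y - z)) \<and>
     (K + K\<Lambda>) * \<rho> \<le> e \<and> 0 < K \<and>
     (\<forall>y\<in>V. N (y - x0) < 2 * \<rho> \<longrightarrow> (\<forall>v\<in>V. norm (DF y v - DF x0 v) \<le> e / 10000 * N v)) \<and>
     (\<forall>v\<in>V. norm (DF x0 (tail n0 v)) \<le> e / 10000 * N v \<and> norm (\<Lambda> (tail n0 v)) \<le> e / 10000 * N v) \<and>
     \<rho> \<le> (1/2) ^ n0" for x0 \<rho> e K n0
  have "\<exists>\<rho> e K n0. G x0 \<rho> e K n0" if x0: "x0 \<in> U" for x0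
  proof -
    have x0V: "x0 \<in> V" using x0 U by blast
    obtain d1 where d1: "d1 > 0" "\<And>y. y \<in> V \<Longrightarrow> N (y - x0) < d1 \<Longrightarrow> y \<in> U" using U(2)[OF x0] by blast
    obtain d2 where d2: "d2 > 0" "\<And>y. y \<in> V \<Longrightarrow> N (y - x0) < d2 \<Longrightarrow> \<bar>\<epsilon> y - \<epsilon> x0\<bar> < \<epsilon> x0 / 2"
      using \<epsilon>(2)[OF x0V, of "\<epsilon> x0 / 2"] \<epsilon>(1)[OF x0V] by auto
    define e where "e = min (\<epsilon> x0 / 2) (min (d1 / 2) ((d1 / 2)\<^sup>2))"
    have e: "e > 0" using d1 \<epsilon>(1)[OF x0V] by (simp add: e_def)
    obtain K d3 where K: "K > 0" "d3 > 0" "\<And>y z. y \<in> V \<Longrightarrow> z \<in> V \<Longrightarrow> N (y - x0) < d3 \<Longrightarrow> N (z - x0) < d3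
      \<Longrightarrow> norm (F y - F z) \<le> K * N (y - z)" using strict_deriv_Lipschitz[OF sF[OF x0V]] by blast
    obtain d4 where d4: "d4 > 0" "\<And>y v. y \<in> V \<Longrightarrow> N (y - x0) < d4 \<Longrightarrow> v \<in> V \<Longrightarrow> norm (DF y v - DF x0 v) \<le> e / 10000 * N v"
      using strict_deriv_deriv_continuous[where f = F and Df = DF and e = "e / 10000", OF sF[OF x0V] x0V] sF e by auto
    obtain n1 where n1: "\<forall>n\<ge>n1. \<forall>v\<in>V. norm (DF x0 (tail n v)) \<le> e / 10000 * N v"
      using dual_vec[OF lF[OF x0V], of "e / 10000"] e by auto
    obtain n2 where n2: "\<forall>n\<ge>n2. \<forall>v\<in>V. norm (\<Lambda> (tail n v)) \<le> e / 10000 * N v"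
      using dual_vec[OF l\<Lambda>, of "e / 10000"] e by auto
    define n0 where "n0 = max n1 n2"
    define \<rho> where "\<rho> = Min {1, d1 / 2, d2, d3 / 2, d4 / 2, e / (K + K\<Lambda>), (1/2) ^ n0}"
    have \<rho>: "\<rho> > 0" "\<rho> \<le> 1" "\<rho> \<le> d1 / 2" "\<rho> \<le> d2" "\<rho> \<le> d3 / 2" "\<rho> \<le> d4 / 2" "\<rho> \<le> e / (K + K\<Lambda>)" "\<rho> \<le> (1/2) ^ n0"
    proof -
      show "\<rho> > 0" unfolding \<rho>_def using d1(1) d2(1) K(1,2) d4(1) e K\<Lambda>(1)
        by (subst Min_gr_iff) (auto intro!: divide_pos_pos add_pos_pos)
    qed (unfold \<rho>_def, (rule Min_le; simp)+)
    have "G x0 \<rho> e K n0"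
      unfolding G_def
    proof (intro conjI ballI impI)
      fix y assume y: "y \<in> V" "N (y - x0) < \<rho>"
      show "y \<in> U" using d1 y \<rho> by auto
      show "e \<le> \<epsilon> y" using d2(2)[of y] y \<rho> unfolding e_def by linarith
      fix b assume b: "b \<in> V - U"
      have "d1 \<le> N (b - x0)" using d1(2)[of b] b by force
      also have "\<dots> \<le> N (b - y) + N (y - x0)" using b y x0V by (intro norm_diff_triangle) auto
      finally have db: "d1 / 2 \<le> N (y - b)" using y \<rho> b norm_minus_commute'[of b y] by auto
      thus "e \<le> N (y - b)" by (simp add: e_def)
      have "(d1 / 2)\<^sup>2 \<le> (N (y - b))\<^sup>2" using db d1 by (intro power_mono) auto
      thus "e \<le> (N (y - b))\<^sup>2" by (simp add: e_def)
    next
      show "(K + K\<Lambda>) * \<rho> \<le> e" using \<rho>(7) K K\<Lambda> by (simp add: field_simps)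
    qed (use \<rho> e K d4 n1 n2 in \<open>auto simp: n0_def\<close>)
    thus ?thesis by blast
  qed
  then obtain \<rho> e K n0 where G: "\<And>x0. x0 \<in> U \<Longrightarrow> G x0 (\<rho> x0) (e x0) (K x0) (n0 x0)" by metis
  have \<rho>01: "\<forall>x0\<in>U. 0 < \<rho> x0 \<and> \<rho> x0 \<le> 1" using G unfolding G_def by blast
  obtain r where r': "\<forall>x\<in>V. 0 \<le> r x \<and> r x \<le> 1/16" "\<forall>x\<in>V. \<forall>y\<in>V. \<bar>r x - r y\<bar> \<le> 1/100 * N (x - y)"
    "\<forall>x\<in>U. r x > 0" "\<forall>x\<in>V. r x > 0 \<longrightarrow> (\<exists>x0\<in>U. N (x - x0) < \<rho> x0 \<and> r x \<le> \<rho> x0 / 50)"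
    using gauge[where \<rho> = \<rho>, OF U(1) ne \<rho>01] by (elim exE conjE)
  have r: "\<And>x. x \<in> V \<Longrightarrow> 0 \<le> r x" "\<And>x. x \<in> V \<Longrightarrow> r x \<le> 1/16"
    "\<And>x y. x \<in> V \<Longrightarrow> y \<in> V \<Longrightarrow> \<bar>r x - r y\<bar> \<le> 1/100 * N (x - y)" "\<And>x. x \<in> U \<Longrightarrow> r x > 0"
    "\<And>x. x \<in> V \<Longrightarrow> r x > 0 \<Longrightarrow> \<exists>x0\<in>U. N (x - x0) < \<rho> x0 \<and> r x \<le> \<rho> x0 / 50"
    using r'(1) apply blast using r'(1) apply blast using r'(2) apply blast using r'(3) apply blast using r'(4) by blast
  define Q where "Q n g dg \<longleftrightarrow> (\<forall>x\<in>V. strict_deriv g (dg x) x) \<and> (\<forall>x\<in>V. \<forall>y\<in>V. \<bar>g x - g y\<bar> \<le> 1/100 * N (x - y)) \<and>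
    (\<forall>x\<in>V. \<bar>g x - r (head n x)\<bar> \<le> (1/2) ^ n / 8)" for n g dg
  have "\<exists>g dg. Q n g dg" for n
  proof -
    have "\<exists>g dg. (\<forall>x\<in>V. strict_deriv g (dg x) x) \<and> (\<forall>x\<in>V. \<forall>y\<in>V. \<bar>g x - g y\<bar> \<le> 1/100 * N (x - y)) \<and>
      (\<forall>x\<in>V. \<bar>g x - r (head n x)\<bar> \<le> (1/2) ^ n / 8) \<and> (\<forall>x\<in>V. g (head n x) = g x)"
      by (rule smoothing[OF r(3)]) auto
    thus ?thesis unfolding Q_def by (elim exE conjE) (intro exI conjI)
  qed
  then obtain rad drad where "\<And>n. Q n (rad n) (drad n)" by metis
  hence rad: "\<And>n x. x \<in> V \<Longrightarrow> strict_deriv (rad n) (drad n x) x"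
    "\<And>n x y. x \<in> V \<Longrightarrow> y \<in> V \<Longrightarrow> \<bar>rad n x - rad n y\<bar> \<le> 1/100 * N (x - y)"
    "\<And>n x. x \<in> V \<Longrightarrow> \<bar>rad n x - r (head n x)\<bar> \<le> (1/2) ^ n / 8" unfolding Q_def by simp_all
  obtain c where c: "\<And>n. 0 < c n" "\<And>n. c n \<le> (1/2) ^ (n + 2)"
    "\<And>n x. x \<in> V \<Longrightarrow> \<bar>x n\<bar> \<le> 2 * c n \<Longrightarrow> \<bar>ds n x (unit_seq n)\<bar> \<le> (1/2) ^ n / 16"
    using c_exists by blast
  interpret B: bending V N s ds r rad drad c
    by unfold_locales (use r rad c in auto)
  \<comment> \<open>\<open>\<Lambda>\<close> is composed with the bending only, not with the
    truncation, so its far directions survive.\<close>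
  define \<phi> where "\<phi> x = F (B.trunc x) + \<Lambda> (B.h.\<Phi> x)" for x
  define D\<phi> where "D\<phi> x v = DF (B.trunc x) (B.dtrunc x v) + \<Lambda> (B.h.D\<Phi> x v)" for x v
  have rU: "x \<in> U \<longleftrightarrow> r x > 0" if x: "x \<in> V" for x
  proof
    assume "r x > 0"
    then obtain x0 where "x0 \<in> U" "N (x - x0) < \<rho> x0" using r(5)[OF x] by blast
    thus "x \<in> U" using G[of x0] x unfolding G_def by blast
  qed (rule r(4))
  have out: "\<phi> x = f x" "D\<phi> x v = Df x v" if "x \<in> V" "x \<notin> U" for x v
  proof -
    have "r x = 0" using rU[OF that(1)] r(1)[OF that(1)] that(2) by auto
    thus "\<phi> x = f x" "D\<phi> x v = Df x v"
      using B.M_id[OF that(1)] by (simp_all add: \<phi>_def D\<phi>_def F_def DF_def)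
  qed
  have "\<exists>e>0. e \<le> \<epsilon> x \<and> (\<forall>b\<in>V - U. e \<le> N (x - b) \<and> e \<le> (N (x - b))\<^sup>2) \<and> norm (\<phi> x - f x) \<le> e \<and>
      (\<forall>v\<in>V. norm (D\<phi> x v - Df x v) \<le> e * N v)" if x: "x \<in> U" for x
  proof -
    have xV: "x \<in> V" using x U by blast
    obtain x0 where x0: "x0 \<in> U" "N (x - x0) < \<rho> x0" "r x \<le> \<rho> x0 / 50" using r(5)[OF xV r(4)[OF x]] by blast
    have x0V: "x0 \<in> V" using x0 U by blast
    note g = G[OF x0(1), unfolded G_def]
    define e0 where "e0 = e x0"
    have e0: "e0 > 0" using g by (simp add: e0_def)
    have M: "B.trunc x \<in> V" "B.h.\<Phi> x \<in> V" using B.M_mem B.h_mem xV by auto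
    have Mx: "N (B.trunc x - x) \<le> \<rho> x0 / 5" "N (B.h.\<Phi> x - x) \<le> \<rho> x0 / 5"
      using B.M_disp[OF xV] x0(3) by linarith+
    have "N (B.trunc x - x0) \<le> N (B.trunc x - x) + N (x - x0)" using M xV x0V by (intro norm_diff_triangle)
    hence near: "N (B.trunc x - x0) < 2 * \<rho> x0" "N (x - x0) < 2 * \<rho> x0" using Mx x0(2) g by linarith+
    have F: "norm (F (B.trunc x) - F x) \<le> K x0 * N (B.trunc x - x)" using g M(1) xV near by blast
    have "norm (\<phi> x - f x) = norm ((F (B.trunc x) - F x) + \<Lambda> (B.h.\<Phi> x - x))"
      by (simp add: \<phi>_def F_def bdd_lin_diff[OF l\<Lambda> M(2) xV] algebra_simps)
    also have "\<dots> \<le> K x0 * (\<rho> x0 / 5) + K\<Lambda> * (\<rho> x0 / 5)"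
    proof (rule norm_triangle_mono)
      show "norm (F (B.trunc x) - F x) \<le> K x0 * (\<rho> x0 / 5)"
        by (rule order_trans[OF F mult_left_mono[OF Mx(1)]]) (use g in simp)
      show "norm (\<Lambda> (B.h.\<Phi> x - x)) \<le> K\<Lambda> * (\<rho> x0 / 5)"
        by (rule order_trans[OF K\<Lambda>(2)[OF diff_mem[OF M(2) xV]] mult_left_mono[OF Mx(2)]]) (use K\<Lambda> in simp)
    qed
    also have "\<dots> = (K x0 + K\<Lambda>) * \<rho> x0 / 5" by (simp add: field_simps)
    also have "\<dots> \<le> e0" using g e0 by (auto simp: e0_def)
    finally have 1: "norm (\<phi> x - f x) \<le> e0" .
    \<comment> \<open>This is the hypothesis of \<open>dtrunc_tail\<close>: both maps fix the
      coordinates below \<open>n0 x0\<close>.\<close>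
    have r4: "4 * r x < (1/2) ^ n0 x0" using x0(3) g by linarith
    have 2: "norm (D\<phi> x v - Df x v) \<le> e0 * N v" if v: "v \<in> V" for v
    proof -
      have nv: "0 \<le> N v" using v by (rule norm_nonneg)
      define w1 w2 where "w1 = B.h.D\<Phi> x v - v" and "w2 = B.dtrunc x v - v"
      note bd = B.dtrunc_bound[OF xV v]
      have w: "w1 \<in> V" "w2 \<in> V" using bd v by (auto simp: w1_def w2_def intro!: diff_mem)
      have t: "tail (n0 x0) w1 = w1" "tail (n0 x0) w2 = w2"
        using B.dtrunc_tail[OF xV r4, of v] by (auto simp: w1_def w2_def)
      have D1: "norm (DF y v - DF x0 v) \<le> e0 / 10000 * N v" if "y \<in> V" "N (y - x0) < 2 * \<rho> x0" "v \<in> V" for y v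
        using g that unfolding e0_def by blast
      have D2: "norm (DF x0 (tail (n0 x0) v)) \<le> e0 / 10000 * N v" "norm (\<Lambda> (tail (n0 x0) v)) \<le> e0 / 10000 * N v" if "v \<in> V" for v
        using g that unfolding e0_def by blast+
      have sc: "e0 / 10000 * a \<le> e0 / 10000 * (b * N v)" if "a \<le> b * N v" for a b
        using e0 that by (intro mult_left_mono) auto
      \<comment> \<open>Every derivative of \<open>F\<close> is compared with the one at
        \<open>x0\<close>, where smallness on tails is known; the remaining terms act on
        \<open>w1\<close> and \<open>w2\<close>, which are tails.\<close>
      have eq: "D\<phi> x v - Df x v = (DF (B.trunc x) (B.dtrunc x v) - DF x0 (B.dtrunc x v)) - (DF x (B.dtrunc x v) - DF x0 (B.dtrunc x v))
          + (DF x w2 - DF x0 w2) + DF x0 w2 + \<Lambda> w1"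
      proof -
        have "DF x w2 = DF x (B.dtrunc x v) - DF x v" unfolding w2_def by (rule bdd_lin_diff[OF lF[OF xV] bd(2) v])
        moreover have "\<Lambda> w1 = \<Lambda> (B.h.D\<Phi> x v) - \<Lambda> v" unfolding w1_def by (rule bdd_lin_diff[OF l\<Lambda> bd(1) v])
        ultimately show ?thesis by (simp add: D\<phi>_def DF_def)
      qed
      have "norm (D\<phi> x v - Df x v) \<le> norm (DF (B.trunc x) (B.dtrunc x v) - DF x0 (B.dtrunc x v)) + norm (DF x (B.dtrunc x v) - DF x0 (B.dtrunc x v))
          + norm (DF x w2 - DF x0 w2) + norm (DF x0 w2) + norm (\<Lambda> w1)"
      proof -
        have n5: "norm (a - b + c + d + w) \<le> norm a + norm b + norm c + norm d + norm w" for a b c d w :: "real ^ 'd"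
          using norm_triangle_ineq[of "a - b + c + d" w] norm_triangle_ineq[of "a - b + c" d]
            norm_triangle_ineq[of "a - b" c] norm_triangle_ineq4[of a b] by linarith
        show ?thesis unfolding eq by (rule n5)
      qed
      \<comment> \<open>The five coefficients add up to 6842, below the denominator 10000.\<close>
      also have "\<dots> \<le> e0 / 10000 * (1701 * N v) + e0 / 10000 * (1701 * N v) + e0 / 10000 * (1700 * N v)
          + e0 / 10000 * (1700 * N v) + e0 / 10000 * (40 * N v)"
      proof (intro add_mono)
        show "norm (DF (B.trunc x) (B.dtrunc x v) - DF x0 (B.dtrunc x v)) \<le> e0 / 10000 * (1701 * N v)"
          using D1[OF M(1) near(1) bd(2)] sc[OF bd(5)] by linarith
        show "norm (DF x (B.dtrunc x v) - DF x0 (B.dtrunc x v)) \<le> e0 / 10000 * (1701 * N v)"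
          using D1[OF xV near(2) bd(2)] sc[OF bd(5)] by linarith
        show "norm (DF x w2 - DF x0 w2) \<le> e0 / 10000 * (1700 * N v)"
          using D1[OF xV near(2) w(2)] sc[OF bd(4)] by (simp add: w2_def)
        show "norm (DF x0 w2) \<le> e0 / 10000 * (1700 * N v)"
          using D2(1)[OF w(2)] t(2) sc[OF bd(4)] by (simp add: w2_def)
        show "norm (\<Lambda> w1) \<le> e0 / 10000 * (40 * N v)"
          using D2(2)[OF w(1)] t(1) sc[OF bd(3)] by (simp add: w1_def)
      qed
      also have "\<dots> \<le> e0 * N v" using e0 nv by (simp add: field_simps)
      finally show ?thesis .
    qed
    show ?thesis
    proof (intro exI[of _ e0] conjI)
      show "e0 \<le> \<epsilon> x" using g xV x0(2) unfolding e0_def by blast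
      show "\<forall>b\<in>V - U. e0 \<le> N (x - b) \<and> e0 \<le> (N (x - b))\<^sup>2" using g xV x0(2) unfolding e0_def by blast
    qed (use e0 1 2 in auto)
  qed
  hence "\<exists>e'. \<forall>x\<in>U. e' x > 0 \<and> e' x \<le> \<epsilon> x \<and> (\<forall>b\<in>V - U. e' x \<le> N (x - b) \<and> e' x \<le> (N (x - b))\<^sup>2) \<and>
      norm (\<phi> x - f x) \<le> e' x \<and> (\<forall>v\<in>V. norm (D\<phi> x v - Df x v) \<le> e' x * N v)"
    by (intro bchoice ballI)
  then obtain e' where E: "\<forall>x\<in>U. e' x > 0 \<and> e' x \<le> \<epsilon> x \<and> (\<forall>b\<in>V - U. e' x \<le> N (x - b) \<and> e' x \<le> (N (x - b))\<^sup>2) \<and>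
      norm (\<phi> x - f x) \<le> e' x \<and> (\<forall>v\<in>V. norm (D\<phi> x v - Df x v) \<le> e' x * N v)" ..
  have e': "\<And>x. x \<in> U \<Longrightarrow> e' x > 0" "\<And>x. x \<in> U \<Longrightarrow> e' x \<le> \<epsilon> x"
    "\<And>x b. x \<in> U \<Longrightarrow> b \<in> V - U \<Longrightarrow> e' x \<le> N (x - b)" "\<And>x b. x \<in> U \<Longrightarrow> b \<in> V - U \<Longrightarrow> e' x \<le> (N (x - b))\<^sup>2"
    "\<And>x. x \<in> U \<Longrightarrow> norm (\<phi> x - f x) \<le> e' x" "\<And>x v. x \<in> U \<Longrightarrow> v \<in> V \<Longrightarrow> norm (D\<phi> x v - Df x v) \<le> e' x * N v"
    using E by simp_all
  have s\<phi>: "strict_deriv \<phi> (D\<phi> x) x" if x: "x \<in> U" for x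
  proof -
    have xV: "x \<in> V" using x U by blast
    have "strict_deriv (\<lambda>x. F (B.trunc x) + \<Lambda> (B.h.\<Phi> x)) (\<lambda>v. DF (B.trunc x) (B.dtrunc x v) + \<Lambda> (B.h.D\<Phi> x v)) x"
      by (rule strict_deriv_add[OF strict_deriv_compose[OF B.M_strict_deriv(2)[OF xV r(4)[OF x]] sF[OF B.M_mem[OF xV]] xV]
        strict_deriv_compose[OF B.M_strict_deriv(1)[OF xV r(4)[OF x]] strict_deriv_of_bdd_lin[OF l\<Lambda>] xV]])
    thus ?thesis by (simp add: \<phi>_def[abs_def] D\<phi>_def[abs_def])
  qed
  have bdd_lin\<phi>: "bdd_lin (D\<phi> x)" if x: "x \<in> V" for x
  proof (cases "x \<in> U")
    case False
    thus ?thesis using bdd_lin_cong[OF strict_deriv_bdd_lin[OF f[OF x]]] out(2)[OF x False] by blast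
  qed (rule strict_deriv_bdd_lin[OF s\<phi>])
  have frechet: "\<exists>d>0. \<forall>h\<in>V. N h < d \<longrightarrow> norm (\<phi> (x + h) - \<phi> x - D\<phi> x h) \<le> a * N h"
    if x: "x \<in> V" and a: "a > 0" for x a
  proof (cases "x \<in> U")
    case True
    obtain d where d: "d > 0" "\<forall>y\<in>V. \<forall>z\<in>V. N (y - x) < d \<longrightarrow> N (z - x) < d \<longrightarrow>
      norm (\<phi> y - \<phi> z - D\<phi> x (y - z)) \<le> a * N (y - z)" using strict_derivD[OF s\<phi>[OF True] a] by blast
    have "norm (\<phi> (x + h) - \<phi> x - D\<phi> x h) \<le> a * N h" if "h \<in> V" "N h < d" for h
      using d(2)[rule_format, of "x + h" x] that x d(1) by (simp add: add_mem)
    thus ?thesis using d(1) by blast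
  next
    case False
    obtain d where d: "d > 0" "\<forall>y\<in>V. \<forall>z\<in>V. N (y - x) < d \<longrightarrow> N (z - x) < d \<longrightarrow>
      norm (f y - f z - Df x (y - z)) \<le> a/2 * N (y - z)" using strict_derivD[OF f[OF x], of "a/2"] a by auto
    have "norm (\<phi> (x + h) - \<phi> x - D\<phi> x h) \<le> a * N h" if h: "h \<in> V" "N h < min d (a/2)" for h
    proof -
      have hn: "0 \<le> N h" using h by (intro norm_nonneg)
      have xh: "x + h \<in> V" using x h by (simp add: add_mem)
      have 1: "norm (f (x + h) - f x - Df x h) \<le> a/2 * N h"
        using d(2)[rule_format, of "x + h" x] h x xh d(1) by simp
      \<comment> \<open>Here the quadratic bound enters: \<open>x\<close> lies outside
        \<open>U\<close>, so the deviation at \<open>x + h\<close> is at most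
        \<open>(N h)^2\<close>, which is negligible against \<open>N h\<close>.\<close>
      have 2: "norm (\<phi> (x + h) - f (x + h)) \<le> a/2 * N h"
      proof (cases "x + h \<in> U")
        case True
        have "norm (\<phi> (x + h) - f (x + h)) \<le> (N (x + h - x))\<^sup>2"
          using e'(5)[OF True] e'(4)[OF True, of x] x False by fastforce
        also have "\<dots> = N h * N h" by (simp add: power2_eq_square)
        also have "\<dots> \<le> a/2 * N h" using h hn by (intro mult_right_mono) auto
        finally show ?thesis .
      qed (use out(1)[OF xh] a hn in simp)
      have "\<phi> (x + h) - \<phi> x - D\<phi> x h = (\<phi> (x + h) - f (x + h)) + (f (x + h) - f x - Df x h)"
        using out[OF x False] by simp
      hence "norm (\<phi> (x + h) - \<phi> x - D\<phi> x h) \<le> norm (\<phi> (x + h) - f (x + h)) + norm (f (x + h) - f x - Df x h)"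
        by (metis norm_triangle_ineq)
      thus ?thesis using 1 2 by linarith
    qed
    thus ?thesis using d(1) a by (intro exI[of _ "min d (a/2)"]) auto
  qed
  have cont: "\<exists>d>0. \<forall>y\<in>V. N (y - x) < d \<longrightarrow> (\<forall>v\<in>V. norm (D\<phi> y v - D\<phi> x v) \<le> a * N v)"
    if x: "x \<in> V" and a: "a > 0" for x a
  proof (cases "x \<in> U")
    case True
    obtain d where d: "d > 0" "\<forall>y\<in>V. N (y - x) < d \<longrightarrow> strict_deriv \<phi> (D\<phi> y) y \<longrightarrow> (\<forall>v\<in>V. norm (D\<phi> y v - D\<phi> x v) \<le> a * N v)"
      using strict_deriv_deriv_continuous[where f = \<phi> and Df = D\<phi>, OF s\<phi>[OF True] x a] by blast
    obtain d' where d': "d' > 0" "\<forall>y\<in>V. N (y - x) < d' \<longrightarrow> y \<in> U" using U(2)[OF True] by blast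
    show ?thesis using d d' s\<phi> by (intro exI[of _ "min d d'"]) auto
  next
    case False
    obtain d where d: "d > 0" "\<forall>y\<in>V. N (y - x) < d \<longrightarrow> strict_deriv f (Df y) y \<longrightarrow> (\<forall>v\<in>V. norm (Df y v - Df x v) \<le> a/2 * N v)"
      using strict_deriv_deriv_continuous[where f = f and Df = Df and e = "a/2", OF f[OF x] x] a by auto
    have "norm (D\<phi> y v - D\<phi> x v) \<le> a * N v" if y: "y \<in> V" "N (y - x) < min d (a/2)" and v: "v \<in> V" for y v
    proof -
      have nv: "0 \<le> N v" using v by (rule norm_nonneg)
      have 1: "norm (Df y v - Df x v) \<le> a/2 * N v" using d y v f by auto
      \<comment> \<open>For the derivatives a linear bound suffices: the deviation at
        \<open>y\<close> is at most \<open>N (y - x) * N v\<close>.\<close>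
      have 2: "norm (D\<phi> y v - Df y v) \<le> a/2 * N v"
      proof (cases "y \<in> U")
        case True
        have "norm (D\<phi> y v - Df y v) \<le> e' y * N v" by (rule e'(6)[OF True v])
        also have "\<dots> \<le> a/2 * N v"
          using e'(3)[OF True, of x] x False y nv by (intro mult_right_mono) auto
        finally show ?thesis .
      qed (use out(2)[OF y(1)] a nv in simp)
      have "norm (D\<phi> y v - D\<phi> x v) = norm ((D\<phi> y v - Df y v) + (Df y v - Df x v))"
        using out(2)[OF x False] by simp
      thus ?thesis using norm_triangle_ineq[of "D\<phi> y v - Df y v" "Df y v - Df x v"] 1 2 by linarith
    qed
    thus ?thesis using d(1) a by (intro exI[of _ "min d (a/2)"]) auto
  qed
  have sur: "D\<phi> x ` V = UNIV" if x: "x \<in> V" for x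
  proof (cases "x \<in> U")
    case False
    hence "D\<phi> x ` V = Df x ` V" using out(2)[OF x False] by (intro image_cong) auto
    thus ?thesis using surj[of x] x False by simp
  next
    case True
    show ?thesis
    proof (rule bdd_lin_surj[OF bdd_lin\<phi>[OF x]], rule ccontr)
      fix \<xi> :: "real ^ 'd" assume \<xi>: "\<xi> \<noteq> 0" "\<not> (\<exists>v\<in>V. \<xi> \<bullet> D\<phi> x v \<noteq> 0)"
      obtain M a w where w: "w \<in> V" "\<And>m. m \<ge> M \<Longrightarrow> a m > 0"
        "\<And>m. m \<ge> M \<Longrightarrow> \<exists>v\<in>V. B.h.D\<Phi> x v = unit_seq m \<and> B.dtrunc x v = scl (a m) w"
        using B.M_tail_structure[OF x r(4)[OF True]] by blast
      define \<beta> where "\<beta> = \<xi> \<bullet> DF (B.trunc x) w"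
      have eq: "a m * \<beta> + (1/2) ^ m * (\<xi> \<bullet> u m) = 0" if m: "m \<ge> M" for m
      proof -
        obtain v where v: "v \<in> V" "B.h.D\<Phi> x v = unit_seq m" "B.dtrunc x v = scl (a m) w" using w(3)[OF m] by blast
        have "D\<phi> x v = a m *\<^sub>R DF (B.trunc x) w + (1/2) ^ m *\<^sub>R u m"
          using v by (simp add: D\<phi>_def \<Lambda>u bdd_lin_scl[OF lF[OF B.M_mem[OF x]] w(1)])
        moreover have "\<xi> \<bullet> D\<phi> x v = 0" using \<xi>(2) v(1) by blast
        ultimately show ?thesis by (simp add: inner_add_right \<beta>_def)
      qed
      obtain i where i: "\<xi> $ i \<noteq> 0" using \<xi>(1) by (auto simp: vec_eq_iff)
      \<comment> \<open>Chosen so that \<open>\<sigma> * \<xi> $ i\<close> has the sign of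
        \<open>\<beta>\<close>, and is positive if \<open>\<beta> = 0\<close>. Then the two terms of
        \<open>eq\<close> cannot cancel, as \<open>a m > 0\<close>.\<close>
      define \<sigma> :: real where "\<sigma> = (if (\<beta> \<ge> 0) = (\<xi> $ i > 0) then 1 else -1)"
      have "\<sigma> \<in> {1, -1}" by (simp add: \<sigma>_def)
      then obtain m where m: "m \<ge> M" "u m = \<sigma> *\<^sub>R axis i 1" using u(2) by blast
      have xu: "\<xi> \<bullet> u m = \<sigma> * \<xi> $ i" by (simp add: m inner_axis)
      have am: "a m > 0" using w(2)[OF m(1)] .
      have p: "(1/2::real) ^ m > 0" by simp
      show False
      proof (cases "\<beta> \<ge> 0")
        case True
        hence "\<xi> \<bullet> u m > 0" using i xu by (auto simp: \<sigma>_def)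
        hence "(1/2) ^ m * (\<xi> \<bullet> u m) > 0" using p by (rule mult_pos_pos[rotated])
        moreover have "a m * \<beta> \<ge> 0" using True am by simp
        ultimately show False using eq[OF m(1)] by linarith
      next
        case False
        hence "\<xi> \<bullet> u m < 0" using i xu by (auto simp: \<sigma>_def)
        hence "(1/2) ^ m * (\<xi> \<bullet> u m) < 0" using p by (simp add: mult_pos_neg)
        moreover have "a m * \<beta> < 0" using False am by (intro mult_pos_neg) auto
        ultimately show False using eq[OF m(1)] by linarith
      qed
    qed
  qed
  have close: "norm (f x - \<phi> x) \<le> \<epsilon> x" "\<And>v. v \<in> V \<Longrightarrow> norm (Df x v - D\<phi> x v) \<le> \<epsilon> x * N v" if x: "x \<in> V" for x
  proof -
    show "norm (f x - \<phi> x) \<le> \<epsilon> x"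
      using e'(5)[of x] e'(2)[of x] out(1)[OF x] \<epsilon>(1)[OF x] by (cases "x \<in> U") (auto simp: norm_minus_commute)
    fix v assume v: "v \<in> V"
    have nv: "0 \<le> N v" using v by (rule norm_nonneg)
    show "norm (Df x v - D\<phi> x v) \<le> \<epsilon> x * N v"
    proof (cases "x \<in> U")
      case True
      have "norm (D\<phi> x v - Df x v) \<le> e' x * N v" by (rule e'(6)[OF True v])
      also have "\<dots> \<le> \<epsilon> x * N v" using e'(2)[OF True] nv by (rule mult_right_mono)
      finally show ?thesis by (simp add: norm_minus_commute)
    qed (use out(2)[OF x] \<epsilon>(1)[OF x] nv in simp)
  qed
  show ?thesis
    using bdd_lin\<phi> frechet cont close out(1) sur
    by (intro exI[of _ \<phi>] exI[of _ D\<phi>] conjI ballI allI impI) auto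
qed

end

section \<open>The spaces \<open>\<ell>\<^sub>p\<close>\<close>

context seq_lattice
begin

text \<open>Strict differentiability passes to limits in which the remainders have arbitrarily small
  Lipschitz constants near \<open>x\<close>; used below to cut an infinite sum to a finite
  one.\<close>

lemma strict_deriv_approx:
  fixes f :: "(nat \<Rightarrow> real) \<Rightarrow> 'a::real_normed_vector"
  assumes L: "bdd_lin L"
    and ap: "\<And>e. e > 0 \<Longrightarrow> \<exists>g M d. d > 0 \<and> strict_deriv g M x \<and>
      (\<forall>y\<in>V. \<forall>z\<in>V. N (y - x) < d \<longrightarrow> N (z - x) < d \<longrightarrow> norm ((f y - g y) - (f z - g z)) \<le> e * N (y - z)) \<and>
      (\<forall>v\<in>V. norm (L v - M v) \<le> e * N v)"
  shows "strict_deriv f L x"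
  unfolding strict_deriv_def
proof (intro conjI allI impI L)
  fix e :: real assume e: "e > 0"
  obtain g M d where g: "d > 0" "strict_deriv g M x"
    "\<And>y z. y \<in> V \<Longrightarrow> z \<in> V \<Longrightarrow> N (y - x) < d \<Longrightarrow> N (z - x) < d \<Longrightarrow> norm ((f y - g y) - (f z - g z)) \<le> e/3 * N (y - z)"
    "\<And>v. v \<in> V \<Longrightarrow> norm (L v - M v) \<le> e/3 * N v"
    using ap[of "e/3"] e by auto
  obtain d' where d': "d' > 0" "\<forall>y\<in>V. \<forall>z\<in>V. N (y - x) < d' \<longrightarrow> N (z - x) < d' \<longrightarrow>
     norm (g y - g z - M (y - z)) \<le> e/3 * N (y - z)" using strict_derivD[OF g(2), of "e/3"] e by auto
  have "norm (f y - f z - L (y - z)) \<le> e * N (y - z)"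
    if yz: "y \<in> V" "z \<in> V" "N (y - x) < min d d'" "N (z - x) < min d d'" for y z
  proof -
    have n3: "norm (a + b - c) \<le> norm a + norm b + norm c" for a b c :: 'a
      using norm_triangle_ineq4[of "a + b" c] norm_triangle_ineq[of a b] by linarith
    have eq: "f y - f z - L (y - z) = ((f y - g y) - (f z - g z)) + (g y - g z - M (y - z)) - (L (y - z) - M (y - z))"
      by simp
    have "norm (f y - f z - L (y - z)) \<le> norm ((f y - g y) - (f z - g z)) + norm (g y - g z - M (y - z)) + norm (L (y - z) - M (y - z))"
      by (subst eq) (rule n3)
    also have "\<dots> \<le> e/3 * N (y - z) + e/3 * N (y - z) + e/3 * N (y - z)"
      using g d' yz by (intro add_mono) (auto simp: diff_mem)
    finally show ?thesis by simp
  qed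
  thus "\<exists>d>0. \<forall>y\<in>V. \<forall>z\<in>V. N (y - x) < d \<longrightarrow> N (z - x) < d \<longrightarrow>
     norm (f y - f z - L (y - z)) \<le> e * N (y - z)"
    using g(1) d'(1) by (intro exI[of _ "min d d'"]) auto
qed

lemma bdd_lin_map_tail: "bdd_lin_map (tail n)"
proof -
  have "\<exists>K. \<forall>u\<in>V. N (tail n u) \<le> K * N u" using norm_tail by (intro exI[of _ 1]) simp
  moreover have "tail n (u + v) = tail n u + tail n v" "tail n (scl b u) = scl b (tail n u)" for b u v
    by (auto simp: tail_def fun_eq_iff)
  ultimately show ?thesis by (simp add: bdd_lin_map_def tail_mem)
qed

lemma strict_deriv_map_linear: "bdd_lin_map D \<Longrightarrow> strict_deriv_map D D x"
  unfolding strict_deriv_map_def using bdd_lin_map_diff[of D] norm_nonneg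
  by (auto simp: diff_mem bdd_lin_map_mem intro!: exI[of _ 1] mult_nonneg_nonneg)

text \<open>Heads converge to \<open>v\<close> in norm, so a bound on all heads passes to the
  limit.\<close>

lemma bdd_lin_tail_limit:
  fixes L :: "(nat \<Rightarrow> real) \<Rightarrow> real"
  assumes L: "bdd_lin L" and v: "v \<in> V" and b: "\<And>m. \<bar>L (head m v)\<bar> \<le> B"
  shows "\<bar>L v\<bar> \<le> B"
proof (rule field_le_epsilon)
  fix e :: real assume e: "e > 0"
  obtain K where K: "K > 0" "\<forall>u\<in>V. norm (L u) \<le> K * N u" using bdd_lin_bound[OF L] by blast
  obtain m where m: "N (tail m v) < e / K" using tail_small[OF v, of "e / K"] e K by auto
  have "\<bar>L (tail m v)\<bar> \<le> K * N (tail m v)" using K tail_mem[OF v] by simp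
  also have "\<dots> \<le> K * (e / K)" using m K by (intro mult_left_mono) auto
  finally have "\<bar>L (tail m v)\<bar> \<le> e" using K by simp
  moreover have "L v = L (head m v) + L (tail m v)"
    using bdd_lin_add[OF L head_mem[OF v] tail_mem[OF v], of m m] by (simp add: head_add_tail)
  ultimately show "\<bar>L v\<bar> \<le> B + e" using b[of m] by linarith
qed

lemma bdd_lin_head:
  fixes L :: "(nat \<Rightarrow> real) \<Rightarrow> real"
  assumes L: "bdd_lin L"
  shows "L (head m v) = (\<Sum>i<m. v i * L (unit_seq i))"
proof (induction m)
  case 0
  have "head 0 v = 0" by (auto simp: head_def)
  hence "L (head 0 v) = 0" using bdd_lin_zero[OF L] by (simp only:)
  thus ?case unfolding lessThan_0 sum.empty .
next
  case (Suc m)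
  have h: "head m v \<in> V" for m
  proof -
    have "summable (\<lambda>n. \<bar>head m v n\<bar>)" by (rule summable_finite[of "{..<m}"]) (auto simp: head_def)
    thus ?thesis using summable_mem by blast
  qed
  have "head (Suc m) v = head m v + scl (v m) (unit_seq m)"
    by (auto simp: head_def unit_seq_def fun_eq_iff less_Suc_eq)
  hence "L (head (Suc m) v) = L (head m v) + v m * L (unit_seq m)"
    using bdd_lin_add[OF L h scl_mem[OF unit_seq_mem]] bdd_lin_scl[OF L unit_seq_mem] by simp
  thus ?case using Suc by simp
qed

end

text \<open>Convexity on the open half-line, extended to the end point 0 by
  \<open>s powr p \<le> s\<close> on the unit interval.\<close>

lemma powr_convex_nonneg:
  fixes a b t p :: real
  assumes "p \<ge> 1" "a \<ge> 0" "b \<ge> 0" "0 \<le> t" "t \<le> 1"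
  shows "(t * a + (1 - t) * b) powr p \<le> t * a powr p + (1 - t) * b powr p"
proof -
  have le: "s powr p \<le> s" if "0 \<le> s" "s \<le> 1" for s :: real
    using powr_mono'[of 1 p s] assms(1) that by simp
  consider "a > 0" "b > 0" | "a = 0" | "b = 0" using assms by linarith
  thus ?thesis
  proof cases
    case 1
    have "convex_on {0<..} (\<lambda>x::real. x powr p)" using powr_convex assms(1) by blast
    from convex_onD[OF this, of "1 - t" a b] 1 assms show ?thesis by simp
  next
    case 2
    have "((1 - t) * b) powr p = (1 - t) powr p * b powr p" using assms by (simp add: powr_mult)
    also have "\<dots> \<le> (1 - t) * b powr p" using assms le[of "1 - t"] by (intro mult_right_mono) auto
    finally show ?thesis using 2 assms by simp
  next
    case 3
    have "(t * a) powr p = t powr p * a powr p" using assms by (simp add: powr_mult)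
    also have "\<dots> \<le> t * a powr p" using assms le[of t] by (intro mult_right_mono) auto
    finally show ?thesis using 3 assms by simp
  qed
qed

section \<open>The \<open>p\<close>-norm: Minkowski and Hoelder inequalities\<close>

locale lp =
  fixes p :: real
  assumes p: "1 < p"
begin

definition V :: "(nat \<Rightarrow> real) set" where "V = {x. summable (\<lambda>n. \<bar>x n\<bar> powr p)}"
definition S :: "(nat \<Rightarrow> real) \<Rightarrow> real" where "S x = (\<Sum>n. \<bar>x n\<bar> powr p)"
definition N :: "(nat \<Rightarrow> real) \<Rightarrow> real" where "N x = S x powr (1 / p)"

lemma summ: "x \<in> V \<Longrightarrow> summable (\<lambda>n. \<bar>x n\<bar> powr p)" by (simp add: V_def)

lemma S_nonneg: "x \<in> V \<Longrightarrow> 0 \<le> S x" unfolding S_def by (rule suminf_nonneg[OF summ]) simp_all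

lemma N_nonneg': "0 \<le> N x" by (simp add: N_def)

lemma N_powr: "x \<in> V \<Longrightarrow> N x powr p = S x"
  using p S_nonneg[of x] by (simp add: N_def powr_powr)

lemma S_nonneg_term: "x \<in> V \<Longrightarrow> \<bar>x n\<bar> powr p \<le> S x"
  unfolding S_def using sum_le_suminf[OF summ, of x "{n}"] by simp

lemma root_le: "0 \<le> a \<Longrightarrow> 0 \<le> b \<Longrightarrow> a \<le> b powr p \<Longrightarrow> a powr (1/p) \<le> b"
  using powr_mono2[of "1/p" a "b powr p"] p by (simp add: powr_powr)

lemma N_le: "x \<in> V \<Longrightarrow> 0 \<le> b \<Longrightarrow> S x \<le> b powr p \<Longrightarrow> N x \<le> b"
  unfolding N_def using root_le S_nonneg by blast

lemma coord: "x \<in> V \<Longrightarrow> \<bar>x n\<bar> \<le> N x"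
  using powr_mono2[of "1/p" "\<bar>x n\<bar> powr p" "S x"] S_nonneg_term[of x n] p by (simp add: N_def powr_powr)

lemma N_eq_0: "x \<in> V \<Longrightarrow> N x = 0 \<Longrightarrow> x n = 0"
  using coord[of x n] by simp

lemma solid': assumes "v \<in> V" "\<And>n. \<bar>u n\<bar> \<le> \<bar>v n\<bar>" shows "u \<in> V" "S u \<le> S v" "N u \<le> N v"
proof -
  have le: "\<bar>u n\<bar> powr p \<le> \<bar>v n\<bar> powr p" for n using assms(2) p by (intro powr_mono2) auto
  have s: "summable (\<lambda>n. \<bar>u n\<bar> powr p)"
    by (rule summable_comparison_test[OF _ summ[OF assms(1)]]) (use le in auto)
  thus u: "u \<in> V" by (simp add: V_def)
  show "S u \<le> S v" unfolding S_def by (rule suminf_le[OF le s summ[OF assms(1)]])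
  thus "N u \<le> N v" unfolding N_def using S_nonneg[OF u] p by (intro powr_mono2) auto
qed

lemma normalized: "x \<in> V \<Longrightarrow> N x > 0 \<Longrightarrow> summable (\<lambda>n. (\<bar>x n\<bar> / N x) powr p) \<and> (\<Sum>n. (\<bar>x n\<bar> / N x) powr p) = 1"
proof -
  assume x: "x \<in> V" and n: "N x > 0"
  have e: "(\<bar>x n\<bar> / N x) powr p = \<bar>x n\<bar> powr p / S x" for n using n by (simp add: powr_divide N_powr[OF x])
  have "S x \<noteq> 0" using n by (auto simp: N_def)
  thus ?thesis using summ[OF x] suminf_divide[OF summ[OF x], of "S x"] by (simp add: e S_def[symmetric])
qed

text \<open>Convexity of the \<open>p\<close>-th power is applied to the normalized sequences with
  weights \<open>a / (a + b)\<close> and \<open>b / (a + b)\<close>; summing gives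
  \<open>(a + b) powr p\<close>.\<close>

lemma minkowski: assumes x: "x \<in> V" and y: "y \<in> V" shows "x + y \<in> V" "N (x + y) \<le> N x + N y"
proof -
  have "x + y \<in> V \<and> N (x + y) \<le> N x + N y"
  proof (cases "N x = 0 \<or> N y = 0")
    case True
    hence "x + y = y \<or> x + y = x" using N_eq_0[OF x] N_eq_0[OF y] by (auto simp: fun_eq_iff)
    thus ?thesis using x y N_nonneg' by auto
  next
    case False
    hence n: "N x > 0" "N y > 0" using N_nonneg' by (auto simp: less_le)
    define a b where "a = N x" and "b = N y"
    have ab: "a > 0" "b > 0" using n by (auto simp: a_def b_def)
    define t where "t = a / (a + b)"
    have t: "0 \<le> t" "t \<le> 1" "1 - t = b / (a + b)" using ab by (auto simp: t_def field_simps)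
    have le: "\<bar>(x + y) n\<bar> powr p \<le> (a + b) powr p * (t * (\<bar>x n\<bar> / a) powr p + (1 - t) * (\<bar>y n\<bar> / b) powr p)" for n
    proof -
      have "\<bar>(x + y) n\<bar> \<le> \<bar>x n\<bar> + \<bar>y n\<bar>" by simp
      also have "\<dots> = (a + b) * (t * (\<bar>x n\<bar> / a) + (1 - t) * (\<bar>y n\<bar> / b))"
      proof -
        have "(a + b) * (t * (\<bar>x n\<bar> / a)) = \<bar>x n\<bar>" "(a + b) * ((1 - t) * (\<bar>y n\<bar> / b)) = \<bar>y n\<bar>"
          unfolding t(3) unfolding t_def using ab by auto
        thus ?thesis by (simp only: distrib_left)
      qed
      finally have "\<bar>(x + y) n\<bar> powr p \<le> ((a + b) * (t * (\<bar>x n\<bar> / a) + (1 - t) * (\<bar>y n\<bar> / b))) powr p"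
        using p by (intro powr_mono2) auto
      also have "\<dots> = (a + b) powr p * (t * (\<bar>x n\<bar> / a) + (1 - t) * (\<bar>y n\<bar> / b)) powr p"
        using ab t by (intro powr_mult)
      also have "\<dots> \<le> (a + b) powr p * (t * (\<bar>x n\<bar> / a) powr p + (1 - t) * (\<bar>y n\<bar> / b) powr p)"
        using p t ab by (intro mult_left_mono powr_convex_nonneg) auto
      finally show ?thesis .
    qed
    have "(\<lambda>n. (\<bar>x n\<bar> / a) powr p) sums 1" "(\<lambda>n. (\<bar>y n\<bar> / b) powr p) sums 1"
      using normalized[OF x n(1)] normalized[OF y n(2)] by (auto simp: a_def b_def sums_iff)
    hence "(\<lambda>n. (a + b) powr p * (t * (\<bar>x n\<bar> / a) powr p + (1 - t) * (\<bar>y n\<bar> / b) powr p)) sums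
      ((a + b) powr p * (t * 1 + (1 - t) * 1))" by (intro sums_mult sums_add)
    hence s: "(\<lambda>n. (a + b) powr p * (t * (\<bar>x n\<bar> / a) powr p + (1 - t) * (\<bar>y n\<bar> / b) powr p)) sums ((a + b) powr p)"
      by simp
    have sm: "summable (\<lambda>n. \<bar>(x + y) n\<bar> powr p)"
      by (rule summable_comparison_test[OF _ sums_summable[OF s]]) (use le in auto)
    hence m: "x + y \<in> V" by (simp add: V_def)
    have "S (x + y) \<le> (a + b) powr p"
      using suminf_le[OF le sm sums_summable[OF s]] s by (simp add: S_def sums_iff)
    thus ?thesis using N_le[OF m, of "a + b"] m ab by (auto simp: a_def b_def)
  qed
  thus "x + y \<in> V" "N (x + y) \<le> N x + N y" by auto
qed

text \<open>Young's inequality for the normalized sequences with \<open>q = p / (p - 1)\<close>, for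
  which \<open>(p - 1) * q = p\<close>. Pairing with \<open>\<bar>x\<bar> powr (p - 1)\<close> is
  the form taken by derivatives of the norm and by general functionals.\<close>

lemma holder: assumes x: "x \<in> V" and h: "h \<in> V"
  shows "summable (\<lambda>n. \<bar>x n\<bar> powr (p - 1) * \<bar>h n\<bar>)" "(\<Sum>n. \<bar>x n\<bar> powr (p - 1) * \<bar>h n\<bar>) \<le> N x powr (p - 1) * N h"
proof -
  have "summable (\<lambda>n. \<bar>x n\<bar> powr (p - 1) * \<bar>h n\<bar>) \<and> (\<Sum>n. \<bar>x n\<bar> powr (p - 1) * \<bar>h n\<bar>) \<le> N x powr (p - 1) * N h"
  proof (cases "N x = 0 \<or> N h = 0")
    case True
    hence "(\<lambda>n. \<bar>x n\<bar> powr (p - 1) * \<bar>h n\<bar>) = (\<lambda>n. 0)" using N_eq_0[OF x] N_eq_0[OF h] by (auto simp: fun_eq_iff)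
    thus ?thesis using N_nonneg' by simp
  next
    case False
    hence n: "N x > 0" "N h > 0" using N_nonneg' by (auto simp: less_le)
    define a b where "a = N x" and "b = N h"
    have ab: "a > 0" "b > 0" using n by (auto simp: a_def b_def)
    define q where "q = p / (p - 1)"
    have q: "q > 1" "1 / q + 1 / p = 1" "(p - 1) * q = p" using p by (auto simp: q_def field_simps)
    have le: "\<bar>x n\<bar> powr (p - 1) * \<bar>h n\<bar> \<le> a powr (p - 1) * b * ((1 / q) * (\<bar>x n\<bar> / a) powr p + (1 / p) * (\<bar>h n\<bar> / b) powr p)" for n
    proof -
      have "(\<bar>x n\<bar> / a) powr (p - 1) * (\<bar>h n\<bar> / b) \<le> ((\<bar>x n\<bar> / a) powr (p - 1)) powr q / q + (\<bar>h n\<bar> / b) powr p / p"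
        using q p ab by (intro Youngs_inequality) auto
      also have "((\<bar>x n\<bar> / a) powr (p - 1)) powr q = (\<bar>x n\<bar> / a) powr p" by (simp add: powr_powr q)
      finally have "a powr (p - 1) * b * ((\<bar>x n\<bar> / a) powr (p - 1) * (\<bar>h n\<bar> / b)) \<le>
        a powr (p - 1) * b * ((1 / q) * (\<bar>x n\<bar> / a) powr p + (1 / p) * (\<bar>h n\<bar> / b) powr p)"
        using ab by (intro mult_left_mono) auto
      moreover have "a powr (p - 1) * b * ((\<bar>x n\<bar> / a) powr (p - 1) * (\<bar>h n\<bar> / b)) = \<bar>x n\<bar> powr (p - 1) * \<bar>h n\<bar>"
        using ab by (simp add: powr_divide)
      ultimately show ?thesis by simp
    qed
    have "(\<lambda>n. (\<bar>x n\<bar> / a) powr p) sums 1" "(\<lambda>n. (\<bar>h n\<bar> / b) powr p) sums 1"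
      using normalized[OF x n(1)] normalized[OF h n(2)] by (auto simp: a_def b_def sums_iff)
    hence "(\<lambda>n. a powr (p - 1) * b * ((1 / q) * (\<bar>x n\<bar> / a) powr p + (1 / p) * (\<bar>h n\<bar> / b) powr p)) sums
      (a powr (p - 1) * b * ((1 / q) * 1 + (1 / p) * 1))" by (intro sums_mult sums_add)
    hence s: "(\<lambda>n. a powr (p - 1) * b * ((1 / q) * (\<bar>x n\<bar> / a) powr p + (1 / p) * (\<bar>h n\<bar> / b) powr p)) sums
      (a powr (p - 1) * b)" using q by simp
    have sm: "summable (\<lambda>n. \<bar>x n\<bar> powr (p - 1) * \<bar>h n\<bar>)"
      by (rule summable_comparison_test[OF _ sums_summable[OF s]]) (use le in auto)
    thus ?thesis using suminf_le[OF le sm sums_summable[OF s]] s by (simp add: a_def b_def sums_iff)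
  qed
  thus "summable (\<lambda>n. \<bar>x n\<bar> powr (p - 1) * \<bar>h n\<bar>)" "(\<Sum>n. \<bar>x n\<bar> powr (p - 1) * \<bar>h n\<bar>) \<le> N x powr (p - 1) * N h" by auto
qed

lemma S_tail: "x \<in> V \<Longrightarrow> S (tail n x) = (\<Sum>i. \<bar>x (i + n)\<bar> powr p)"
proof -
  assume x: "x \<in> V"
  have "tail n x \<in> V" by (rule solid'[OF x]) (auto simp: tail_def)
  hence "S (tail n x) = (\<Sum>i. \<bar>tail n x (i + n)\<bar> powr p) + (\<Sum>i<n. \<bar>tail n x i\<bar> powr p)"
    unfolding S_def by (intro suminf_split_initial_segment summ)
  thus ?thesis by (simp add: tail_def)
qed

sublocale seq_lattice V N
proof unfold_locales
  fix u v :: "nat \<Rightarrow> real" and b :: real and n :: nat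
  show "u \<in> V \<Longrightarrow> v \<in> V \<Longrightarrow> u + v \<in> V" "u \<in> V \<Longrightarrow> v \<in> V \<Longrightarrow> N (u + v) \<le> N u + N v" using minkowski by auto
  show "u \<in> V \<Longrightarrow> \<bar>u n\<bar> \<le> N u" by (rule coord)
  show "v \<in> V \<Longrightarrow> (\<And>n. \<bar>u n\<bar> \<le> \<bar>v n\<bar>) \<Longrightarrow> u \<in> V \<and> N u \<le> N v" using solid'[of v u] by blast
  { assume u: "u \<in> V"
    have e: "\<bar>scl b u n\<bar> powr p = \<bar>b\<bar> powr p * \<bar>u n\<bar> powr p" for n by (simp add: abs_mult powr_mult)
    show "scl b u \<in> V" using summ[OF u] unfolding V_def mem_Collect_eq e by (rule summable_mult)
    have "S (scl b u) = \<bar>b\<bar> powr p * S u" unfolding S_def e by (rule suminf_mult[OF summ[OF u]])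
    thus "N (scl b u) = \<bar>b\<bar> * N u" using p by (simp add: N_def powr_mult powr_powr S_nonneg[OF u]) }
  { assume s: "summable (\<lambda>n. \<bar>u n\<bar>)"
    define t where "t = (\<Sum>n. \<bar>u n\<bar>)"
    have ut: "\<bar>u n\<bar> \<le> t" for n using sum_le_suminf[OF s, of "{n}"] by (simp add: t_def)
    show "u \<in> V \<and> N u \<le> (\<Sum>n. \<bar>u n\<bar>)"
    proof (cases "t = 0")
      case True
      hence "u = (\<lambda>n. 0)" using ut by (auto simp: fun_eq_iff)
      thus ?thesis using p by (simp add: V_def N_def S_def)
    next
      case False
      hence t: "t > 0" using ut[of 0] by linarith
      have le: "\<bar>u n\<bar> powr p \<le> t powr p / t * \<bar>u n\<bar>" for n
      proof -
        have "(\<bar>u n\<bar> / t) powr p \<le> (\<bar>u n\<bar> / t) powr 1" using ut[of n] t p by (intro powr_mono') auto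
        hence "t powr p * (\<bar>u n\<bar> / t) powr p \<le> t powr p * (\<bar>u n\<bar> / t)" using t by (intro mult_left_mono) auto
        thus ?thesis using t by (simp add: powr_divide)
      qed
      have sb: "(\<lambda>n. t powr p / t * \<bar>u n\<bar>) sums (t powr p / t * t)"
        using s by (intro sums_mult) (simp add: t_def sums_iff)
      have sm: "summable (\<lambda>n. \<bar>u n\<bar> powr p)"
        by (rule summable_comparison_test[OF _ sums_summable[OF sb]]) (use le in auto)
      hence u: "u \<in> V" by (simp add: V_def)
      have "S u \<le> t powr p" using suminf_le[OF le sm sums_summable[OF sb]] sb t by (simp add: S_def sums_iff)
      thus ?thesis using N_le[OF u] u t by (simp add: t_def)
    qed }
  { fix e :: real assume u: "u \<in> V" and e: "e > 0"
    obtain n where n: "norm (\<Sum>i. \<bar>u (i + n)\<bar> powr p) < (e / 2) powr p"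
      using suminf_exist_split[OF _ summ[OF u], of "(e / 2) powr p"] e by auto
    have "tail n u \<in> V" by (rule solid'[OF u]) (auto simp: tail_def)
    hence "N (tail n u) \<le> e / 2" using n S_tail[OF u, of n] e by (intro N_le) auto
    thus "\<exists>n. N (tail n u) < e" using e by (intro exI[of _ n]) simp }
qed

section \<open>The duality map and the derivative of the \<open>p\<close>-th power sum\<close>

definition J :: "real \<Rightarrow> real" where "J t = sgn t * \<bar>t\<bar> powr (p - 1)"

lemma abs_J: "\<bar>J t\<bar> = \<bar>t\<bar> powr (p - 1)"
  by (cases "t = 0") (simp_all add: J_def abs_mult abs_sgn_eq)

lemma DERIV_abs_powr: "((\<lambda>t. \<bar>t\<bar> powr p) has_real_derivative p * J t) (at t)"
proof -
  consider "t > 0" | "t < 0" | "t = 0" by linarith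
  thus ?thesis
  proof cases
    case 1
    have "((\<lambda>t. t powr p) has_real_derivative p * t powr (p - 1)) (at t)"
      using has_real_derivative_powr[OF 1, of p] by simp
    moreover have "eventually (\<lambda>s. s powr p = \<bar>s\<bar> powr p) (nhds t)"
      using eventually_nhds_in_open[of "{0<..}" t] 1 by (auto elim!: eventually_mono)
    ultimately have "((\<lambda>t. \<bar>t\<bar> powr p) has_real_derivative p * t powr (p - 1)) (at t)"
      by (subst (asm) DERIV_cong_ev[OF refl _ refl]) auto
    thus ?thesis using 1 by (simp add: J_def)
  next
    case 2
    have "((\<lambda>t. t powr p) has_real_derivative p * (- t) powr (p - 1)) (at (- t))"
      using has_real_derivative_powr[of "- t" p] 2 by simp
    hence "((\<lambda>t. (- t) powr p) has_real_derivative (p * (- t) powr (p - 1)) * (- 1)) (at t)"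
      by (rule DERIV_chain2) (auto intro!: derivative_eq_intros)
    moreover have "eventually (\<lambda>s. (- s) powr p = \<bar>s\<bar> powr p) (nhds t)"
      using eventually_nhds_in_open[of "{..<0}" t] 2 by (auto elim!: eventually_mono)
    ultimately have "((\<lambda>t. \<bar>t\<bar> powr p) has_real_derivative (p * (- t) powr (p - 1)) * (- 1)) (at t)"
      by (subst (asm) DERIV_cong_ev[OF refl _ refl]) auto
    thus ?thesis using 2 by (simp add: J_def)
  next
    case 3
    \<comment> \<open>At 0 the difference quotient has absolute value at most
      \<open>\<bar>h\<bar> powr (p - 1)\<close>, which tends to 0 because
      \<open>p > 1\<close>.\<close>
    have "((\<lambda>h. \<bar>h\<bar> powr (p - 1)) \<longlongrightarrow> 0 powr (p - 1)) (at (0::real))"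
      using p by (intro tendsto_powr' tendsto_intros tendsto_rabs_zero) auto
    hence "((\<lambda>h. \<bar>h\<bar> powr (p - 1)) \<longlongrightarrow> 0) (at (0::real))" by simp
    hence "((\<lambda>h. (\<bar>0 + h\<bar> powr p - \<bar>0\<bar> powr p) / h) \<longlongrightarrow> 0) (at (0::real))"
    proof (rule Lim_null_comparison[rotated])
      have "norm ((\<bar>0 + h\<bar> powr p - \<bar>0\<bar> powr p) / h) \<le> \<bar>h\<bar> powr (p - 1)" for h :: real
        using p by (cases "h = 0") (auto simp: powr_diff)
      thus "\<forall>\<^sub>F h in at (0::real). norm ((\<bar>0 + h\<bar> powr p - \<bar>0\<bar> powr p) / h) \<le> \<bar>h\<bar> powr (p - 1)" by simp
    qed
    thus ?thesis using 3 by (simp add: DERIV_def J_def)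
  qed
qed

lemma isCont_J: "isCont J t"
proof -
  have e: "J = (\<lambda>t. (max 0 t) powr (p - 1) - (max 0 (- t)) powr (p - 1))"
    by (auto simp: J_def fun_eq_iff max_def sgn_if)
  have "isCont (\<lambda>t::real. (max 0 t) powr (p - 1)) t" for t
    unfolding isCont_def using p by (intro tendsto_powr' tendsto_intros) auto
  moreover have "isCont (\<lambda>t::real. (max 0 (- t)) powr (p - 1)) t" for t
    unfolding isCont_def using p by (intro tendsto_powr' tendsto_intros) auto
  ultimately show ?thesis unfolding e by (intro continuous_diff)
qed

lemma abs_powr_diff_le: "\<bar>\<bar>a\<bar> powr p - \<bar>b\<bar> powr p\<bar> \<le> p * ((\<bar>a\<bar> + \<bar>b\<bar>) powr (p - 1) * \<bar>a - b\<bar>)"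
proof -
  have *: "\<bar>\<bar>a\<bar> powr p - \<bar>b\<bar> powr p\<bar> \<le> p * ((\<bar>a\<bar> + \<bar>b\<bar>) powr (p - 1) * \<bar>a - b\<bar>)" if ab: "b < a" for a b :: real
  proof -
    obtain z where z: "b < z" "z < a" "\<bar>a\<bar> powr p - \<bar>b\<bar> powr p = (a - b) * (p * J z)"
      using MVT2[OF ab DERIV_abs_powr] by blast
    have "\<bar>z\<bar> powr (p - 1) \<le> (\<bar>a\<bar> + \<bar>b\<bar>) powr (p - 1)" using z p by (intro powr_mono2) auto
    hence "\<bar>a - b\<bar> * (p * \<bar>z\<bar> powr (p - 1)) \<le> \<bar>a - b\<bar> * (p * (\<bar>a\<bar> + \<bar>b\<bar>) powr (p - 1))"
      using p by (intro mult_left_mono) auto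
    thus ?thesis using p by (simp add: z(3) abs_mult abs_J mult_ac)
  qed
  show ?thesis
  proof (cases a b rule: linorder_cases)
    case less
    thus ?thesis using *[OF less] by (simp add: abs_minus_commute add.commute)
  qed (use * in auto)
qed

definition dS :: "(nat \<Rightarrow> real) \<Rightarrow> (nat \<Rightarrow> real) \<Rightarrow> real" where
  "dS x v = (\<Sum>i. p * J (x i) * v i)"

lemma dS_summable: assumes "x \<in> V" "v \<in> V"
  shows "summable (\<lambda>i. p * J (x i) * v i)" "\<bar>dS x v\<bar> \<le> p * N x powr (p - 1) * N v"
proof -
  have e: "norm (p * J (x i) * v i) = p * (\<bar>x i\<bar> powr (p - 1) * \<bar>v i\<bar>)" for i
    using p by (simp add: abs_mult abs_J)
  have s: "summable (\<lambda>i. norm (p * J (x i) * v i))"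
    unfolding e using holder(1)[OF assms] by (rule summable_mult)
  thus "summable (\<lambda>i. p * J (x i) * v i)" by (rule summable_norm_cancel)
  have "\<bar>dS x v\<bar> \<le> (\<Sum>i. norm (p * J (x i) * v i))"
    unfolding dS_def using summable_norm[OF s] by simp
  also have "\<dots> = p * (\<Sum>i. \<bar>x i\<bar> powr (p - 1) * \<bar>v i\<bar>)" unfolding e using holder(1)[OF assms] by (rule suminf_mult)
  also have "\<dots> \<le> p * (N x powr (p - 1) * N v)" using holder(2)[OF assms] p by (intro mult_left_mono) auto
  finally show "\<bar>dS x v\<bar> \<le> p * N x powr (p - 1) * N v" by simp
qed

lemma dS_bdd_lin: assumes x: "x \<in> V" shows "bdd_lin (dS x)"
  unfolding bdd_lin_def
proof (intro conjI ballI allI)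
  fix u v :: "nat \<Rightarrow> real" and b :: real assume u: "u \<in> V"
  { assume v: "v \<in> V"
    show "dS x (u + v) = dS x u + dS x v"
      using suminf_add[OF dS_summable(1)[OF x u] dS_summable(1)[OF x v]] by (simp add: dS_def algebra_simps) }
  show "dS x (scl b u) = b *\<^sub>R dS x u"
    using suminf_mult[OF dS_summable(1)[OF x u], of b] by (simp add: dS_def algebra_simps)
qed (use dS_summable(2)[OF x] in auto)

lemma S_split: assumes "x \<in> V" shows "S x = (\<Sum>i<n. \<bar>x i\<bar> powr p) + S (tail n x)"
  using suminf_split_initial_segment[OF summ[OF assms], of n] S_tail[OF assms, of n] by (simp add: S_def)

text \<open>Finite partial sums are treated coordinatewise. The rest of the sum is Lipschitz near
  \<open>x\<close> with constant \<open>p\<close> times a power of the tail norm, by the mean value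
  bound and Hoelder, and is thus a small remainder.\<close>

lemma S_strict_deriv: assumes x: "x \<in> V" shows "strict_deriv S (dS x) x"
proof (rule strict_deriv_approx[OF dS_bdd_lin[OF x]])
  fix e :: real assume e: "e > 0"
  \<comment> \<open>Solves \<open>p * (4 * \<tau>) powr (p - 1) = e\<close>; the 4 arises because
    two tails of norm at most \<open>2 * \<tau>\<close> are added.\<close>
  define \<tau> where "\<tau> = (e / p) powr (1 / (p - 1)) / 4"
  have \<tau>: "\<tau> > 0" using e p by (simp add: \<tau>_def)
  have \<tau>e: "p * (4 * \<tau>) powr (p - 1) = e" using e p by (simp add: \<tau>_def powr_powr)
  obtain n where n: "N (tail n x) < \<tau>" using tail_small[OF x \<tau>] by blast
  define g where "g m y = (\<Sum>i<m. \<bar>y i\<bar> powr p)" for m and y :: "nat \<Rightarrow> real"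
  define M where "M m v = (\<Sum>i<m. p * J (x i) * v i)" for m and v :: "nat \<Rightarrow> real"
  have gM: "strict_deriv (g m) (M m) x" for m
  proof (induction m)
    case 0
    thus ?case using strict_deriv_const[of 0 x] by (simp add: g_def[abs_def] M_def[abs_def])
  next
    case (Suc m)
    have "strict_deriv (\<lambda>y. \<bar>y m\<bar> powr p) (\<lambda>v. p * J (x m) * v m) x"
      by (rule strict_deriv_deriv_compose[OF strict_deriv_coord x, where r = 1 and G = "\<lambda>t. \<bar>t\<bar> powr p" and G' = "\<lambda>t. p * J t"])
         (use DERIV_abs_powr isCont_J in \<open>auto intro!: continuous_intros\<close>)
    from strict_deriv_add[OF Suc this] show ?case by (simp add: g_def[abs_def] M_def[abs_def])
  qed
  have tl: "norm ((S y - g n y) - (S z - g n z)) \<le> e * N (y - z)"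
    if yz: "y \<in> V" "z \<in> V" "N (y - x) < \<tau>" "N (z - x) < \<tau>" for y z
  proof -
    define a b where "a = tail n y" and "b = tail n z"
    have m: "a \<in> V" "b \<in> V" using yz by (auto simp: a_def b_def tail_mem)
    have nt: "N (tail n w) \<le> 2 * \<tau>" if "w \<in> V" "N (w - x) < \<tau>" for w
    proof -
      have "tail n w = tail n x + tail n (w - x)" by (auto simp: tail_def fun_eq_iff)
      thus ?thesis using norm_add[of "tail n x" "tail n (w - x)"] norm_tail[of "w - x" n] n x that
        by (simp add: tail_mem diff_mem)
    qed
    have aV: "(\<lambda>i. \<bar>a i\<bar>) \<in> V \<and> N (\<lambda>i. \<bar>a i\<bar>) \<le> N a" "(\<lambda>i. \<bar>b i\<bar>) \<in> V \<and> N (\<lambda>i. \<bar>b i\<bar>) \<le> N b"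
      by (rule solid[OF m(1)], simp) (rule solid[OF m(2)], simp)
    define c where "c = (\<lambda>i. \<bar>a i\<bar>) + (\<lambda>i. \<bar>b i\<bar>)"
    have c: "c \<in> V" "N c \<le> 4 * \<tau>"
      using norm_add[of "\<lambda>i. \<bar>a i\<bar>" "\<lambda>i. \<bar>b i\<bar>"] aV nt[OF yz(1,3)] nt[OF yz(2,4)] by (auto simp: c_def a_def b_def add_mem)
    have ab: "a - b \<in> V" using m by (simp add: diff_mem)
    have nab: "N (a - b) \<le> N (y - z)"
    proof -
      have "a - b = tail n (y - z)" by (auto simp: a_def b_def tail_def fun_eq_iff)
      thus ?thesis using yz norm_tail[of "y - z" n] by (simp add: diff_mem)
    qed
    have n0: "0 \<le> N (y - z)" using yz by (simp add: norm_nonneg diff_mem)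
    have le: "norm (\<bar>a i\<bar> powr p - \<bar>b i\<bar> powr p) \<le> p * (\<bar>c i\<bar> powr (p - 1) * \<bar>(a - b) i\<bar>)" for i
      using abs_powr_diff_le[of "a i" "b i"] by (simp add: c_def)
    have sr: "summable (\<lambda>i. p * (\<bar>c i\<bar> powr (p - 1) * \<bar>(a - b) i\<bar>))"
      using holder(1)[OF c(1) ab] by (rule summable_mult)
    have sl: "summable (\<lambda>i. norm (\<bar>a i\<bar> powr p - \<bar>b i\<bar> powr p))"
      by (rule summable_comparison_test[OF _ sr]) (use le in auto)
    have "(S y - g n y) - (S z - g n z) = S a - S b"
      using S_split[OF yz(1), of n] S_split[OF yz(2), of n] by (simp add: g_def a_def b_def)
    also have "\<dots> = (\<Sum>i. \<bar>a i\<bar> powr p - \<bar>b i\<bar> powr p)"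
      unfolding S_def by (rule suminf_diff[OF summ[OF m(1)] summ[OF m(2)]])
    finally have "norm ((S y - g n y) - (S z - g n z)) \<le> (\<Sum>i. norm (\<bar>a i\<bar> powr p - \<bar>b i\<bar> powr p))"
      using summable_norm[OF sl] by simp
    also have "\<dots> \<le> (\<Sum>i. p * (\<bar>c i\<bar> powr (p - 1) * \<bar>(a - b) i\<bar>))" by (rule suminf_le[OF le sl sr])
    also have "\<dots> = p * (\<Sum>i. \<bar>c i\<bar> powr (p - 1) * \<bar>(a - b) i\<bar>)"
      using holder(1)[OF c(1) ab] by (rule suminf_mult)
    also have "\<dots> \<le> p * (N c powr (p - 1) * N (a - b))" using holder(2)[OF c(1) ab] p by (intro mult_left_mono) auto
    also have "\<dots> \<le> p * ((4 * \<tau>) powr (p - 1) * N (y - z))"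
      using p c nab n0 N_nonneg' \<tau> norm_nonneg[OF ab] by (intro mult_left_mono mult_mono powr_mono2) auto
    also have "\<dots> = e * N (y - z)" using \<tau>e by (simp add: mult.assoc[symmetric])
    finally show ?thesis .
  qed
  have dl: "norm (dS x v - M n v) \<le> e * N v" if v: "v \<in> V" for v
  proof -
    have "dS x v = M n v + (\<Sum>i. p * J (x (i + n)) * v (i + n))"
      unfolding dS_def M_def using suminf_split_initial_segment[OF dS_summable(1)[OF x v], of n] by simp
    moreover have "dS (tail n x) v = (\<Sum>i. p * J (x (i + n)) * v (i + n))"
      unfolding dS_def
      using suminf_split_initial_segment[OF dS_summable(1)[OF tail_mem[OF x] v], of n n] by (simp add: tail_def J_def)
    ultimately have "norm (dS x v - M n v) \<le> p * N (tail n x) powr (p - 1) * N v"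
      using dS_summable(2)[OF tail_mem[OF x] v, of n] by simp
    also have "\<dots> \<le> p * (4 * \<tau>) powr (p - 1) * N v"
      using p n N_nonneg' \<tau> norm_nonneg[OF v] by (intro mult_right_mono mult_left_mono powr_mono2) auto
    finally show ?thesis using \<tau>e by simp
  qed
  show "\<exists>g M d. d > 0 \<and> strict_deriv g M x \<and>
      (\<forall>y\<in>V. \<forall>z\<in>V. N (y - x) < d \<longrightarrow> N (z - x) < d \<longrightarrow> norm ((S y - g y) - (S z - g z)) \<le> e * N (y - z)) \<and>
      (\<forall>v\<in>V. norm (dS x v - M v) \<le> e * N v)"
    using \<tau> gM tl dl by (intro exI[of _ "g n"] exI[of _ "M n"] exI[of _ \<tau>] conjI ballI impI)
qed

text \<open>The coefficients of \<open>L\<close> form a \<open>q\<close>-summable sequence. It is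
  encoded by \<open>x\<close> in the space itself with
  \<open>\<bar>x\<bar> powr (p - 1) = \<bar>a\<bar>\<close>, so that \<open>holder\<close> bounds
  \<open>L\<close> on tails by the tail norm of \<open>x\<close>.\<close>

lemma lp_dual:
  fixes L :: "(nat \<Rightarrow> real) \<Rightarrow> real"
  assumes L: "bdd_lin L" and e: "e > 0"
  shows "\<exists>n. \<forall>v\<in>V. \<bar>L (tail n v)\<bar> \<le> e * N v"
proof -
  obtain K where K: "K > 0" "\<forall>u\<in>V. norm (L u) \<le> K * N u" using bdd_lin_bound[OF L] by blast
  define a where "a i = L (unit_seq i)" for i
  define x where "x i = \<bar>a i\<bar> powr (1 / (p - 1))" for i
  have x1: "\<bar>x i\<bar> powr (p - 1) = \<bar>a i\<bar>" for i using p by (cases "a i = 0") (simp_all add: x_def powr_powr)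
  have x0: "0 \<le> x i" for i by (simp add: x_def)
  have xp: "\<bar>x i\<bar> powr p = \<bar>a i\<bar> * x i" for i
  proof (cases "x i = 0")
    case False
    hence "\<bar>x i\<bar> powr (p - 1 + 1) = \<bar>x i\<bar> powr (p - 1) * \<bar>x i\<bar> powr 1" using powr_add by blast
    thus ?thesis using x1[of i] x0[of i] by simp
  qed simp
  have bd: "(\<Sum>i<m. \<bar>x i\<bar> powr p) \<le> (K powr (1 / (p - 1))) powr p" for m
  proof -
    \<comment> \<open>The extremal test vector: \<open>L w = S w = N w powr p\<close>, so the bound
      \<open>K * N w\<close> limits \<open>N w\<close> independently of \<open>m\<close>.\<close>
    define w where "w i = (if i < m then sgn (a i) * x i else 0)" for i
    have wf: "\<bar>w i\<bar> = (if i < m then x i else 0)" for i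
      by (cases "a i = 0") (auto simp: w_def x_def abs_mult abs_sgn_eq)
    have wV: "w \<in> V" unfolding V_def mem_Collect_eq by (rule summable_finite[of "{..<m}"]) (auto simp: w_def)
    have "S w = (\<Sum>i<m. \<bar>w i\<bar> powr p)" unfolding S_def by (rule suminf_finite) (auto simp: w_def)
    also have "\<dots> = (\<Sum>i<m. \<bar>x i\<bar> powr p)" using wf x0 by (intro sum.cong) auto
    finally have Sw: "S w = (\<Sum>i<m. \<bar>x i\<bar> powr p)" .
    have "head m w = w" by (auto simp: head_def w_def)
    hence "L w = (\<Sum>i<m. w i * a i)" using bdd_lin_head[OF L, of m w] by (simp add: a_def)
    also have "\<dots> = S w" unfolding Sw
    proof (intro sum.cong refl)
      fix i assume "i \<in> {..<m}"
      thus "w i * a i = \<bar>x i\<bar> powr p" unfolding xp by (simp add: w_def abs_sgn[of "a i"])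
    qed
    finally have "S w \<le> K * N w" using K wV by force
    moreover have "S w = N w powr (p - 1) * N w"
    proof (cases "N w = 0")
      case True
      thus ?thesis using N_powr[OF wV] p by simp
    next
      case False
      hence "N w powr (p - 1 + 1) = N w powr (p - 1) * N w powr 1" using powr_add by blast
      thus ?thesis using N_powr[OF wV] N_nonneg'[of w] by simp
    qed
    ultimately have le: "N w powr (p - 1) * N w \<le> K * N w" by simp
    have "N w \<le> K powr (1 / (p - 1))"
    proof (cases "N w = 0")
      case False
      hence "N w > 0" using N_nonneg'[of w] by simp
      hence "N w powr (p - 1) \<le> K" using le by simp
      hence "(N w powr (p - 1)) powr (1 / (p - 1)) \<le> K powr (1 / (p - 1))" using p by (intro powr_mono2) auto
      thus ?thesis using p N_nonneg'[of w] by (simp add: powr_powr)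
    qed simp
    hence "N w powr p \<le> (K powr (1 / (p - 1))) powr p" using p N_nonneg' by (intro powr_mono2) auto
    thus ?thesis using N_powr[OF wV] Sw by simp
  qed
  have "summable (\<lambda>i. \<bar>x i\<bar> powr p)"
    by (rule summableI_nonneg_bounded[OF _ bd]) simp
  hence xV: "x \<in> V" by (simp add: V_def)
  define \<tau> where "\<tau> = e powr (1 / (p - 1))"
  have \<tau>: "\<tau> > 0" "\<tau> powr (p - 1) = e" using e p by (simp_all add: \<tau>_def powr_powr)
  obtain n where n: "N (tail n x) < \<tau>" using tail_small[OF xV \<tau>(1)] by blast
  have "\<bar>L (tail n v)\<bar> \<le> e * N v" if v: "v \<in> V" for v
  proof (rule bdd_lin_tail_limit[OF L tail_mem[OF v]])
    fix m
    have "\<bar>L (head m (tail n v))\<bar> = \<bar>\<Sum>i<m. tail n v i * a i\<bar>" using bdd_lin_head[OF L, of m "tail n v"] by (simp add: a_def)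
    also have "\<dots> \<le> (\<Sum>i<m. \<bar>tail n v i * a i\<bar>)" by (rule sum_abs)
    also have "\<dots> = (\<Sum>i<m. \<bar>tail n x i\<bar> powr (p - 1) * \<bar>v i\<bar>)"
      using x1 by (intro sum.cong) (auto simp: tail_def abs_mult)
    also have "\<dots> \<le> (\<Sum>i. \<bar>tail n x i\<bar> powr (p - 1) * \<bar>v i\<bar>)"
      by (rule sum_le_suminf[OF holder(1)[OF tail_mem[OF xV] v]]) auto
    also have "\<dots> \<le> N (tail n x) powr (p - 1) * N v" by (rule holder(2)[OF tail_mem[OF xV] v])
    also have "\<dots> \<le> \<tau> powr (p - 1) * N v"
      using n p N_nonneg' norm_nonneg[OF v] by (intro mult_right_mono powr_mono2) auto
    finally show "\<bar>L (head m (tail n v))\<bar> \<le> e * N v" using \<tau> by simp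
  qed
  thus ?thesis by blast
qed

text \<open>The \<open>p\<close>-norm of the tail with one additional entry \<open>(1/2)^n\<close>.
  The entry keeps the argument of the root positive, hence the root differentiable.\<close>

definition s :: "nat \<Rightarrow> (nat \<Rightarrow> real) \<Rightarrow> real" where
  "s n x = (((1/2) ^ n) powr p + S (tail n x)) powr (1 / p)"

definition ds :: "nat \<Rightarrow> (nat \<Rightarrow> real) \<Rightarrow> (nat \<Rightarrow> real) \<Rightarrow> real" where
  "ds n x v = (1 / p) * (((1/2) ^ n) powr p + S (tail n x)) powr (1 / p - 1) * dS (tail n x) (tail n v)"

lemma s_arg_pos: "x \<in> V \<Longrightarrow> 0 < ((1/2) ^ n) powr p + S (tail n x)"
  using S_nonneg[OF tail_mem, of x n] by (intro add_pos_nonneg) auto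

lemma lp_s_strict_deriv: assumes x: "x \<in> V" shows "strict_deriv (s n) (ds n x) x"
proof -
  have "strict_deriv (\<lambda>y. S (tail n y)) (\<lambda>v. dS (tail n x) (tail n v)) x"
    by (rule strict_deriv_compose[OF strict_deriv_map_linear[OF bdd_lin_map_tail] S_strict_deriv[OF tail_mem[OF x]] x])
  from strict_deriv_add[OF strict_deriv_const[of "((1/2) ^ n) powr p" x] this]
  have a: "strict_deriv (\<lambda>y. ((1/2) ^ n) powr p + S (tail n y)) (\<lambda>v. dS (tail n x) (tail n v)) x" by simp
  have "strict_deriv (\<lambda>y. (((1/2) ^ n) powr p + S (tail n y)) powr (1 / p))
    (\<lambda>v. (1 / p) * (((1/2) ^ n) powr p + S (tail n x)) powr (1 / p - 1) * dS (tail n x) (tail n v)) x"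
  proof (rule strict_deriv_deriv_compose[OF a x s_arg_pos[OF x], where G = "\<lambda>t. t powr (1 / p)" and G' = "\<lambda>t. (1 / p) * t powr (1 / p - 1)"])
    fix t assume "\<bar>t - (((1/2) ^ n) powr p + S (tail n x))\<bar> < ((1/2) ^ n) powr p + S (tail n x)"
    hence "t > 0" by linarith
    thus "((\<lambda>t. t powr (1 / p)) has_real_derivative (1 / p) * t powr (1 / p - 1)) (at t)"
      by (rule has_real_derivative_powr)
  next
    show "isCont (\<lambda>t. (1 / p) * t powr (1 / p - 1)) (((1/2) ^ n) powr p + S (tail n x))"
      using s_arg_pos[OF x, of n] by (intro continuous_intros) auto
  qed
  thus ?thesis by (simp add: s_def[abs_def] ds_def[abs_def])
qed

text \<open>Writing \<open>s n x\<close> literally as a norm, with the extra entry in position 0,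
  reduces its Lipschitz bound to the triangle inequality.\<close>

lemma s_as_norm: assumes x: "x \<in> V"
  shows "(\<lambda>i. case i of 0 \<Rightarrow> (1/2) ^ n | Suc j \<Rightarrow> tail n x j) \<in> V" "s n x = N (\<lambda>i. case i of 0 \<Rightarrow> (1/2) ^ n | Suc j \<Rightarrow> tail n x j)"
proof -
  let ?e = "\<lambda>i. case i of 0 \<Rightarrow> (1/2) ^ n | Suc j \<Rightarrow> tail n x j"
  have "summable (\<lambda>i. \<bar>?e (Suc i)\<bar> powr p)" using summ[OF tail_mem[OF x, of n]] by simp
  hence sm: "summable (\<lambda>i. \<bar>?e i\<bar> powr p)" by (subst (asm) summable_Suc_iff)
  thus "?e \<in> V" by (simp add: V_def)
  have "S ?e = (\<Sum>i. \<bar>?e (Suc i)\<bar> powr p) + \<bar>?e 0\<bar> powr p"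
    unfolding S_def using suminf_split_head[OF sm] by simp
  thus "s n x = N ?e" by (simp add: s_def N_def S_def add.commute)
qed

lemma lp_s_lip: assumes x: "x \<in> V" and y: "y \<in> V" shows "\<bar>s n x - s n y\<bar> \<le> N (tail n (x - y))"
proof -
  let ?e = "\<lambda>x i. case i of 0 \<Rightarrow> (1/2) ^ n | Suc j \<Rightarrow> tail n x j"
  have d: "x - y \<in> V" using x y by (rule diff_mem)
  let ?w = "\<lambda>i. case i of 0 \<Rightarrow> 0 | Suc j \<Rightarrow> tail n (x - y) j"
  have "summable (\<lambda>i. \<bar>?w (Suc i)\<bar> powr p)" using summ[OF tail_mem[OF d, of n]] by simp
  hence sm: "summable (\<lambda>i. \<bar>?w i\<bar> powr p)" by (subst (asm) summable_Suc_iff)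
  hence wV: "?w \<in> V" by (simp add: V_def)
  have "S ?w = (\<Sum>i. \<bar>?w (Suc i)\<bar> powr p) + \<bar>?w 0\<bar> powr p"
    unfolding S_def using suminf_split_head[OF sm] by simp
  hence Nw: "N ?w = N (tail n (x - y))" using p by (simp add: N_def S_def)
  have e: "?e x = ?e y + ?w" "?e y = ?e x + - ?w"
    by (auto simp: fun_eq_iff tail_def split: nat.splits)
  have "N (?e x) \<le> N (?e y) + N ?w" by (subst e(1)) (intro norm_add s_as_norm y wV)
  moreover have "N (?e y) \<le> N (?e x) + N (- ?w)" by (subst e(2)) (intro norm_add s_as_norm x wV uminus_mem)
  ultimately show ?thesis using s_as_norm(2)[OF x, of n] s_as_norm(2)[OF y, of n] Nw norm_uminus[OF wV] by simp
qed

lemma ds_unit: assumes x: "x \<in> V" shows "ds n x (unit_seq m) = (if n \<le> m then (((1/2) ^ n) powr p + S (tail n x)) powr (1 / p - 1) * J (x m) else 0)"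
proof (cases "n \<le> m")
  case True
  have "dS (tail n x) (tail n (unit_seq m)) = (\<Sum>i\<in>{m}. p * J (tail n x i) * tail n (unit_seq m) i)"
    unfolding dS_def by (rule suminf_finite) (auto simp: tail_def unit_seq_def)
  thus ?thesis using True p by (simp add: ds_def tail_def unit_seq_def)
next
  case False
  have "dS (tail n x) (tail n (unit_seq m)) = (\<Sum>i\<in>{}. p * J (tail n x i) * tail n (unit_seq m) i)"
    unfolding dS_def by (rule suminf_finite) (use False in \<open>auto simp: tail_def unit_seq_def\<close>)
  thus ?thesis using False by (simp add: ds_def)
qed

sublocale seq_space V N s ds
proof unfold_locales
  fix L :: "(nat \<Rightarrow> real) \<Rightarrow> real" and e :: real
  show "bdd_lin L \<Longrightarrow> e > 0 \<Longrightarrow> \<exists>n. \<forall>v\<in>V. \<bar>L (tail n v)\<bar> \<le> e * N v" by (rule lp_dual)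
next
  fix x y :: "nat \<Rightarrow> real" and n i :: nat
  assume x: "x \<in> V"
  show "strict_deriv (s n) (ds n x) x" using x by (rule lp_s_strict_deriv)
  have "\<bar>(\<lambda>i. case i of 0 \<Rightarrow> (1/2) ^ n | Suc j \<Rightarrow> tail n x j) 0\<bar> \<le> s n x"
    unfolding s_as_norm(2)[OF x] by (rule coord[OF s_as_norm(1)[OF x]])
  thus "(1/2) ^ n \<le> s n x" by simp
  show "N (tail n x) \<le> s n x" unfolding s_def N_def using S_nonneg[OF tail_mem[OF x]] p by (intro powr_mono2) auto
  have "tail n 0 = 0" "tail n (x - 0) = tail n x" by (auto simp: tail_def)
  moreover have "S 0 = 0" by (simp add: S_def)
  ultimately have "s n 0 = (1/2) ^ n" "\<bar>s n x - s n 0\<bar> \<le> N (tail n x)"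
    using lp_s_lip[OF x zero_mem, of n] p by (simp_all add: s_def powr_powr)
  thus "s n x \<le> 4 * (1/2) ^ n + N (tail n x)" using zero_le_power[of "1/2 :: real" n] by linarith
  { assume y: "y \<in> V"
    show "\<bar>s n x - s n y\<bar> \<le> N (x - y)"
      using lp_s_lip[OF x y, of n] norm_tail[of "x - y" n] x y by (force simp: diff_mem) }
  show "i < n \<Longrightarrow> ds n x (unit_seq i) = 0" using ds_unit[OF x] by simp
  show "0 \<le> x n * ds n x (unit_seq n)" by (simp add: ds_unit[OF x] J_def sgn_if zero_le_mult_iff)
next
  fix t :: real and n assume t: "t > 0"
  define C where "C = (((1/2) ^ n) powr p) powr (1 / p - 1)"
  have C: "C > 0" by (simp add: C_def)
  \<comment> \<open>The prefactor in \<open>ds_unit\<close> has a negative exponent, so it is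
    largest, namely \<open>C\<close>, for an empty tail; then
    \<open>C * c powr (p - 1) = t\<close>.\<close>
  define c where "c = (t / C) powr (1 / (p - 1))"
  have c: "c > 0" "c powr (p - 1) = t / C" using t C p by (simp_all add: c_def powr_powr)
  have "\<bar>ds n x (unit_seq n)\<bar> \<le> t" if x: "x \<in> V" "\<bar>x n\<bar> \<le> c" for x
  proof -
    have "(((1/2) ^ n) powr p + S (tail n x)) powr (1 / p - 1) \<le> C"
      unfolding C_def using p S_nonneg[OF tail_mem[OF x(1)], of n] by (intro powr_mono2') auto
    moreover have "\<bar>x n\<bar> powr (p - 1) \<le> c powr (p - 1)" using x p by (intro powr_mono2) auto
    ultimately have "(((1/2) ^ n) powr p + S (tail n x)) powr (1 / p - 1) * \<bar>x n\<bar> powr (p - 1) \<le> C * (t / C)"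
      using c C by (intro mult_mono) auto
    thus ?thesis using C by (simp add: ds_unit[OF x(1)] abs_mult abs_J)
  qed
  thus "\<exists>c>0. \<forall>x\<in>V. \<bar>x n\<bar> \<le> c \<longrightarrow> \<bar>ds n x (unit_seq n)\<bar> \<le> t" using c by blast
next
  fix x M assume x: "x \<in> V" "\<And>m. m \<ge> M \<Longrightarrow> 0 < x m"
  show "\<exists>a. (\<forall>m\<ge>M. 0 < a m) \<and> (\<forall>n. \<exists>M'. \<forall>m\<ge>M'. \<forall>m'\<ge>M'. a m' * ds n x (unit_seq m) = a m * ds n x (unit_seq m'))"
  \<comment> \<open>By \<open>ds_unit\<close> the factor in front of \<open>J (x m)\<close> is the
    same for all \<open>m \<ge> n\<close>.\<close>
  proof (intro exI[of _ "\<lambda>m. J (x m)"] conjI allI impI)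
    fix m assume "m \<ge> M" thus "0 < J (x m)" using x(2)[of m] by (simp add: J_def)
  next
    fix n
    show "\<exists>M'. \<forall>m\<ge>M'. \<forall>m'\<ge>M'. J (x m') * ds n x (unit_seq m) = J (x m) * ds n x (unit_seq m')"
      by (intro exI[of _ n]) (simp add: ds_unit[OF x(1)])
  qed
qed

end

section \<open>The space \<open>c\<^sub>0\<close>\<close>

definition c0V :: "(nat \<Rightarrow> real) set" where "c0V = {x. x \<longlonglongrightarrow> 0}"
definition c0N :: "(nat \<Rightarrow> real) \<Rightarrow> real" where "c0N x = (SUP n. \<bar>x n\<bar>)"

lemma c0_coord: "x \<in> c0V \<Longrightarrow> \<bar>x n\<bar> \<le> c0N x"
proof -
  assume "x \<in> c0V"
  hence "Bseq x" unfolding c0V_def by (auto intro: convergent_imp_Bseq convergentI)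
  then obtain K where "\<And>n. \<bar>x n\<bar> \<le> K" by (auto simp: Bseq_def)
  hence "bdd_above (range (\<lambda>n. \<bar>x n\<bar>))" by (intro bdd_aboveI[of _ K]) auto
  thus ?thesis unfolding c0N_def by (intro cSUP_upper) auto
qed

lemma c0N_le: "(\<And>n. \<bar>x n\<bar> \<le> b) \<Longrightarrow> c0N x \<le> b"
  unfolding c0N_def by (intro cSUP_least) auto

lemma c0_small: "x \<in> c0V \<Longrightarrow> e > 0 \<Longrightarrow> \<exists>n. \<forall>i\<ge>n. \<bar>x i\<bar> < e"
  unfolding c0V_def using LIMSEQ_D[of x 0 e] by auto

interpretation c0: seq_lattice c0V c0N
proof unfold_locales
  fix u v :: "nat \<Rightarrow> real" and b :: real and n :: nat
  { assume u: "u \<in> c0V" and v: "v \<in> c0V"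
    show "u + v \<in> c0V" using tendsto_add[of u 0 _ v 0] u v by (simp add: c0V_def plus_fun_def)
    show "c0N (u + v) \<le> c0N u + c0N v"
    proof (rule c0N_le)
      fix n show "\<bar>(u + v) n\<bar> \<le> c0N u + c0N v" using c0_coord[OF u, of n] c0_coord[OF v, of n] by simp
    qed }
  show "u \<in> c0V \<Longrightarrow> \<bar>u n\<bar> \<le> c0N u" by (rule c0_coord)
  { assume u: "u \<in> c0V"
    have sc: "scl b u \<in> c0V" for b using tendsto_mult_right_zero[of u sequentially b] u by (simp add: c0V_def scl_def)
    show "scl b u \<in> c0V" by (rule sc)
    have le: "c0N (scl b u) \<le> \<bar>b\<bar> * c0N u" for b
      by (rule c0N_le) (simp add: abs_mult mult_left_mono c0_coord[OF u])
    have pos: "0 \<le> c0N (scl b u)" using c0_coord[OF sc[of b], of 0] by linarith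
    have "\<bar>b\<bar> * c0N u \<le> c0N (scl b u)"
    proof (cases "b = 0")
      case False
      have "c0N u \<le> c0N (scl b u) / \<bar>b\<bar>"
      proof (rule c0N_le)
        fix n show "\<bar>u n\<bar> \<le> c0N (scl b u) / \<bar>b\<bar>"
          using c0_coord[OF sc[of b], of n] False by (simp add: abs_mult field_simps)
      qed
      thus ?thesis using False by (simp add: field_simps)
    qed (use pos in simp)
    thus "c0N (scl b u) = \<bar>b\<bar> * c0N u" using le[of b] by linarith }
  { assume v: "v \<in> c0V" and le: "\<And>n. \<bar>u n\<bar> \<le> \<bar>v n\<bar>"
    have "u \<longlonglongrightarrow> 0"
      by (rule Lim_null_comparison[of _ "\<lambda>n. \<bar>v n\<bar>"]) (use v le in \<open>auto simp: c0V_def intro: tendsto_rabs_zero\<close>)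
    moreover have "c0N u \<le> c0N v" using le c0_coord[OF v] by (intro c0N_le) (meson order_trans)
    ultimately show "u \<in> c0V \<and> c0N u \<le> c0N v" by (simp add: c0V_def) }
  { assume s: "summable (\<lambda>n. \<bar>u n\<bar>)"
    have "u \<in> c0V" using summable_LIMSEQ_zero[OF s] by (simp add: c0V_def tendsto_rabs_zero_iff)
    moreover have "c0N u \<le> (\<Sum>n. \<bar>u n\<bar>)"
    proof (rule c0N_le)
      fix n show "\<bar>u n\<bar> \<le> (\<Sum>n. \<bar>u n\<bar>)" using sum_le_suminf[OF s, of "{n}"] by simp
    qed
    ultimately show "u \<in> c0V \<and> c0N u \<le> (\<Sum>n. \<bar>u n\<bar>)" by simp }
  { fix e :: real assume u: "u \<in> c0V" and e: "e > 0"
    then obtain n where n: "\<forall>i\<ge>n. \<bar>u i\<bar> < e / 2" using c0_small[of u "e/2"] by auto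
    have "c0N (tail n u) \<le> e / 2" using n e by (intro c0N_le) (auto simp: tail_def intro: less_imp_le)
    thus "\<exists>n. c0N (tail n u) < e" using e by (intro exI[of _ n]) simp }
qed

section \<open>Iterated smooth maxima\<close>

lemma quad_deriv_DERIV:
  assumes "quad_deriv K G G'" shows "(G has_real_derivative G' t) (at t)"
proof -
  have "((\<lambda>h. (G (t + h) - G t) / h - G' t) \<longlongrightarrow> 0) (at 0)"
  proof (rule Lim_null_comparison)
    show "((\<lambda>h. K * \<bar>h\<bar>) \<longlongrightarrow> 0) (at (0::real))" by (auto intro!: tendsto_eq_intros)
    have "norm ((G (t + h) - G t) / h - G' t) \<le> K * \<bar>h\<bar>" if "h \<noteq> 0" for h
    proof -
      have "\<bar>G (t + h) - G t - G' t * h\<bar> \<le> K * \<bar>h\<bar> * \<bar>h\<bar>" using quad_derivD[OF assms, of "t + h" t t] by simp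
      moreover have "(G (t + h) - G t) / h - G' t = (G (t + h) - G t - G' t * h) / h" using that by (simp add: field_simps)
      ultimately show ?thesis using that by (simp add: field_simps)
    qed
    thus "\<forall>\<^sub>F h in at 0. norm ((G (t + h) - G t) / h - G' t) \<le> K * \<bar>h\<bar>"
      by (simp add: eventually_at_filter)
  qed
  thus ?thesis unfolding DERIV_def by (simp add: LIM_zero_iff)
qed

text \<open>\<open>soft_pos \<delta>\<close> is a \<open>C\<^sup>1\<close> version of \<open>max 0\<close>, equal to it outside \<open>(-\<delta>, \<delta>)\<close>. Hence
  \<open>a + soft_pos \<delta> (b - a)\<close> is a smooth maximum of \<open>a\<close> and \<open>b\<close> which does not see \<open>b\<close> when
  \<open>b \<le> a - \<delta>\<close>; iterating it over all coordinates gives functions on \<open>c\<^sub>0\<close> that depend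
  locally on finitely many coordinates.\<close>

definition soft_pos :: "real \<Rightarrow> real \<Rightarrow> real" where
  "soft_pos \<delta> t = (1 / (4 * \<delta>)) * pos2 (t + \<delta>) + (- 1 / (4 * \<delta>)) * pos2 (t + - \<delta>)"

definition soft_pos' :: "real \<Rightarrow> real \<Rightarrow> real" where
  "soft_pos' \<delta> t = (1 / (4 * \<delta>)) * (2 * max 0 (t + \<delta>)) + (- 1 / (4 * \<delta>)) * (2 * max 0 (t + - \<delta>))"

lemma quad_deriv_gam: "quad_deriv (\<bar>1 / (4 * \<delta>)\<bar> * 2 + \<bar>- 1 / (4 * \<delta>)\<bar> * 2) (soft_pos \<delta>) (soft_pos' \<delta>)"
  unfolding soft_pos_def[abs_def] soft_pos'_def[abs_def]
  by (intro quad_deriv_add quad_deriv_cmult quad_deriv_shift[of _ pos2 "\<lambda>t. 2 * max 0 t"] quad_deriv_pos2)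

lemma soft_pos_eq_0: "\<delta> > 0 \<Longrightarrow> t \<le> - \<delta> \<Longrightarrow> soft_pos \<delta> t = 0" "\<delta> > 0 \<Longrightarrow> t \<le> - \<delta> \<Longrightarrow> soft_pos' \<delta> t = 0"
  by (simp_all add: soft_pos_def soft_pos'_def pos2_def)

lemma soft_pos'_bounds: "\<delta> > 0 \<Longrightarrow> 0 \<le> soft_pos' \<delta> t" "\<delta> > 0 \<Longrightarrow> soft_pos' \<delta> t \<le> 1"
  by (auto simp: soft_pos'_def max_def field_simps)

lemma soft_pos_lip: assumes "\<delta> > 0" "a \<le> b" shows "soft_pos \<delta> a \<le> soft_pos \<delta> b" "soft_pos \<delta> b - soft_pos \<delta> a \<le> b - a"
proof -
  have "soft_pos \<delta> a \<le> soft_pos \<delta> b \<and> soft_pos \<delta> b - soft_pos \<delta> a \<le> b - a"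
  proof (cases "a = b")
    case False
    hence "a < b" using assms by simp
    then obtain z where "soft_pos \<delta> b - soft_pos \<delta> a = (b - a) * soft_pos' \<delta> z"
      using MVT2[of a b "soft_pos \<delta>" "soft_pos' \<delta>"] quad_deriv_DERIV[OF quad_deriv_gam] by blast
    moreover have "0 \<le> (b - a) * soft_pos' \<delta> z" "(b - a) * soft_pos' \<delta> z \<le> (b - a) * 1"
      using soft_pos'_bounds[OF assms(1), of z] assms(2)
      by (auto intro!: mult_nonneg_nonneg simp del: mult_1_right) (intro mult_left_mono, auto)
    ultimately show ?thesis by simp
  qed simp
  thus "soft_pos \<delta> a \<le> soft_pos \<delta> b" "soft_pos \<delta> b - soft_pos \<delta> a \<le> b - a" by auto
qed

lemma soft_pos_bounds: assumes d: "\<delta> > 0" shows "0 \<le> soft_pos \<delta> t" "t \<le> soft_pos \<delta> t" "soft_pos \<delta> t \<le> max 0 t + \<delta>"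
proof -
  have z: "soft_pos \<delta> (- \<delta>) = 0" using soft_pos_eq_0[OF d] by simp
  have big: "soft_pos \<delta> s = s" if "s \<ge> \<delta>" for s
    using that d by (simp add: soft_pos_def pos2_def power2_eq_square field_simps)
  show 0: "0 \<le> soft_pos \<delta> t" for t
    using soft_pos_eq_0[OF d, of t] soft_pos_lip(1)[OF d, of "- \<delta>" t] z by (cases "t \<le> - \<delta>") auto
  show "t \<le> soft_pos \<delta> t" using big[of t] big[of \<delta>] soft_pos_lip(2)[OF d, of t \<delta>] by (cases "t \<ge> \<delta>") auto
  show "soft_pos \<delta> t \<le> max 0 t + \<delta>"
    using soft_pos_eq_0[OF d, of t] soft_pos_lip(2)[OF d, of "- \<delta>" t] z d by (cases "t \<le> - \<delta>") auto
qed

text \<open>The start value \<open>2 * (1/2)^n\<close> hides all coordinates below about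
  \<open>(1/2)^n\<close>, and the smoothing widths add up to at most \<open>(1/2)^n\<close>. Both
  \<open>x\<close> and \<open>-x\<close> are fed in to avoid the kink of the absolute value.\<close>

primrec iter_max :: "nat \<Rightarrow> nat \<Rightarrow> (nat \<Rightarrow> real) \<Rightarrow> real" where
  "iter_max n 0 x = 2 * (1/2) ^ n"
| "iter_max n (Suc j) x = iter_max n j x + (soft_pos ((1/2) ^ (n + j + 1)) (x (n + j) - iter_max n j x) +
     soft_pos ((1/2) ^ (n + j + 1)) (0 - x (n + j) - iter_max n j x))"

primrec diter_max :: "nat \<Rightarrow> nat \<Rightarrow> (nat \<Rightarrow> real) \<Rightarrow> (nat \<Rightarrow> real) \<Rightarrow> real" where
  "diter_max n 0 x v = 0"
| "diter_max n (Suc j) x v = diter_max n j x v +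
     (soft_pos' ((1/2) ^ (n + j + 1)) (x (n + j) - iter_max n j x) * (v (n + j) - diter_max n j x v) +
      soft_pos' ((1/2) ^ (n + j + 1)) (0 - x (n + j) - iter_max n j x) * (0 - v (n + j) - diter_max n j x v))"

lemma delta_pos: "(0::real) < (1/2) ^ (n + j + 1)" by simp

lemma delta_le: "(1/2::real) ^ (n + j + 1) \<le> (1/2) ^ n / 2"
proof -
  have "(1/2::real) ^ (n + j + 1) \<le> (1/2) ^ (n + 1)" by (intro power_decreasing) auto
  thus ?thesis by simp
qed

lemma iter_max_ge: "2 * (1/2) ^ n \<le> iter_max n j x"
proof (induction j)
  case (Suc j)
  thus ?case using soft_pos_bounds(1)[OF delta_pos, of n j] by (simp del: power_Suc add: add_increasing2)
qed simp

text \<open>The running value is never below the smoothing width, so the term with argument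
  \<open>- \<bar>x (n + j)\<bar>\<close> vanishes and only one of the two signs is seen.\<close>

lemma iter_max_step: "iter_max n (Suc j) x = iter_max n j x + soft_pos ((1/2) ^ (n + j + 1)) (\<bar>x (n + j)\<bar> - iter_max n j x)"
proof -
  have "(1/2) ^ (n + j + 1) \<le> iter_max n j x" using iter_max_ge[of n j x] delta_le[of n j] zero_le_power[of "1/2::real" n] by linarith
  hence "soft_pos ((1/2) ^ (n + j + 1)) (- \<bar>x (n + j)\<bar> - iter_max n j x) = 0" by (intro soft_pos_eq_0(1) delta_pos) simp
  thus ?thesis unfolding iter_max.simps by (cases "x (n + j) \<ge> 0") simp_all
qed

lemma iter_max_mono: "i \<le> j \<Longrightarrow> iter_max n i x \<le> iter_max n j x"
proof (induction j rule: dec_induct)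
  case (step j)
  thus ?case using soft_pos_bounds(1)[OF delta_pos, of n j "\<bar>x (n + j)\<bar> - iter_max n j x"] unfolding iter_max_step by linarith
qed simp

lemma coord_le_mu: "\<bar>x (n + j)\<bar> \<le> iter_max n (Suc j) x"
  using soft_pos_bounds(2)[OF delta_pos, of "\<bar>x (n + j)\<bar> - iter_max n j x" n j] unfolding iter_max_step by linarith

lemma iter_max_le:
  assumes "\<And>i. n \<le> i \<Longrightarrow> \<bar>x i\<bar> \<le> B" "B \<ge> 0"
  shows "iter_max n j x \<le> 2 * (1/2) ^ n + B + (1/2) ^ n * (1 - (1/2) ^ j)"
proof (induction j)
  case (Suc j)
  have e: "(1/2::real) ^ (n + j + 1) = (1/2) ^ n * (1/2) ^ j / 2" by (simp add: power_add)
  have "iter_max n (Suc j) x \<le> max (iter_max n j x) \<bar>x (n + j)\<bar> + (1/2) ^ (n + j + 1)"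
    using soft_pos_bounds(3)[OF delta_pos, of n j "\<bar>x (n + j)\<bar> - iter_max n j x"] unfolding iter_max_step by (simp add: max_def split: if_splits)
  also have "max (iter_max n j x) \<bar>x (n + j)\<bar> \<le> 2 * (1/2) ^ n + B + (1/2) ^ n * (1 - (1/2) ^ j)"
  proof -
    have "0 \<le> (1/2::real) ^ n * (1 - (1/2) ^ j)" by (simp add: power_le_one)
    moreover have "(0::real) \<le> (1/2) ^ n" by simp
    ultimately have "\<bar>x (n + j)\<bar> \<le> 2 * (1/2) ^ n + B + (1/2) ^ n * (1 - (1/2) ^ j)" using assms(1)[of "n + j"] by linarith
    thus ?thesis using Suc by simp
  qed
  finally show ?case unfolding e by (simp add: algebra_simps)
qed (use assms in simp)

text \<open>Because \<open>soft_pos\<close> has slope between 0 and 1,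
  \<open>a + soft_pos \<delta> (b - a)\<close> increases in both arguments and moves with a common
  shift. Such a function is nonexpansive for the maximum distance.\<close>

lemma iter_max_lip:
  assumes "\<And>i. n \<le> i \<Longrightarrow> \<bar>x i - y i\<bar> \<le> D" "D \<ge> 0"
  shows "\<bar>iter_max n j x - iter_max n j y\<bar> \<le> D"
proof (induction j)
  case (Suc j)
  define \<delta> where "\<delta> = (1/2::real) ^ (n + j + 1)"
  have d: "\<delta> > 0" by (simp add: \<delta>_def)
  have le: "a + soft_pos \<delta> (b - a) \<le> a' + soft_pos \<delta> (b' - a') + D" if "a \<le> a' + D" "b \<le> b' + D" for a b a' b' :: real
  proof -
    have "soft_pos \<delta> (b - a) \<le> soft_pos \<delta> (b' + D - a)" using that by (intro soft_pos_lip d) simp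
    moreover have "soft_pos \<delta> (b' + D - a) - soft_pos \<delta> (b' - a') \<le> (b' + D - a) - (b' - a')"
      using that by (intro soft_pos_lip d) simp
    ultimately show ?thesis by linarith
  qed
  have b: "\<bar>\<bar>x (n + j)\<bar> - \<bar>y (n + j)\<bar>\<bar> \<le> D" using assms(1)[of "n + j"] by linarith
  have s: "iter_max n j x \<le> iter_max n j y + D" "iter_max n j y \<le> iter_max n j x + D"
    "\<bar>x (n + j)\<bar> \<le> \<bar>y (n + j)\<bar> + D" "\<bar>y (n + j)\<bar> \<le> \<bar>x (n + j)\<bar> + D"
    using Suc b by linarith+
  show ?case unfolding iter_max_step \<delta>_def[symmetric]
    using le[OF s(1,3)] le[OF s(2,4)] unfolding abs_le_iff by linarith
qed (use assms in simp)

lemma iter_max_strict_deriv: assumes x: "x \<in> c0V" shows "c0.strict_deriv (iter_max n j) (diter_max n j x) x"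
proof (induction j)
  case 0
  show ?case using c0.strict_deriv_const[of "2 * (1/2) ^ n :: real" x] by simp
next
  case (Suc j)
  have 1: "c0.strict_deriv (\<lambda>y. y (n + j) - iter_max n j y) (\<lambda>v. v (n + j) - diter_max n j x v) x"
    by (rule c0.strict_deriv_diff[OF c0.strict_deriv_coord Suc])
  have 2: "c0.strict_deriv (\<lambda>y. 0 - y (n + j) - iter_max n j y) (\<lambda>v. 0 - v (n + j) - diter_max n j x v) x"
    by (rule c0.strict_deriv_diff[OF c0.strict_deriv_diff[OF c0.strict_deriv_const c0.strict_deriv_coord] Suc])
  show ?case unfolding iter_max.simps diter_max.simps
    by (rule c0.strict_deriv_add[OF Suc c0.strict_deriv_add[OF c0.strict_deriv_real_compose[OF 1 x quad_deriv_strict[OF quad_deriv_gam]]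
        c0.strict_deriv_real_compose[OF 2 x quad_deriv_strict[OF quad_deriv_gam]]]])
qed

text \<open>\<open>5/4\<close> plus the smoothing width, at most \<open>1/2\<close> in units of
  \<open>(1/2)^n\<close>, stays below the start value 2, so the coordinate is not noticed at
  all.\<close>

lemma iter_max_stable_step:
  assumes "\<bar>y (n + j)\<bar> \<le> 5/4 * (1/2) ^ n"
  shows "iter_max n (Suc j) y = iter_max n j y" "diter_max n (Suc j) y v = diter_max n j y v"
proof -
  have "\<bar>y (n + j)\<bar> - iter_max n j y \<le> - ((1/2) ^ (n + j + 1))"
    using assms iter_max_ge[of n j y] delta_le[of n j] zero_le_power[of "1/2::real" n] by linarith
  hence a: "y (n + j) - iter_max n j y \<le> - ((1/2) ^ (n + j + 1))" "0 - y (n + j) - iter_max n j y \<le> - ((1/2) ^ (n + j + 1))" by linarith+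
  show "iter_max n (Suc j) y = iter_max n j y" "diter_max n (Suc j) y v = diter_max n j y v"
    unfolding iter_max.simps diter_max.simps soft_pos_eq_0[OF delta_pos a(1)] soft_pos_eq_0[OF delta_pos a(2)] by simp_all
qed

lemma iter_max_stable:
  assumes "\<And>i. i \<ge> m \<Longrightarrow> \<bar>y i\<bar> \<le> 5/4 * (1/2) ^ n" "m \<le> j"
  shows "iter_max n j y = iter_max n m y" "diter_max n j y v = diter_max n m y v"
proof -
  have "iter_max n j y = iter_max n m y \<and> diter_max n j y v = diter_max n m y v"
    using assms(2)
  proof (induction j rule: dec_induct)
    case (step j)
    have "\<bar>y (n + j)\<bar> \<le> 5/4 * (1/2) ^ n" using assms(1)[of "n + j"] step by simp
    thus ?case using iter_max_stable_step(1)[of y n j] iter_max_stable_step(2)[of y n j v] step by simp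
  qed simp
  thus "iter_max n j y = iter_max n m y" "diter_max n j y v = diter_max n m y v" by auto
qed

text \<open>On null sequences the iteration becomes stationary, with an index common to a whole
  ball; the limit is thus locally one of the finite stages and inherits its derivative.\<close>

definition c0s :: "nat \<Rightarrow> (nat \<Rightarrow> real) \<Rightarrow> real" where "c0s n x = lim (\<lambda>j. iter_max n j x)"
definition c0ds :: "nat \<Rightarrow> (nat \<Rightarrow> real) \<Rightarrow> (nat \<Rightarrow> real) \<Rightarrow> real" where "c0ds n x v = lim (\<lambda>j. diter_max n j x v)"

lemma c0s_eq:
  assumes "\<And>i. i \<ge> m \<Longrightarrow> \<bar>y i\<bar> \<le> 5/4 * (1/2) ^ n"
  shows "c0s n y = iter_max n m y" "c0ds n y v = diter_max n m y v"
proof -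
  have "(\<lambda>j. iter_max n j y) \<longlonglongrightarrow> iter_max n m y"
    by (rule tendsto_eventually, rule eventually_sequentiallyI, rule iter_max_stable(1)[OF assms])
  moreover have "(\<lambda>j. diter_max n j y v) \<longlonglongrightarrow> diter_max n m y v"
    by (rule tendsto_eventually, rule eventually_sequentiallyI, rule iter_max_stable(2)[OF assms])
  ultimately show "c0s n y = iter_max n m y" "c0ds n y v = diter_max n m y v" unfolding c0s_def c0ds_def by (simp_all only: limI)
qed

text \<open>The gap between 1 and 5/4 absorbs a perturbation of size \<open>1/4\<close> in units of
  \<open>(1/2)^n\<close>.\<close>

lemma c0_local:
  assumes x: "x \<in> c0V"
  shows "\<exists>m. \<forall>y\<in>c0V. c0N (y - x) < (1/2) ^ n / 4 \<longrightarrow> (\<forall>i\<ge>m. \<bar>y i\<bar> \<le> 5/4 * (1/2) ^ n)"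
proof -
  obtain m where m: "\<forall>i\<ge>m. \<bar>x i\<bar> < (1/2) ^ n" using c0_small[OF x, of "(1/2) ^ n"] by auto
  have "\<bar>y i\<bar> \<le> 5/4 * (1/2) ^ n" if "y \<in> c0V" "c0N (y - x) < (1/2) ^ n / 4" "i \<ge> m" for y i
  proof -
    have "\<bar>y i - x i\<bar> \<le> c0N (y - x)" using c0_coord[OF c0.diff_mem[OF that(1) x], of i] by simp
    moreover have "\<bar>x i\<bar> < (1/2) ^ n" using m that(3) by blast
    ultimately show ?thesis using that(2) by linarith
  qed
  thus ?thesis by blast
qed

lemma c0s_ex:
  assumes x: "x \<in> c0V"
  obtains m where "\<And>i. i \<ge> m \<Longrightarrow> \<bar>x i\<bar> \<le> 5/4 * (1/2) ^ n" "\<And>j. j \<ge> m \<Longrightarrow> c0s n x = iter_max n j x"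
    "\<And>j v. j \<ge> m \<Longrightarrow> c0ds n x v = diter_max n j x v"
proof -
  obtain m where m: "\<forall>i\<ge>m. \<bar>x i\<bar> \<le> 5/4 * (1/2) ^ n"
    using c0_local[OF x, of n] x by (auto dest!: bspec[OF _ x])
  show thesis
  proof (rule that[of m])
    fix j v assume j: "j \<ge> m"
    have a: "\<And>i. i \<ge> j \<Longrightarrow> \<bar>x i\<bar> \<le> 5/4 * (1/2) ^ n" using m j by auto
    show "c0s n x = iter_max n j x" "c0ds n x v = diter_max n j x v" using c0s_eq[OF a] by auto
  qed (use m in blast)
qed

lemma c0s_strict_deriv: assumes x: "x \<in> c0V" shows "c0.strict_deriv (c0s n) (c0ds n x) x"
proof -
  obtain m where m: "\<And>y i. y \<in> c0V \<Longrightarrow> c0N (y - x) < (1/2) ^ n / 4 \<Longrightarrow> i \<ge> m \<Longrightarrow> \<bar>y i\<bar> \<le> 5/4 * (1/2) ^ n"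
    using c0_local[OF x, of n] by blast
  have "c0.strict_deriv (c0s n) (diter_max n m x) x"
    by (rule c0.strict_deriv_local[OF iter_max_strict_deriv[OF x, of n m], of "(1/2) ^ n / 4"]) (use c0s_eq(1)[OF m] in auto)
  moreover have "c0ds n x v = diter_max n m x v" for v by (rule c0s_eq(2)[OF m[OF x]]) simp_all
  ultimately show ?thesis using c0.strict_deriv_cong by blast
qed

text \<open>Sign vectors of finite length have norm at most 1, so the coefficients of
  \<open>L\<close> are absolutely summable; the tail of that series bounds \<open>L\<close> on
  tails.\<close>

lemma c0_dual:
  fixes L :: "(nat \<Rightarrow> real) \<Rightarrow> real"
  assumes L: "c0.bdd_lin L" and e: "e > 0"
  shows "\<exists>n. \<forall>v\<in>c0V. \<bar>L (tail n v)\<bar> \<le> e * c0N v"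
proof -
  obtain K where K: "K > 0" "\<forall>u\<in>c0V. norm (L u) \<le> K * c0N u" using c0.bdd_lin_bound[OF L] by blast
  define a where "a i = L (unit_seq i)" for i
  have bd: "(\<Sum>i<m. \<bar>a i\<bar>) \<le> K" for m
  proof -
    define w where "w i = (if i < m then sgn (a i) else 0)" for i
    have "summable (\<lambda>i. \<bar>w i\<bar>)" by (rule summable_finite[of "{..<m}"]) (auto simp: w_def)
    hence wV: "w \<in> c0V" using c0.summable_mem by blast
    have wN: "c0N w \<le> 1" by (rule c0N_le) (auto simp: w_def sgn_if)
    have "head m w = w" by (auto simp: head_def w_def)
    hence "L w = (\<Sum>i<m. w i * a i)" using c0.bdd_lin_head[OF L, of m w] by (simp add: a_def)
    also have "\<dots> = (\<Sum>i<m. \<bar>a i\<bar>)"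
    proof (intro sum.cong refl)
      fix i assume "i \<in> {..<m}"
      thus "w i * a i = \<bar>a i\<bar>" by (simp add: w_def sgn_if)
    qed
    finally have "(\<Sum>i<m. \<bar>a i\<bar>) \<le> K * c0N w" using K wV by force
    also have "\<dots> \<le> K * 1" using wN K by (intro mult_left_mono) auto
    finally show ?thesis by simp
  qed
  have sa: "summable (\<lambda>i. \<bar>a i\<bar>)" by (rule summableI_nonneg_bounded[OF _ bd]) simp
  obtain n where n: "norm (\<Sum>i. \<bar>a (i + n)\<bar>) < e" using suminf_exist_split[OF e sa] by blast
  have st: "summable (\<lambda>i. \<bar>tail n a i\<bar>)"
    by (rule summable_comparison_test[OF _ sa]) (auto simp: tail_def)
  have "(\<Sum>i. \<bar>tail n a i\<bar>) = (\<Sum>i. \<bar>a (i + n)\<bar>)"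
    using suminf_split_initial_segment[OF st, of n] by (simp add: tail_def)
  hence te: "(\<Sum>i. \<bar>tail n a i\<bar>) \<le> e" using n by simp
  have "\<bar>L (tail n v)\<bar> \<le> e * c0N v" if v: "v \<in> c0V" for v
  proof (rule c0.bdd_lin_tail_limit[OF L c0.tail_mem[OF v]])
    fix m
    have n0: "0 \<le> c0N v" using c0.norm_nonneg[OF v] .
    have "\<bar>L (head m (tail n v))\<bar> = \<bar>\<Sum>i<m. tail n v i * a i\<bar>" using c0.bdd_lin_head[OF L, of m "tail n v"] by (simp add: a_def)
    also have "\<dots> \<le> (\<Sum>i<m. \<bar>tail n v i * a i\<bar>)" by (rule sum_abs)
    also have "\<dots> \<le> (\<Sum>i<m. \<bar>tail n a i\<bar> * c0N v)"
    proof (rule sum_mono)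
      fix i
      have "\<bar>a i\<bar> * \<bar>v i\<bar> \<le> \<bar>a i\<bar> * c0N v" by (rule mult_left_mono[OF c0_coord[OF v]]) simp
      thus "\<bar>tail n v i * a i\<bar> \<le> \<bar>tail n a i\<bar> * c0N v"
        by (cases "n \<le> i") (simp_all add: tail_def abs_mult mult.commute[of _ "\<bar>a i\<bar>"])
    qed
    also have "\<dots> = (\<Sum>i<m. \<bar>tail n a i\<bar>) * c0N v" by (simp add: sum_distrib_right)
    also have "\<dots> \<le> e * c0N v"
      using sum_le_suminf[OF st, of "{..<m}"] te n0 by (intro mult_right_mono) auto
    finally show "\<bar>L (head m (tail n v))\<bar> \<le> e * c0N v" .
  qed
  thus ?thesis by blast
qed

lemma diter_max_unit_head: "i < n \<Longrightarrow> diter_max n j x (unit_seq i) = 0"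
  by (induction j) (simp_all add: unit_seq_def)

lemma diter_max_unit_far: "(\<And>l. l \<ge> m \<Longrightarrow> \<bar>x l\<bar> \<le> 5/4 * (1/2) ^ n) \<Longrightarrow> i \<ge> n + m \<Longrightarrow> diter_max n m x (unit_seq i) = 0"
proof -
  assume i: "i \<ge> n + m"
  have "diter_max n j x (unit_seq i) = 0" if "j \<le> m" for j
    using that by (induction j) (use i in \<open>simp_all add: unit_seq_def\<close>)
  thus ?thesis by simp
qed

text \<open>Step 0 creates this partial derivative with the sign of \<open>x n\<close>, or leaves it
  0 if \<open>x n\<close> is small. Every later step multiplies it by \<open>1 - g j - h j\<close>,
  which is nonnegative as at most one of \<open>g j\<close>, \<open>h j\<close> is nonzero.\<close>

lemma diter_max_unit_self:
  "0 \<le> x n * diter_max n j x (unit_seq n)" "\<bar>x n\<bar> \<le> 5/4 * (1/2) ^ n \<Longrightarrow> diter_max n j x (unit_seq n) = 0"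
proof -
  define g h where "g j = soft_pos' ((1/2) ^ (n + j + 1)) (x (n + j) - iter_max n j x)"
    and "h j = soft_pos' ((1/2) ^ (n + j + 1)) (0 - x (n + j) - iter_max n j x)" for j
  have gh: "0 \<le> g j" "g j \<le> 1" "0 \<le> h j" "h j \<le> 1" for j
    unfolding g_def h_def by (intro soft_pos'_bounds delta_pos)+
  have small: "(1/2) ^ (n + j + 1) \<le> iter_max n j x" for j
    using iter_max_ge[of n j x] delta_le[of n j] zero_le_power[of "1/2::real" n] by linarith
  have g0: "g j = 0" if "x (n + j) \<le> 0" for j
    unfolding g_def using small[of j] that by (intro soft_pos_eq_0(2) delta_pos) simp
  have h0: "h j = 0" if "x (n + j) \<ge> 0" for j
    unfolding h_def using small[of j] that by (intro soft_pos_eq_0(2) delta_pos) simp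
  have st: "diter_max n (Suc j) x (unit_seq n) = diter_max n j x (unit_seq n) * (1 - g j - h j)" if "j > 0" for j
    unfolding diter_max.simps g_def[symmetric] h_def[symmetric] using that by (simp add: unit_seq_def algebra_simps)
  have 1: "diter_max n (Suc 0) x (unit_seq n) = g 0 - h 0"
    unfolding diter_max.simps g_def[symmetric] h_def[symmetric] by (simp add: unit_seq_def)
  have f: "0 \<le> 1 - g j - h j" for j
    using gh[of j] g0[of j] h0[of j] by (cases "x (n + j) \<ge> 0") auto
  have "0 \<le> x n * diter_max n (Suc j) x (unit_seq n)" for j
  proof (induction j)
    case 0
    show ?case unfolding 1 using g0[of 0] h0[of 0] gh[of 0] by (cases "x n \<ge> 0") (auto simp: mult_nonpos_nonpos mult_nonpos_nonneg)
  next
    case (Suc j)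
    have "x n * diter_max n (Suc (Suc j)) x (unit_seq n) = (x n * diter_max n (Suc j) x (unit_seq n)) * (1 - g (Suc j) - h (Suc j))"
      using st[of "Suc j"] by (simp only: mult.assoc zero_less_Suc)
    thus ?case using Suc f[of "Suc j"] by (simp only: mult_nonneg_nonneg)
  qed
  thus "0 \<le> x n * diter_max n j x (unit_seq n)" by (cases j) simp_all
  assume a: "\<bar>x n\<bar> \<le> 5/4 * (1/2) ^ n"
  have "diter_max n (Suc j) x (unit_seq n) = 0" for j
  proof (induction j)
    case 0
    show ?case using iter_max_stable_step(2)[of x n 0 "unit_seq n"] a by simp
  next
    case (Suc j)
    thus ?case using st[of "Suc j"] by (simp only: mult_zero_left zero_less_Suc)
  qed
  thus "diter_max n j x (unit_seq n) = 0" by (cases j) simp_all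
qed

interpretation c0: seq_space c0V c0N c0s c0ds
proof unfold_locales
  fix L :: "(nat \<Rightarrow> real) \<Rightarrow> real" and e :: real
  show "c0.bdd_lin L \<Longrightarrow> e > 0 \<Longrightarrow> \<exists>n. \<forall>v\<in>c0V. \<bar>L (tail n v)\<bar> \<le> e * c0N v" by (rule c0_dual)
next
  fix x y :: "nat \<Rightarrow> real" and n i :: nat
  assume x: "x \<in> c0V"
  show "c0.strict_deriv (c0s n) (c0ds n x) x" using x by (rule c0s_strict_deriv)
  obtain m where m: "\<And>i. i \<ge> m \<Longrightarrow> \<bar>x i\<bar> \<le> 5/4 * (1/2) ^ n" "\<And>j. j \<ge> m \<Longrightarrow> c0s n x = iter_max n j x"
    "\<And>j v. j \<ge> m \<Longrightarrow> c0ds n x v = diter_max n j x v" using c0s_ex[OF x, of n] by blast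
  have pw: "(0::real) \<le> (1/2) ^ n" by simp
  show "(1/2) ^ n \<le> c0s n x" using m(2)[OF order_refl] iter_max_ge[of n m x] pw by linarith
  show "c0N (tail n x) \<le> c0s n x"
  proof (rule c0N_le)
    fix i
    have s0: "0 \<le> c0s n x" using m(2)[OF order_refl] iter_max_ge[of n m x] pw by linarith
    show "\<bar>tail n x i\<bar> \<le> c0s n x"
    proof (cases "n \<le> i")
      case True
      then obtain j where j: "i = n + j" using le_Suc_ex by blast
      have "\<bar>x (n + j)\<bar> \<le> iter_max n (Suc j) x" by (rule coord_le_mu)
      also have "\<dots> \<le> iter_max n (max m (Suc j)) x" by (rule iter_max_mono) simp
      finally show ?thesis using m(2)[of "max m (Suc j)"] True by (simp add: tail_def j)
    qed (use s0 in \<open>simp add: tail_def\<close>)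
  qed
  show "c0s n x \<le> 4 * (1/2) ^ n + c0N (tail n x)"
  proof -
    have "\<bar>x i\<bar> \<le> c0N (tail n x)" if "n \<le> i" for i
      using c0_coord[OF c0.tail_mem[OF x], of n i] that by (simp add: tail_def)
    hence "iter_max n m x \<le> 2 * (1/2) ^ n + c0N (tail n x) + (1/2) ^ n * (1 - (1/2) ^ m)"
      using c0.norm_nonneg[OF c0.tail_mem[OF x]] by (intro iter_max_le) auto
    moreover have "(1/2::real) ^ n * (1 - (1/2) ^ m) \<le> (1/2) ^ n * 1" by (intro mult_left_mono) auto
    ultimately show ?thesis using m(2)[OF order_refl] pw by linarith
  qed
  { assume y: "y \<in> c0V"
    obtain m' where m': "\<And>i. i \<ge> m' \<Longrightarrow> \<bar>y i\<bar> \<le> 5/4 * (1/2) ^ n" "\<And>j. j \<ge> m' \<Longrightarrow> c0s n y = iter_max n j y"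
      "\<And>j v. j \<ge> m' \<Longrightarrow> c0ds n y v = diter_max n j y v" using c0s_ex[OF y, of n] by blast
    have d: "x - y \<in> c0V" using x y by (rule c0.diff_mem)
    have "\<bar>iter_max n (max m m') x - iter_max n (max m m') y\<bar> \<le> c0N (x - y)"
      using c0_coord[OF d] c0.norm_nonneg[OF d] by (intro iter_max_lip) auto
    thus "\<bar>c0s n x - c0s n y\<bar> \<le> c0N (x - y)" using m(2)[of "max m m'"] m'(2)[of "max m m'"] by simp }
  show "i < n \<Longrightarrow> c0ds n x (unit_seq i) = 0" using m(3)[of m] diter_max_unit_head by simp
  show "0 \<le> x n * c0ds n x (unit_seq n)" using m(3)[of m] diter_max_unit_self(1)[of x n m] by simp
next
  fix t :: real and n assume t: "t > 0"
  have "\<bar>c0ds n x (unit_seq n)\<bar> \<le> t" if x: "x \<in> c0V" and a: "\<bar>x n\<bar> \<le> (1/2) ^ n" for x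
  proof -
    obtain m where m: "\<And>i. i \<ge> m \<Longrightarrow> \<bar>x i\<bar> \<le> 5/4 * (1/2) ^ n" "\<And>j. j \<ge> m \<Longrightarrow> c0s n x = iter_max n j x"
      "\<And>j v. j \<ge> m \<Longrightarrow> c0ds n x v = diter_max n j x v" using c0s_ex[OF x, of n] by blast
    have "diter_max n m x (unit_seq n) = 0" using a by (intro diter_max_unit_self(2)) (use zero_le_power[of "1/2::real" n] in linarith)
    thus ?thesis using m(3)[of m] t by simp
  qed
  thus "\<exists>c>0. \<forall>x\<in>c0V. \<bar>x n\<bar> \<le> c \<longrightarrow> \<bar>c0ds n x (unit_seq n)\<bar> \<le> t" by (intro exI[of _ "(1/2) ^ n"]) simp
next
  fix x M assume x: "x \<in> c0V"
  have "\<exists>M'. \<forall>m\<ge>M'. c0ds n x (unit_seq m) = 0" for n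
  proof -
    obtain m where m: "\<And>i. i \<ge> m \<Longrightarrow> \<bar>x i\<bar> \<le> 5/4 * (1/2) ^ n" "\<And>j. j \<ge> m \<Longrightarrow> c0s n x = iter_max n j x"
      "\<And>j v. j \<ge> m \<Longrightarrow> c0ds n x v = diter_max n j x v" using c0s_ex[OF x, of n] by blast
    show ?thesis using diter_max_unit_far[OF m(1)] m(3)[of m] by (intro exI[of _ "n + m"]) simp
  qed
  \<comment> \<open>Each \<open>s n\<close> ignores far coordinates, so both sides are eventually 0
    and the constant \<open>a = 1\<close> will do.\<close>
  hence "\<exists>M'. \<forall>m\<ge>M'. \<forall>m'\<ge>M'. 1 * c0ds n x (unit_seq m) = 1 * c0ds n x (unit_seq m')" for n by (metis (full_types))
  thus "\<exists>a. (\<forall>m\<ge>M. 0 < a m) \<and> (\<forall>n. \<exists>M'. \<forall>m\<ge>M'. \<forall>m'\<ge>M'. a m' * c0ds n x (unit_seq m) = a m * c0ds n x (unit_seq m'))"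
    by (intro exI[of _ "\<lambda>_. 1"]) auto
qed

section \<open>Transfer to the concrete spaces\<close>

context seq_lattice
begin

text \<open>\<open>sp_deriv\<close> is an arbitrary choice, unrestricted off the carrier; uniqueness
  on \<open>V\<close> is what identifies it with a constructed derivative.\<close>

lemma deriv_unique:
  assumes x: "x \<in> V" and L: "bdd_lin L" and M: "bdd_lin M"
    and dL: "\<And>e. e > 0 \<Longrightarrow> \<exists>d>0. \<forall>h\<in>V. N h < d \<longrightarrow> norm (f (x + h) - f x - L h) \<le> e * N h"
    and dM: "\<And>e. e > 0 \<Longrightarrow> \<exists>d>0. \<forall>h\<in>V. N h < d \<longrightarrow> norm (f (x + h) - f x - M h) \<le> e * N h"
    and v: "v \<in> V"
  shows "L v = M v"
proof -
  have bdd_lin: "bdd_lin (\<lambda>v. L v - M v)" using bdd_lin_plus[OF L bdd_lin_cmult[OF M, of "-1"]] by simp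
  have "norm (L v - M v) \<le> 0 + e" if e: "e > 0" for e
  proof -
    define e' where "e' = e / (2 * (N v + 1))"
    have nv: "0 \<le> N v" using v by (rule norm_nonneg)
    have e': "e' > 0" using e nv by (simp add: e'_def)
    obtain d where d: "d > 0" "\<forall>h\<in>V. N h < d \<longrightarrow> norm (f (x + h) - f x - L h) \<le> e' * N h" using dL[OF e'] by blast
    obtain d' where d': "d' > 0" "\<forall>h\<in>V. N h < d' \<longrightarrow> norm (f (x + h) - f x - M h) \<le> e' * N h" using dM[OF e'] by blast
    have "norm (L v - M v) \<le> (2 * e') * N v"
    proof (rule bdd_lin_norm_le[OF bdd_lin, of "min d d'" x])
      fix h assume h: "h \<in> V" "N h < min d d'"
      have "norm (L h - M h) = norm ((f (x + h) - f x - M h) - (f (x + h) - f x - L h))" by simp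
      also have "\<dots> \<le> norm (f (x + h) - f x - M h) + norm (f (x + h) - f x - L h)" by (rule norm_triangle_ineq4)
      also have "\<dots> \<le> e' * N h + e' * N h" using d d' h by (intro add_mono) auto
      finally show "norm (L h - M h) \<le> (2 * e') * N h" by simp
    qed (use d d' x v in auto)
    also have "\<dots> \<le> e" using e nv by (simp add: e'_def field_simps)
    finally show ?thesis by simp
  qed
  hence "norm (L v - M v) \<le> 0" by (rule field_le_epsilon)
  thus ?thesis by simp
qed

text \<open>Mean value inequality for \<open>t \<mapsto> f (w t) - t * Df x v\<close> along the
  segment from \<open>z\<close> to \<open>y\<close>, which stays in the ball by convexity.\<close>

lemma strict_deriv_of_C1:
  fixes f :: "(nat \<Rightarrow> real) \<Rightarrow> 'b::real_normed_vector"
  assumes bdd_lin: "\<And>x. x \<in> V \<Longrightarrow> bdd_lin (Df x)"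
    and deriv: "\<And>x e. x \<in> V \<Longrightarrow> e > 0 \<Longrightarrow> \<exists>d>0. \<forall>h\<in>V. N h < d \<longrightarrow> norm (f (x + h) - f x - Df x h) \<le> e * N h"
    and cont: "\<And>x e. x \<in> V \<Longrightarrow> e > 0 \<Longrightarrow> \<exists>d>0. \<forall>y\<in>V. N (y - x) < d \<longrightarrow> (\<forall>v\<in>V. norm (Df y v - Df x v) \<le> e * N v)"
    and x: "x \<in> V"
  shows "strict_deriv f (Df x) x"
  unfolding strict_deriv_def
proof (intro conjI allI impI)
  show "bdd_lin (Df x)" using bdd_lin x .
  fix e :: real assume e: "e > 0"
  obtain d where d: "d > 0" "\<And>y v. y \<in> V \<Longrightarrow> N (y - x) < d \<Longrightarrow> v \<in> V \<Longrightarrow> norm (Df y v - Df x v) \<le> e * N v"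
    using cont[OF x e] by blast
  have "norm (f y - f z - Df x (y - z)) \<le> e * N (y - z)"
    if yz: "y \<in> V" "z \<in> V" "N (y - x) < d" "N (z - x) < d" for y z
  proof -
    define v where "v = y - z"
    have v: "v \<in> V" using yz by (simp add: v_def diff_mem)
    define w where "w t = z + scl t v" for t
    have wV: "w t \<in> V" for t using yz v by (simp add: w_def add_mem scl_mem)
    have ws: "w s = w t + scl (s - t) v" for s t by (auto simp: w_def fun_eq_iff algebra_simps)
    have wd: "((\<lambda>t. f (w t)) has_vector_derivative Df (w t) v) (at t)" for t
      unfolding has_vector_derivative_def has_derivative_at_alt
    proof (intro conjI allI impI)
      show "bounded_linear (\<lambda>s. s *\<^sub>R Df (w t) v)" by (rule bounded_linear_scaleR_left)
      fix a :: real assume a: "a > 0"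
      define a' where "a' = a / (N v + 1)"
      have nv: "0 \<le> N v" using v by (rule norm_nonneg)
      have a': "a' > 0" "a' * N v \<le> a" using a nv by (simp_all add: a'_def field_simps)
      obtain \<eta> where \<eta>: "\<eta> > 0" "\<forall>h\<in>V. N h < \<eta> \<longrightarrow> norm (f (w t + h) - f (w t) - Df (w t) h) \<le> a' * N h"
        using deriv[OF wV a'(1)] by blast
      have "norm (f (w s) - f (w t) - (s - t) *\<^sub>R Df (w t) v) \<le> a * norm (s - t)"
        if s: "norm (s - t) < \<eta> / (N v + 1)" for s
      proof -
        have h: "scl (s - t) v \<in> V" "N (scl (s - t) v) = \<bar>s - t\<bar> * N v" using v by (simp_all add: scl_mem norm_scl)
        have "\<bar>s - t\<bar> * N v \<le> \<bar>s - t\<bar> * (N v + 1)" by (intro mult_left_mono) auto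
        also have "\<dots> < \<eta>" using s nv by (simp add: field_simps)
        finally have "norm (f (w s) - f (w t) - Df (w t) (scl (s - t) v)) \<le> a' * (\<bar>s - t\<bar> * N v)"
          using \<eta>(2) h ws[of s t] by metis
        also have "\<dots> = a' * N v * \<bar>s - t\<bar>" by simp
        also have "\<dots> \<le> a * \<bar>s - t\<bar>" using a'(2) by (intro mult_right_mono) auto
        finally show ?thesis using bdd_lin_scl[OF bdd_lin[OF wV] v] by simp
      qed
      thus "\<exists>d>0. \<forall>s. norm (s - t) < d \<longrightarrow> norm (f (w s) - f (w t) - (s - t) *\<^sub>R Df (w t) v) \<le> a * norm (s - t)"
        using \<eta>(1) nv by (intro exI[of _ "\<eta> / (N v + 1)"]) auto
    qed
    define g where "g t = f (w t) - t *\<^sub>R Df x v" for t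
    have gd: "(g has_vector_derivative (Df (w t) v - Df x v)) (at t)" for t
      unfolding g_def[abs_def] using wd[of t] by (auto intro!: derivative_eq_intros)
    have gc: "continuous_on {0..1} g"
      using gd has_vector_derivative_continuous by (intro continuous_at_imp_continuous_on) blast
    have "norm (g 1 - g 0) \<le> e * N v * 1 - e * N v * 0"
    proof (rule differentiable_bound_general[of 0 1 g "\<lambda>t. e * N v * t" "\<lambda>t. Df (w t) v - Df x v" "\<lambda>t. e * N v"])
      fix t :: real assume t: "0 < t" "t < 1"
      show "((\<lambda>t. e * N v * t) has_vector_derivative e * N v) (at t)"
        by (auto intro!: derivative_eq_intros simp: has_real_derivative_iff_has_vector_derivative[symmetric])
      have "w t - x = scl t (y - x) + scl (1 - t) (z - x)" by (auto simp: w_def v_def fun_eq_iff algebra_simps)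
      hence "N (w t - x) \<le> t * N (y - x) + (1 - t) * N (z - x)"
        using norm_add[of "scl t (y - x)" "scl (1 - t) (z - x)"] t yz x by (simp add: scl_mem diff_mem norm_scl)
      also have "\<dots> < d" using convex_bound_lt[OF yz(3,4), of t "1 - t"] t by simp
      finally show "norm (Df (w t) v - Df x v) \<le> e * N v" using d(2)[OF wV _ v] by blast
    qed (use gc gd in \<open>auto intro!: continuous_intros\<close>)
    moreover have "w 1 = y" "w 0 = z" by (auto simp: w_def v_def fun_eq_iff)
    ultimately show ?thesis by (simp add: g_def v_def algebra_simps)
  qed
  thus "\<exists>d>0. \<forall>y\<in>V. \<forall>z\<in>V. N (y - x) < d \<longrightarrow> N (z - x) < d \<longrightarrow> norm (f y - f z - Df x (y - z)) \<le> e * N (y - z)"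
    using d(1) by blast
qed

end

section \<open>Derivatives and operator norms in the given encoding\<close>

locale carrier_space = seq_space +
  fixes S :: seqspace
  assumes carrier: "sp_carrier S = V" and nrm: "sp_norm S = N"
begin

lemma bounded_linear_iff: "sp_bounded_linear S L \<longleftrightarrow> bdd_lin L"
  unfolding sp_bounded_linear_def bdd_lin_def carrier nrm by (simp add: plus_fun_def scl_def)

lemma has_deriv_iff:
  "sp_has_deriv S f L x \<longleftrightarrow> bdd_lin L \<and> (\<forall>e>0. \<exists>d>0. \<forall>h\<in>V. N h < d \<longrightarrow> norm (f (x + h) - f x - L h) \<le> e * N h)"
  unfolding sp_has_deriv_def bounded_linear_iff carrier nrm by (simp add: plus_fun_def)

lemma sp_deriv_eq:
  assumes "x \<in> V" "sp_has_deriv S f L x" "v \<in> V"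
  shows "sp_deriv S f x v = L v"
proof -
  have s: "sp_has_deriv S f (sp_deriv S f x) x" unfolding sp_deriv_def
    by (rule someI[where P = "\<lambda>L. sp_has_deriv S f L x", OF assms(2)])
  note a = s[unfolded has_deriv_iff] assms(2)[unfolded has_deriv_iff]
  show ?thesis by (rule deriv_unique[OF assms(1) _ _ _ _ assms(3), where f = f]) (use a in blast)+
qed

lemma opnorm_le: "(\<And>v. v \<in> V \<Longrightarrow> norm (L v) \<le> K * N v) \<Longrightarrow> K \<ge> 0 \<Longrightarrow> sp_opnorm S L \<le> K"
  unfolding sp_opnorm_def carrier nrm
proof (rule cSup_least)
  show "{norm (L u) |u. u \<in> V \<and> N u \<le> 1} \<noteq> {}" using zero_mem norm_zero' by fastforce
  fix a assume L: "\<And>v. v \<in> V \<Longrightarrow> norm (L v) \<le> K * N v" and K: "K \<ge> 0" and "a \<in> {norm (L u) |u. u \<in> V \<and> N u \<le> 1}"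
  then obtain u where u: "u \<in> V" "N u \<le> 1" "a = norm (L u)" by blast
  have "K * N u \<le> K * 1" using u K by (intro mult_left_mono)
  thus "a \<le> K" using L[OF u(1)] u(3) by simp
qed

text \<open>A supremum dominates its set only if the set is bounded above, which is where
  boundedness of \<open>L\<close> enters; \<open>v\<close> is then normalized.\<close>

lemma le_opnorm: assumes L: "bdd_lin L" and v: "v \<in> V" shows "norm (L v) \<le> sp_opnorm S L * N v"
proof (cases "N v = 0")
  case True
  have "v = 0" using norm_eq_0[OF v True] .
  hence "L v = 0" using bdd_lin_zero[OF L] by simp
  thus ?thesis using True by simp
next
  case False
  hence n: "N v > 0" using norm_nonneg[OF v] by simp
  obtain K where K: "K > 0" "\<forall>u\<in>V. norm (L u) \<le> K * N u" using bdd_lin_bound[OF L] by blast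
  have bdd: "bdd_above {norm (L u) |u. u \<in> V \<and> N u \<le> 1}"
  proof (rule bdd_aboveI[of _ K])
    fix a assume "a \<in> {norm (L u) |u. u \<in> V \<and> N u \<le> 1}"
    then obtain u where u: "u \<in> V" "N u \<le> 1" "a = norm (L u)" by blast
    have "K * N u \<le> K * 1" using u K by (intro mult_left_mono) auto
    thus "a \<le> K" using K(2) u by force
  qed
  define u where "u = scl (1 / N v) v"
  have u: "u \<in> V" "N u \<le> 1" using v n by (simp_all add: u_def scl_mem norm_scl)
  have "norm (L u) \<le> sp_opnorm S L"
    unfolding sp_opnorm_def carrier nrm using u by (intro cSup_upper bdd) blast
  moreover have "norm (L u) = norm (L v) / N v" using bdd_lin_scl[OF L v, of "1 / N v"] n by (simp add: u_def)
  ultimately show ?thesis using n by (simp add: field_simps)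
qed

theorem perturbation_concrete:
  fixes f :: "(nat \<Rightarrow> real) \<Rightarrow> real ^ 'd"
  assumes f: "sp_C1 S f" and \<epsilon>: "sp_continuous S \<epsilon>" "\<forall>x\<in>sp_carrier S. \<epsilon> x > 0"
    and U: "sp_open S U" and crit: "sp_critical S f \<subseteq> U"
  shows "\<exists>\<phi> :: (nat \<Rightarrow> real) \<Rightarrow> real ^ 'd. sp_C1 S \<phi> \<and>
     (\<forall>x\<in>sp_carrier S. norm (f x - \<phi> x) \<le> \<epsilon> x) \<and>
     (\<forall>x\<in>sp_carrier S - U. f x = \<phi> x) \<and>
     (\<forall>x\<in>sp_carrier S. sp_surj S (sp_deriv S \<phi> x)) \<and>
     (\<forall>x\<in>sp_carrier S. sp_opnorm S (\<lambda>u. sp_deriv S f x u - sp_deriv S \<phi> x u) \<le> \<epsilon> x)"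
proof -
  have mn: "(\<lambda>n. y n - x n) = y - x" for x y :: "nat \<Rightarrow> real" by (simp add: fun_diff_def)
  obtain Df where Df: "\<And>x. x \<in> V \<Longrightarrow> sp_has_deriv S f (Df x) x"
    "\<And>x e. x \<in> V \<Longrightarrow> e > 0 \<Longrightarrow> \<exists>d>0. \<forall>y\<in>V. N (y - x) < d \<longrightarrow> sp_opnorm S (\<lambda>u. Df y u - Df x u) \<le> e"
    using f unfolding sp_C1_def carrier nrm mn by blast
  have Dl: "bdd_lin (Df x)" if "x \<in> V" for x using Df(1)[OF that] by (simp add: has_deriv_iff)
  have "\<exists>d>0. \<forall>y\<in>V. N (y - x) < d \<longrightarrow> (\<forall>v\<in>V. norm (Df y v - Df x v) \<le> e * N v)" if x: "x \<in> V" and e: "e > 0" for x e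
  proof -
    obtain d where d: "d > 0" "\<forall>y\<in>V. N (y - x) < d \<longrightarrow> sp_opnorm S (\<lambda>u. Df y u - Df x u) \<le> e" using Df(2)[OF x e] by blast
    have "norm (Df y v - Df x v) \<le> e * N v" if y: "y \<in> V" "N (y - x) < d" and v: "v \<in> V" for y v
    proof -
      have "bdd_lin (\<lambda>v. Df y v - Df x v)" using bdd_lin_plus[OF Dl[OF y(1)] bdd_lin_cmult[OF Dl[OF x], of "-1"]] by simp
      from le_opnorm[OF this v] have "norm (Df y v - Df x v) \<le> sp_opnorm S (\<lambda>u. Df y u - Df x u) * N v" .
      also have "\<dots> \<le> e * N v" using d y norm_nonneg[OF v] by (intro mult_right_mono) auto
      finally show ?thesis .
    qed
    thus ?thesis using d(1) by blast
  qed
  note Dc = this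
  have sdf: "strict_deriv f (Df x) x" if x: "x \<in> V" for x
  proof (rule strict_deriv_of_C1[OF Dl _ Dc x])
    show "\<exists>d>0. \<forall>h\<in>V. N h < d \<longrightarrow> norm (f (x + h) - f x - Df x h) \<le> e * N h" if "x \<in> V" "e > 0" for x e
      using Df(1)[OF that(1)] that(2) unfolding has_deriv_iff by blast
  qed
  have Deq: "sp_deriv S f x v = Df x v" if "x \<in> V" "v \<in> V" for x v by (rule sp_deriv_eq[OF that(1) Df(1)[OF that(1)] that(2)])
  have surj: "Df x ` V = UNIV" if x: "x \<in> V - U" for x
  proof -
    have "sp_deriv S f x ` V = UNIV" using crit x unfolding sp_critical_def sp_surj_def carrier by blast
    moreover have "sp_deriv S f x ` V = Df x ` V" using Deq[of x] x by (intro image_cong) auto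
    ultimately show ?thesis by simp
  qed
  have e1: "\<epsilon> x > 0" if "x \<in> V" for x using \<epsilon>(2) that carrier by blast
  have e2: "\<exists>d>0. \<forall>y\<in>V. N (y - x) < d \<longrightarrow> \<bar>\<epsilon> y - \<epsilon> x\<bar> < e" if "x \<in> V" "e > 0" for x e
    using \<epsilon>(1) that unfolding sp_continuous_def carrier nrm mn by blast
  have U1: "U \<subseteq> V" using U unfolding sp_open_def carrier by blast
  have U2: "\<exists>d>0. \<forall>y\<in>V. N (y - x) < d \<longrightarrow> y \<in> U" if "x \<in> U" for x
    using U that unfolding sp_open_def carrier nrm mn by blast
  obtain \<phi> D\<phi> where P: "\<forall>x\<in>V. bdd_lin (D\<phi> x)"
    "\<forall>x\<in>V. \<forall>e>0. \<exists>d>0. \<forall>h\<in>V. N h < d \<longrightarrow> norm (\<phi> (x + h) - \<phi> x - D\<phi> x h) \<le> e * N h"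
    "\<forall>x\<in>V. \<forall>e>0. \<exists>d>0. \<forall>y\<in>V. N (y - x) < d \<longrightarrow> (\<forall>v\<in>V. norm (D\<phi> y v - D\<phi> x v) \<le> e * N v)"
    "\<forall>x\<in>V. norm (f x - \<phi> x) \<le> \<epsilon> x" "\<forall>x\<in>V - U. f x = \<phi> x" "\<forall>x\<in>V. D\<phi> x ` V = UNIV"
    "\<forall>x\<in>V. \<forall>v\<in>V. norm (Df x v - D\<phi> x v) \<le> \<epsilon> x * N v"
  proof -
    have "\<exists>\<phi> D\<phi>. (\<forall>x\<in>V. bdd_lin (D\<phi> x)) \<and>
    (\<forall>x\<in>V. \<forall>e>0. \<exists>d>0. \<forall>h\<in>V. N h < d \<longrightarrow> norm (\<phi> (x + h) - \<phi> x - D\<phi> x h) \<le> e * N h) \<and>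
    (\<forall>x\<in>V. \<forall>e>0. \<exists>d>0. \<forall>y\<in>V. N (y - x) < d \<longrightarrow> (\<forall>v\<in>V. norm (D\<phi> y v - D\<phi> x v) \<le> e * N v)) \<and>
    (\<forall>x\<in>V. norm (f x - \<phi> x) \<le> \<epsilon> x) \<and> (\<forall>x\<in>V - U. f x = \<phi> x) \<and> (\<forall>x\<in>V. D\<phi> x ` V = UNIV) \<and>
    (\<forall>x\<in>V. \<forall>v\<in>V. norm (Df x v - D\<phi> x v) \<le> \<epsilon> x * N v)"
      by (rule perturbation[where f = f and Df = Df and \<epsilon> = \<epsilon> and U = U])
         (erule sdf, erule e1, erule (1) e2, rule U1, erule U2, erule surj)
    thus thesis using that by (elim exE conjE)
  qed
  have hd: "sp_has_deriv S \<phi> (D\<phi> x) x" if "x \<in> V" for x using P(1,2) that unfolding has_deriv_iff by blast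
  have eq: "sp_deriv S \<phi> x v = D\<phi> x v" if "x \<in> V" "v \<in> V" for x v by (rule sp_deriv_eq[OF that(1) hd[OF that(1)] that(2)])
  have "sp_C1 S \<phi>"
    unfolding sp_C1_def carrier nrm mn
  proof (intro exI[of _ D\<phi>] conjI ballI allI impI)
    fix x and e :: real assume x: "x \<in> V" and e: "e > 0"
    obtain d where d: "d > 0" "\<forall>y\<in>V. N (y - x) < d \<longrightarrow> (\<forall>v\<in>V. norm (D\<phi> y v - D\<phi> x v) \<le> e * N v)" using P(3) x e by blast
    show "\<exists>d>0. \<forall>y\<in>V. N (y - x) < d \<longrightarrow> sp_opnorm S (\<lambda>u. D\<phi> y u - D\<phi> x u) \<le> e"
      using d e by (intro exI[of _ d] conjI ballI impI opnorm_le) auto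
  qed (rule hd)
  moreover have "sp_surj S (sp_deriv S \<phi> x)" if x: "x \<in> V" for x
  proof -
    have "sp_deriv S \<phi> x ` V = D\<phi> x ` V" using eq[OF x] by (intro image_cong) auto
    thus ?thesis using P(6) x by (simp add: sp_surj_def carrier)
  qed
  moreover have "sp_opnorm S (\<lambda>u. sp_deriv S f x u - sp_deriv S \<phi> x u) \<le> \<epsilon> x" if x: "x \<in> V" for x
    using P(7) x e1[OF x] by (intro opnorm_le) (auto simp: eq[OF x] Deq[OF x])
  ultimately show ?thesis using P(4,5) unfolding carrier by blast
qed

end

theorem theorem1p1:
  fixes S :: seqspace
    and f :: "(nat \<Rightarrow> real) \<Rightarrow> real ^ 'd"
    and \<epsilon> :: "(nat \<Rightarrow> real) \<Rightarrow> real"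
    and U :: "(nat \<Rightarrow> real) set"
  assumes "valid_space S"
    and "sp_C1 S f"
    and "sp_continuous S \<epsilon>"
    and "\<forall>x\<in>sp_carrier S. \<epsilon> x > 0"
    and "sp_open S U"
    and "sp_critical S f \<subseteq> U"
  shows "\<exists>\<phi> :: (nat \<Rightarrow> real) \<Rightarrow> real ^ 'd. sp_C1 S \<phi> \<and>
     (\<forall>x\<in>sp_carrier S. norm (f x - \<phi> x) \<le> \<epsilon> x) \<and>
     (\<forall>x\<in>sp_carrier S - U. f x = \<phi> x) \<and>
     (\<forall>x\<in>sp_carrier S. sp_surj S (sp_deriv S \<phi> x)) \<and>
     (S = C0 \<longrightarrow> (\<forall>x\<in>sp_carrier S.
        sp_opnorm S (\<lambda>u. sp_deriv S f x u - sp_deriv S \<phi> x u) \<le> \<epsilon> x))"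
proof -
  have "\<exists>V N s ds. carrier_space V N s ds S"
  proof (cases S)
    case C0
    have "carrier_space c0V c0N c0s c0ds S"
      by (intro carrier_space.intro carrier_space_axioms.intro c0.seq_space_axioms)
         (auto simp: C0 sp_carrier_def sp_norm_def c0V_def c0N_def fun_eq_iff)
    thus ?thesis by blast
  next
    case (Lp p)
    interpret lp p using assms(1) by unfold_locales (simp add: Lp valid_space_def)
    have "carrier_space (lp.V p) (lp.N p) (lp.s p) (lp.ds p) S"
      by (intro carrier_space.intro carrier_space_axioms.intro seq_space_axioms)
         (auto simp: Lp sp_carrier_def sp_norm_def V_def N_def S_def fun_eq_iff)
    thus ?thesis by blast
  qed
  then obtain V N s ds where "carrier_space V N s ds S" by blast
  from carrier_space.perturbation_concrete[OF this assms(2-6)] show ?thesis by blast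
qed

end
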